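(* Let $n\ge 1$. Suppose $M$ is a connected real-analytic submanifold of $\mathbb{R}^{2n}$ which is not contained in any affine hyperplane of $\mathbb{R}^{2n}$. Let $\mu$ be a smooth measure on $M$. Then the Weyl transform $W(\mu)$ is a compact operator on $L^2(\mathbb{R}^n)$.
   Context: A smooth measure on a smooth submanifold $M$ of $\mathbb{R}^{N}$ is a measure of the form $\mu=\psi\sigma$, where $\sigma$ is the measure on $M$ induced by Lebesgue measure on $\mathbb{R}^N$ (the Riemannian volume measure of the metric induced on $M$), and $\psi$ is a smooth (complex-valued) function on $\mathbb{R}^N$ whose support intersects $M$ in a compact set. Such a $\mu$ is regarded as a finite (complex) Borel measure on $\mathbb{R}^N$. For a finite (complex) Borel measure $\lambda$ on $\mathbb{R}^{2n}=\mathbb{R}^n\times\mathbb{R}^n$, the Weyl transform of $\lambda$ is the bounded operator $W(\lambda)$ on $L^2(\mathbb{R}^n)$ defined by $$(W(\lambda)\varphi)(t)=\int_{\mathbb{R}^{2n}} e^{\pi i(x\cdot y+2y\cdot t)}\,\varphi(t+x)\,d\lambda(x,y),\qquad \varphi\in L^2(\mathbb{R}^n).$$ Equivalently, $W(\lambda)=\int_{\mathbb{R}^{2n}}\rho(x,y,1)\,d\lambda(x,y)$ as a weak integral, where $(\rho(x,y,1)\varphi)(t)=e^{\pi i(x\cdot y+2y\cdot t)}\varphi(t+x)$. *)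

theory Defs
  imports "HOL-Analysis.Analysis"
begin

section \<open>Smooth and real-analytic maps\<close>

primrec Ck_on :: "nat \<Rightarrow> 'a set \<Rightarrow> ('a::real_normed_vector \<Rightarrow> 'b::real_normed_vector) \<Rightarrow> bool"
  where
    "Ck_on 0 S f \<longleftrightarrow> continuous_on S f"
  | "Ck_on (Suc k) S f \<longleftrightarrow> (\<forall>x\<in>S. f differentiable (at x)) \<and>
       (\<forall>v. Ck_on k S (\<lambda>x. frechet_derivative f (at x) v))"

text \<open>Both notions below are meant for open \<open>S\<close>.\<close>

definition smooth_on :: "'a set \<Rightarrow> ('a::real_normed_vector \<Rightarrow> 'b::real_normed_vector) \<Rightarrow> bool"
  where "smooth_on S f \<longleftrightarrow> (\<forall>k. Ck_on k S f)"

text \<open>A multi-index is a map \<open>'a \<Rightarrow> nat\<close> vanishing outside \<open>Basis\<close>; the power series are summed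
  unconditionally, hence (the coefficients lying in a finite-dimensional space) absolutely.\<close>

definition multi_indices :: "('a::euclidean_space \<Rightarrow> nat) set"
  where "multi_indices = {\<alpha>. \<forall>b. b \<notin> Basis \<longrightarrow> \<alpha> b = 0}"

definition real_analytic_on ::
    "'a set \<Rightarrow> ('a::euclidean_space \<Rightarrow> 'b::euclidean_space) \<Rightarrow> bool"
  where "real_analytic_on S f \<longleftrightarrow>
    (\<forall>p\<in>S. \<exists>r>0. \<exists>c. \<forall>x\<in>ball p r.
       ((\<lambda>\<alpha>. (\<Prod>b\<in>Basis. ((x - p) \<bullet> b) ^ \<alpha> b) *\<^sub>R c \<alpha>) has_sum f x) multi_indices)"


section \<open>Submanifolds and smooth measures on them\<close>

text \<open>Submanifolds are embedded, and need not be closed. The dimension is \<open>CARD('k)\<close>, so it is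
  positive; a connected submanifold of dimension \<open>0\<close> has at most one point.\<close>

definition regular_parametrization ::
    "'a::euclidean_space set \<Rightarrow> (real^'k) set \<Rightarrow> (real^'k \<Rightarrow> 'a) \<Rightarrow> bool"
  where "regular_parametrization M V \<phi> \<longleftrightarrow>
    open V \<and> smooth_on V \<phi> \<and> (\<forall>x\<in>V. inj (frechet_derivative \<phi> (at x))) \<and>
    openin (top_of_set M) (\<phi> ` V) \<and> (\<exists>\<phi>'. homeomorphism V (\<phi> ` V) \<phi> \<phi>')"

definition real_analytic_submanifold ::
    "'k::finite itself \<Rightarrow> 'a::euclidean_space set \<Rightarrow> bool"
  where "real_analytic_submanifold k M \<longleftrightarrow>
    (\<forall>p\<in>M. \<exists>(V :: (real^'k) set) \<phi>.
       regular_parametrization M V \<phi> \<and> real_analytic_on V \<phi> \<and> p \<in> \<phi> ` V)"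

text \<open>The volume density of the metric induced on the image of \<open>\<phi>\<close>, i.e. the square root of the
  determinant of the matrix \<open>g\<^sub>i\<^sub>j = \<partial>\<^sub>i\<phi> \<bullet> \<partial>\<^sub>j\<phi>\<close>.\<close>

definition volume_density :: "(real^'k \<Rightarrow> 'a::euclidean_space) \<Rightarrow> real^'k \<Rightarrow> real"
  where "volume_density \<phi> x =
    sqrt (det (\<chi> i j. frechet_derivative \<phi> (at x) (axis i 1) \<bullet>
                      frechet_derivative \<phi> (at x) (axis j 1)))"

text \<open>The Riemannian volume measure of \<open>M\<close>, regarded as a Borel measure on the ambient space that
  is concentrated on \<open>M\<close>. For a submanifold \<open>M\<close> of dimension \<open>CARD('k)\<close> the conditions determine
  \<open>\<sigma>\<close>, as countably many parametrizations cover \<open>M\<close>.\<close>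

definition riemannian_volume ::
    "'k::finite itself \<Rightarrow> 'a::euclidean_space set \<Rightarrow> 'a measure \<Rightarrow> bool"
  where "riemannian_volume k M \<sigma> \<longleftrightarrow>
    sets \<sigma> = sets borel \<and>
    (\<forall>A\<in>sets borel. A \<inter> M = {} \<longrightarrow> emeasure \<sigma> A = 0) \<and>
    (\<forall>(V :: (real^'k) set) \<phi>. regular_parametrization M V \<phi> \<longrightarrow>
      (\<forall>A\<in>sets borel. A \<subseteq> V \<longrightarrow>
         emeasure \<sigma> (\<phi> ` A) = (\<integral>\<^sup>+x\<in>A. ennreal (volume_density \<phi> x) \<partial>lborel)))"

text \<open>A finite complex Borel measure is given by its set function, of which only the values on Borel
  sets matter.\<close>

definition smooth_measure ::
    "'k::finite itself \<Rightarrow> 'a::euclidean_space set \<Rightarrow> ('a set \<Rightarrow> complex) \<Rightarrow> bool"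
  where "smooth_measure k M \<mu> \<longleftrightarrow>
    (\<exists>\<sigma> \<psi>. riemannian_volume k M \<sigma> \<and> smooth_on UNIV \<psi> \<and>
       compact (closure {z. \<psi> z \<noteq> 0} \<inter> M) \<and>
       (\<forall>A\<in>sets borel. \<mu> A = (LINT z:A|\<sigma>. \<psi> z)))"


section \<open>Integration against complex measures\<close>

definition has_complex_density ::
    "('a::topological_space set \<Rightarrow> complex) \<Rightarrow> 'a measure \<Rightarrow> ('a \<Rightarrow> complex) \<Rightarrow> bool"
  where "has_complex_density \<mu> \<nu> h \<longleftrightarrow>
    sets \<nu> = sets borel \<and> integrable \<nu> h \<and> (\<forall>A\<in>sets borel. \<mu> A = (LINT z:A|\<nu>. h z))"

text \<open>Every finite complex Borel measure is of the form \<open>h \<nu>\<close> with \<open>\<nu>\<close> positive (for instance by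
  polar decomposition, \<open>\<nu> = \<bar>\<mu>\<bar>\<close>). For Borel \<open>f\<close> the integral does not depend on the choice
  of \<open>\<nu>\<close> and \<open>h\<close>, see \<open>complex_integral_eq\<close> below.\<close>

definition complex_integral ::
    "('a::topological_space set \<Rightarrow> complex) \<Rightarrow> ('a \<Rightarrow> complex) \<Rightarrow> complex"
  where "complex_integral \<mu> f =
    (THE I. \<exists>\<nu> h. has_complex_density \<mu> \<nu> h \<and> I = (LINT z|\<nu>. f z * h z))"

lemma complex_density_unique:
  assumes 1: "has_complex_density \<mu> \<nu>1 h1" and 2: "has_complex_density \<mu> \<nu>2 h2"
    and f[measurable]: "f \<in> borel_measurable borel"
  shows "(LINT z|\<nu>1. f z * h1 z) = (LINT z|\<nu>2. f z * h2 z)"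
proof -
  define \<kappa>1 where "\<kappa>1 = density \<nu>1 (\<lambda>z. ennreal (cmod (h1 z)))"
  define \<kappa>2 where "\<kappa>2 = density \<nu>2 (\<lambda>z. ennreal (cmod (h2 z)))"
  have s[measurable_cong]: "sets \<nu>1 = sets borel" "sets \<nu>2 = sets borel"
    using 1 2 by (auto simp: has_complex_density_def)
  have i: "integrable \<nu>1 h1" "integrable \<nu>2 h2"
    using 1 2 by (auto simp: has_complex_density_def)
  have [measurable]: "h1 \<in> borel_measurable borel" "h2 \<in> borel_measurable borel"
    using borel_measurable_integrable[OF i(1)] borel_measurable_integrable[OF i(2)] by simp_all
  have k[measurable_cong]: "sets \<kappa>1 = sets borel" "sets \<kappa>2 = sets borel"
    by (simp_all add: \<kappa>1_def \<kappa>2_def s)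
  have sp: "space \<kappa>1 = UNIV" "space \<kappa>2 = UNIV"
    using sets_eq_imp_space_eq[OF k(1)] sets_eq_imp_space_eq[OF k(2)] by simp_all
  have "emeasure \<kappa>1 (space \<kappa>1) = (\<integral>\<^sup>+z. norm (h1 z) \<partial>\<nu>1)"
    by (simp add: \<kappa>1_def emeasure_density cong: nn_integral_cong)
  also have "\<dots> < \<infinity>"
    using i(1) by (simp add: integrable_iff_bounded)
  finally have f1: "finite_measure \<kappa>1" by (intro finite_measureI) simp
  have "emeasure \<kappa>2 (space \<kappa>2) = (\<integral>\<^sup>+z. norm (h2 z) \<partial>\<nu>2)"
    by (simp add: \<kappa>2_def emeasure_density cong: nn_integral_cong)
  also have "\<dots> < \<infinity>"
    using i(2) by (simp add: integrable_iff_bounded)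
  finally have f2: "finite_measure \<kappa>2" by (intro finite_measureI) simp
  have J1: "(LINT z|\<nu>1. g z * h1 z) = (LINT z|\<kappa>1. g z * sgn (h1 z))"
    if [measurable]: "g \<in> borel_measurable borel" for g
    unfolding \<kappa>1_def
    by (subst integral_density)
      (auto simp: sgn_div_norm scaleR_conv_of_real field_simps intro!: Bochner_Integration.integral_cong)
  have J2: "(LINT z|\<nu>2. g z * h2 z) = (LINT z|\<kappa>2. g z * sgn (h2 z))"
    if [measurable]: "g \<in> borel_measurable borel" for g
    unfolding \<kappa>2_def
    by (subst integral_density)
      (auto simp: sgn_div_norm scaleR_conv_of_real field_simps intro!: Bochner_Integration.integral_cong)
  define \<kappa> where "\<kappa> = measure_of UNIV (sets borel) (\<lambda>A. emeasure \<kappa>1 A + emeasure \<kappa>2 A)"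
  have sk[measurable_cong]: "sets \<kappa> = sets borel"
    using sets.sigma_sets_eq[of borel] by (simp add: \<kappa>_def sets.sets_into_space)
  have ek: "emeasure \<kappa> A = emeasure \<kappa>1 A + emeasure \<kappa>2 A" if "A \<in> sets borel" for A
  proof (rule emeasure_measure_of[OF \<kappa>_def])
    show "countably_additive (sets \<kappa>) (\<lambda>A. emeasure \<kappa>1 A + emeasure \<kappa>2 A)"
      by (auto simp: countably_additive_def sk k suminf_add[symmetric] suminf_emeasure
          image_subset_iff)
  qed (use that in \<open>auto simp: positive_def sk\<close>)
  have fk: "finite_measure \<kappa>"
    using finite_measure.emeasure_finite[OF f1, of UNIV] finite_measure.emeasure_finite[OF f2, of UNIV]
    by (intro finite_measureI) (simp add: ek sets_eq_imp_space_eq[OF sk])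
  interpret \<kappa>: finite_measure \<kappa> by (rule fk)
  have ac: "absolutely_continuous \<kappa> \<kappa>1" "absolutely_continuous \<kappa> \<kappa>2"
    by (auto simp: absolutely_continuous_def null_sets_def sk k ek)
  have RN: "\<exists>d\<in>borel_measurable borel. (\<forall>z. 0 \<le> d z) \<and> N = density \<kappa> (\<lambda>z. ennreal (d z))"
    if N: "finite_measure N" "absolutely_continuous \<kappa> N" "sets N = sets borel" for N
  proof -
    have sN: "sets N = sets \<kappa>" using N(3) sk by simp
    obtain d where d: "d \<in> borel_measurable \<kappa>" "AE z in \<kappa>. RN_deriv \<kappa> N z = ennreal (d z)"
        "\<And>z. 0 \<le> d z"
      using \<kappa>.real_RN_deriv[OF N(1,2) sN] by metis
    have "N = density \<kappa> (RN_deriv \<kappa> N)"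
      using \<kappa>.density_RN_deriv[OF N(2) sN] by simp
    also have "\<dots> = density \<kappa> (\<lambda>z. ennreal (d z))"
      using d by (intro density_cong) auto
    finally have "N = density \<kappa> (\<lambda>z. ennreal (d z))" .
    moreover have "d \<in> borel_measurable borel"
      using d(1) measurable_cong_sets[OF sk refl] by simp
    ultimately show ?thesis using d(3) by blast
  qed
  obtain d1 where [measurable]: "d1 \<in> borel_measurable borel"
    and d1: "\<And>z. 0 \<le> d1 z" "\<kappa>1 = density \<kappa> (\<lambda>z. ennreal (d1 z))"
    using RN[OF f1 ac(1) k(1)] by blast
  obtain d2 where [measurable]: "d2 \<in> borel_measurable borel"
    and d2: "\<And>z. 0 \<le> d2 z" "\<kappa>2 = density \<kappa> (\<lambda>z. ennreal (d2 z))"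
    using RN[OF f2 ac(2) k(2)] by blast
  have L1: "(LINT z|\<nu>1. g z * h1 z) = (LINT z|\<kappa>. g z * (d1 z *\<^sub>R sgn (h1 z)))"
    if [measurable]: "g \<in> borel_measurable borel" for g
    unfolding J1[OF that] d1(2) by (subst integral_density) (auto simp: d1(1))
  have L2: "(LINT z|\<nu>2. g z * h2 z) = (LINT z|\<kappa>. g z * (d2 z *\<^sub>R sgn (h2 z)))"
    if [measurable]: "g \<in> borel_measurable borel" for g
    unfolding J2[OF that] d2(2) by (subst integral_density) (auto simp: d2(1))
  have "integrable \<kappa>1 (\<lambda>z. sgn (h1 z))"
    by (rule finite_measure.integrable_const_bound[OF f1, of _ 1]) (auto simp: norm_sgn)
  then have I1: "integrable \<kappa> (\<lambda>z. d1 z *\<^sub>R sgn (h1 z))"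
    unfolding d1(2) by (subst (asm) integrable_density) (auto simp: d1(1))
  have "integrable \<kappa>2 (\<lambda>z. sgn (h2 z))"
    by (rule finite_measure.integrable_const_bound[OF f2, of _ 1]) (auto simp: norm_sgn)
  then have I2: "integrable \<kappa> (\<lambda>z. d2 z *\<^sub>R sgn (h2 z))"
    unfolding d2(2) by (subst (asm) integrable_density) (auto simp: d2(1))
  have AE: "AE z in \<kappa>. d1 z *\<^sub>R sgn (h1 z) = d2 z *\<^sub>R sgn (h2 z)"
  proof (rule \<kappa>.density_unique_banach[OF I1 I2])
    fix A assume "A \<in> sets \<kappa>"
    then have A[measurable]: "A \<in> sets borel" by (simp add: sk)
    have m: "(\<lambda>z. indicator A z :: complex) \<in> borel_measurable borel" by measurable
    have e: "indicator A z *\<^sub>R w = indicator A z * w" for z :: 'a and w :: complex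
      by (simp add: indicator_def)
    have "(LINT z:A|\<nu>1. h1 z) = (LINT z:A|\<nu>2. h2 z)"
      using 1 2 A unfolding has_complex_density_def by metis
    then show "(LINT z:A|\<kappa>. d1 z *\<^sub>R sgn (h1 z)) = (LINT z:A|\<kappa>. d2 z *\<^sub>R sgn (h2 z))"
      unfolding set_lebesgue_integral_def e L1[OF m] L2[OF m] .
  qed
  show ?thesis
    unfolding L1[OF f] L2[OF f]
  proof (rule integral_cong_AE)
    show "AE z in \<kappa>. f z * (d1 z *\<^sub>R sgn (h1 z)) = f z * (d2 z *\<^sub>R sgn (h2 z))"
      using AE by eventually_elim simp
  qed simp_all
qed

lemma complex_integral_eq:
  assumes "has_complex_density \<mu> \<nu> h" and "f \<in> borel_measurable borel"
  shows "complex_integral \<mu> f = (LINT z|\<nu>. f z * h z)"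
  unfolding complex_integral_def
  using assms by (intro the_equality) (auto intro: complex_density_unique)


section \<open>The Hilbert space of square-integrable functions\<close>

text \<open>Representatives are Borel measurable (not just Lebesgue measurable), so that they can be
  integrated against singular Borel measures.\<close>

definition square_integrable :: "('a::euclidean_space \<Rightarrow> complex) \<Rightarrow> bool"
  where "square_integrable f \<longleftrightarrow>
    f \<in> borel_measurable borel \<and> integrable lborel (\<lambda>t. (cmod (f t))\<^sup>2)"

definition L2_rel :: "('a::euclidean_space \<Rightarrow> complex) \<Rightarrow> ('a \<Rightarrow> complex) \<Rightarrow> bool"
  where "L2_rel f g \<longleftrightarrow>
    square_integrable f \<and> square_integrable g \<and> (AE t in lborel. f t = g t)"

lemma square_integrable_0: "square_integrable (\<lambda>_. 0)"
  by (simp add: square_integrable_def)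

lemma part_equivp_L2_rel: "part_equivp (L2_rel :: ('a::euclidean_space \<Rightarrow> complex) \<Rightarrow> _)"
proof (rule part_equivpI)
  show "\<exists>f. L2_rel f (f :: 'a \<Rightarrow> complex)"
    using square_integrable_0 by (auto simp: L2_rel_def)
  show "symp (L2_rel :: ('a \<Rightarrow> complex) \<Rightarrow> _)"
    by (auto simp: symp_def L2_rel_def elim: eventually_mono)
  show "transp (L2_rel :: ('a \<Rightarrow> complex) \<Rightarrow> _)"
    by (auto simp: transp_def L2_rel_def elim: eventually_elim2)
qed

quotient_type (overloaded) 'a L2 = "'a::euclidean_space \<Rightarrow> complex" / partial: L2_rel
  by (rule part_equivp_L2_rel)

lemma square_integrable_add:
  assumes f: "square_integrable f" and g: "square_integrable g"
  shows "square_integrable (\<lambda>t. f t + g t)"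
proof -
  have [measurable]: "f \<in> borel_measurable borel" "g \<in> borel_measurable borel"
    using f g by (auto simp: square_integrable_def)
  have i: "integrable lborel (\<lambda>t. 2 * (cmod (f t))\<^sup>2 + 2 * (cmod (g t))\<^sup>2)"
    using f g by (auto simp: square_integrable_def)
  have b: "(cmod (a + c))\<^sup>2 \<le> 2 * (cmod a)\<^sup>2 + 2 * (cmod c)\<^sup>2" for a c :: complex
  proof -
    have "(cmod (a + c))\<^sup>2 \<le> (cmod a + cmod c)\<^sup>2"
      by (intro power_mono norm_triangle_ineq) auto
    also have "\<dots> \<le> 2 * (cmod a)\<^sup>2 + 2 * (cmod c)\<^sup>2"
      using sum_squares_bound[of "cmod a" "cmod c"] by (simp add: power2_sum)
    finally show ?thesis .
  qed
  have "integrable lborel (\<lambda>t. (cmod (f t + g t))\<^sup>2)"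
    by (rule Bochner_Integration.integrable_bound[OF i]) (auto intro!: AE_I2 order_trans[OF b])
  then show ?thesis by (simp add: square_integrable_def)
qed

lemma square_integrable_mult:
  assumes "square_integrable f" shows "square_integrable (\<lambda>t. c * f t)"
  using assms by (auto simp: square_integrable_def norm_mult power_mult_distrib)

lemma square_integrable_inner:
  assumes f: "square_integrable f" and g: "square_integrable g"
  shows "integrable lborel (\<lambda>t. f t \<bullet> g t)"
proof -
  have [measurable]: "f \<in> borel_measurable borel" "g \<in> borel_measurable borel"
    using f g by (auto simp: square_integrable_def)
  have i: "integrable lborel (\<lambda>t. (cmod (f t))\<^sup>2 + (cmod (g t))\<^sup>2)"
    using f g by (auto simp: square_integrable_def)
  have b: "\<bar>a \<bullet> c\<bar> \<le> (cmod a)\<^sup>2 + (cmod c)\<^sup>2" for a c :: complex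
  proof -
    have "\<bar>a \<bullet> c\<bar> \<le> cmod a * cmod c" by (rule Cauchy_Schwarz_ineq2)
    also have "\<dots> \<le> (cmod a)\<^sup>2 + (cmod c)\<^sup>2"
      using sum_squares_bound[of "cmod a" "cmod c"] mult_nonneg_nonneg[of "cmod a" "cmod c"]
        norm_ge_zero[of a] norm_ge_zero[of c] by linarith
    finally show ?thesis .
  qed
  show ?thesis
    by (rule Bochner_Integration.integrable_bound[OF i]) (auto intro!: AE_I2 order_trans[OF b])
qed

instantiation L2 :: (euclidean_space) real_vector
begin

lift_definition zero_L2 :: "'a L2" is "\<lambda>_. 0"
  by (simp add: L2_rel_def square_integrable_0)

lift_definition plus_L2 :: "'a L2 \<Rightarrow> 'a L2 \<Rightarrow> 'a L2" is "\<lambda>f g t. f t + g t"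
  by (auto simp: L2_rel_def square_integrable_add elim: eventually_elim2)

lift_definition uminus_L2 :: "'a L2 \<Rightarrow> 'a L2" is "\<lambda>f t. - f t"
  using square_integrable_mult[of _ "-1"] by (auto simp: L2_rel_def)

definition minus_L2 :: "'a L2 \<Rightarrow> 'a L2 \<Rightarrow> 'a L2" where "minus_L2 F G = F + - G"

lift_definition scaleR_L2 :: "real \<Rightarrow> 'a L2 \<Rightarrow> 'a L2" is "\<lambda>r f t. complex_of_real r * f t"
  by (auto simp: L2_rel_def square_integrable_mult)

instance
proof
  fix F G H :: "'a L2" and r s :: real
  show "F + G + H = F + (G + H)"
    by transfer (auto simp: L2_rel_def square_integrable_add add.assoc)
  show "F + G = G + F"
    by transfer (auto simp: L2_rel_def square_integrable_add add.commute)
  show "0 + F = F"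
    by transfer (auto simp: L2_rel_def)
  show "- F + F = 0"
    by transfer (auto simp: L2_rel_def square_integrable_0)
  show "F - G = F + - G"
    by (rule minus_L2_def)
  show "r *\<^sub>R (F + G) = r *\<^sub>R F + r *\<^sub>R G"
    by transfer (auto simp: L2_rel_def distrib_left distrib_right
        intro!: square_integrable_add square_integrable_mult)
  show "(r + s) *\<^sub>R F = r *\<^sub>R F + s *\<^sub>R F"
    by transfer (auto simp: L2_rel_def distrib_left distrib_right
        intro!: square_integrable_add square_integrable_mult)
  show "r *\<^sub>R s *\<^sub>R F = (r * s) *\<^sub>R F"
    by transfer (use square_integrable_mult in \<open>auto simp: L2_rel_def mult.assoc\<close>)
  show "1 *\<^sub>R F = F"
    by transfer (auto simp: L2_rel_def)
qed

end

instantiation L2 :: (euclidean_space) real_inner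
begin

text \<open>\<open>f t \<bullet> g t\<close> is the real part of \<open>f t * cnj (g t)\<close>.\<close>

lift_definition inner_L2 :: "'a L2 \<Rightarrow> 'a L2 \<Rightarrow> real" is "\<lambda>f g. LINT t|lborel. f t \<bullet> g t"
  subgoal for f f' g g'
    unfolding L2_rel_def square_integrable_def
    by (intro integral_cong_AE) (auto elim: eventually_elim2)
  done

definition norm_L2 :: "'a L2 \<Rightarrow> real" where "norm_L2 F = sqrt (F \<bullet> F)"

definition sgn_L2 :: "'a L2 \<Rightarrow> 'a L2" where "sgn_L2 F = F /\<^sub>R norm F"

definition dist_L2 :: "'a L2 \<Rightarrow> 'a L2 \<Rightarrow> real" where "dist_L2 F G = norm (F - G)"

definition uniformity_L2 :: "('a L2 \<times> 'a L2) filter"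
  where "uniformity_L2 = (INF e\<in>{0 <..}. principal {(x, y). dist x y < e})"

definition open_L2 :: "'a L2 set \<Rightarrow> bool"
  where "open_L2 U \<longleftrightarrow> (\<forall>x\<in>U. eventually (\<lambda>(x', y). x' = x \<longrightarrow> y \<in> U) uniformity)"

instance
proof
  fix F G H :: "'a L2" and r :: real
  show "dist F G = norm (F - G)" by (rule dist_L2_def)
  show "sgn F = F /\<^sub>R norm F" by (rule sgn_L2_def)
  show "norm F = sqrt (F \<bullet> F)" by (rule norm_L2_def)
  show "uniformity = (INF e\<in>{0 <..}. principal {(x, y :: 'a L2). dist x y < e})"
    by (rule uniformity_L2_def)
  show "open U \<longleftrightarrow> (\<forall>x\<in>U. eventually (\<lambda>(x', y). x' = x \<longrightarrow> y \<in> U) uniformity)"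
    for U :: "'a L2 set" by (rule open_L2_def)
  show "F \<bullet> G = G \<bullet> F"
    by transfer (simp add: inner_commute)
  show "(F + G) \<bullet> H = F \<bullet> H + G \<bullet> H"
    by transfer (auto simp: L2_rel_def inner_add_left square_integrable_inner)
  show "(r *\<^sub>R F) \<bullet> G = r * (F \<bullet> G)"
    by transfer (simp flip: scaleR_conv_of_real)
  show "0 \<le> F \<bullet> F"
    by transfer simp
  show "F \<bullet> F = 0 \<longleftrightarrow> F = 0"
  proof transfer
    fix f :: "'a \<Rightarrow> complex" assume "L2_rel f f"
    then have f: "square_integrable f" by (simp add: L2_rel_def)
    have "(LINT t|lborel. f t \<bullet> f t) = 0 \<longleftrightarrow> (AE t in lborel. f t \<bullet> f t = 0)"
      by (rule integral_nonneg_eq_0_iff_AE[OF square_integrable_inner[OF f f]]) simp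
    then show "(LINT t|lborel. f t \<bullet> f t) = 0 \<longleftrightarrow> L2_rel f (\<lambda>_. 0)"
      using f by (simp add: L2_rel_def square_integrable_0)
  qed
qed

end

lift_definition scaleC_L2 :: "complex \<Rightarrow> 'a::euclidean_space L2 \<Rightarrow> 'a L2" is "\<lambda>c f t. c * f t"
  by (auto simp: L2_rel_def square_integrable_mult)

definition compact_operator :: "('a::euclidean_space L2 \<Rightarrow> 'a L2) \<Rightarrow> bool"
  where "compact_operator T \<longleftrightarrow>
    bounded_linear T \<and> (\<forall>c F. T (scaleC_L2 c F) = scaleC_L2 c (T F)) \<and>
    (\<forall>S. bounded S \<longrightarrow> compact (closure (T ` S)))"


section \<open>The Weyl transform\<close>

text \<open>Neither the choice \<open>rep_L2 F\<close> of a Borel representative nor the (null) set of those \<open>t\<close> for which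
  the integral diverges affects the class of the function on the right-hand side.\<close>

definition weyl_transform ::
    "(((real^'n) \<times> (real^'n)) set \<Rightarrow> complex) \<Rightarrow> (real^'n) L2 \<Rightarrow> (real^'n) L2"
  where "weyl_transform \<mu> F = abs_L2 (\<lambda>t. complex_integral \<mu>
    (\<lambda>(x, y). exp (\<i> * complex_of_real (pi * (x \<bullet> y + 2 * (y \<bullet> t)))) * rep_L2 F (t + x)))"

end

theory Submission
  imports Defs "HOL-Complex_Analysis.Complex_Analysis"
begin

text \<open>
Write \<open>\<mu> = h \<nu>\<close> with \<open>\<nu> = \<bar>\<psi>\<bar> \<sigma>\<close> finite and \<open>\<bar>h\<bar> \<le> 1\<close>, and let \<open>T\<close> be the Weyl transform of \<open>\<mu>\<close>. If \<open>P = T\<^sup>* T\<close>, then \<open>T\<close> is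
compact as soon as \<open>P\<close> is, and \<open>P\<close> as soon as \<open>P\<^sup>2\<close> is, so it suffices that a power \<open>P\<^sup>m\<close> with \<open>m = 2\<^sup>j\<close> is
compact. Products of Weyl transforms are Weyl transforms of twisted convolutions, so \<open>P\<^sup>m\<close> is the
Weyl transform of a measure that is absolutely continuous with respect to the convolution of the
\<open>m\<close>-th powers of \<open>\<nu>\<close> and of its reflection.

For \<open>m \<ge> 2 n\<close> this measure has a density: since \<open>M\<close> is analytic, connected and contained in no hyperplane,
for each \<open>a \<noteq> 0\<close> almost no tangent space of \<open>M\<close> is orthogonal to \<open>a\<close>, hence the tangent spaces at \<open>2 n\<close> random
points almost surely span \<open>\<real>\<^sup>2\<^sup>n\<close> and the sum map is a submersion there. Weyl transforms of integrable
functions are compact, being norm limits of integral operators with bounded kernels of bounded support.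

Null sets are handled throughout by averaging over translations: a Borel set is null as soon as almost
all translates of each point in a fixed family of directions avoid it. For analytic \<open>f\<close> this needs only that
\<open>f\<close> restricted to a line is constant or has countably many critical points.
\<close>

section \<open>Real-analytic functions along lines\<close>

text \<open>The measure \<nu> is singular, and a density appears only after enough convolution. Two
  mismatches shape the way there. First, powers of \<open>P\<close> mix \<nu> with its reflection,
  while the spanning argument treats powers of \<nu> alone. Since Lebesgue null sets are invariant
  under translation, the points drawn from the reflected factors can be frozen and act as an
  arbitrary shift; \<open>translate_dominated\<close> expresses this. Second, the directions that
  span depend on the points drawn, and choosing them measurably would be laborious. Statements about
  several random points are therefore quantified one variable at a time (\<open>nested_AE\<close>),
  and directions are images of basis vectors, which leaves finitely many choices. On the operator
  side, total boundedness is expressed by a labelling with finitely many values: labels pair up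
  under sums and survive limits in norm, so everything is built from operators of rank one by a
  monotone class argument.\<close>

lemma power_series_complex_extension:
  fixes f :: "'a::euclidean_space \<Rightarrow> real" and p q v :: 'a and c :: "('a \<Rightarrow> nat) \<Rightarrow> real"
  assumes ser: "\<And>x. x \<in> ball p r \<Longrightarrow>
      ((\<lambda>\<alpha>. (\<Prod>b\<in>Basis. ((x - p) \<bullet> b) ^ \<alpha> b) * c \<alpha>) has_sum f x) multi_indices"
  obtains G :: "complex \<Rightarrow> complex" and \<Omega> where "open \<Omega>" "G holomorphic_on \<Omega>"
    "\<And>t. q + t *\<^sub>R v \<in> ball p r \<Longrightarrow>
       complex_of_real t \<in> \<Omega> \<and> G (complex_of_real t) = complex_of_real (f (q + t *\<^sub>R v))"
proof -
  \<comment> \<open>Coordinates of the point \<open>q + z v - p\<close> at a complex parameter. The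
    vector \<open>Y z\<close> of their moduli is real, so while its norm is below \<open>r\<close>
    the given series converges at \<open>p + Y z\<close>. Unconditional convergence there is
    absolute, and this dominates the complex series.\<close>
  define l where "l b z = complex_of_real ((q - p) \<bullet> b) + z * complex_of_real (v \<bullet> b)" for b z
  define Y where "Y z = (\<Sum>b\<in>Basis. cmod (l b z) *\<^sub>R b)" for z
  define \<Omega> where "\<Omega> = {z. norm (Y z) < r}"
  define m where "m \<alpha> z = (\<Prod>b\<in>Basis. l b z ^ \<alpha> b) * complex_of_real (c \<alpha>)" for \<alpha> z
  define G where "G z = (\<Sum>\<^sub>\<infinity>\<alpha>\<in>multi_indices. m \<alpha> z)" for z
  have Yc: "continuous_on UNIV (\<lambda>z. norm (Y z))"
    unfolding Y_def l_def by (intro continuous_intros)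
  have "open \<Omega>"
    unfolding \<Omega>_def using Yc by (intro open_Collect_less) auto
  moreover have "G holomorphic_on \<Omega>"
    unfolding holomorphic_on_open[OF \<open>open \<Omega>\<close>]
  proof
    fix z0 assume z0: "z0 \<in> \<Omega>"
    \<comment> \<open>Within distance \<delta> of \<open>z0\<close> the modulus of coordinate
      \<open>b\<close> grows by at most \<delta> times the modulus of \<open>v \<bullet> b\<close>,
      so the terms at \<open>p + Z \<delta>\<close> form a Weierstrass majorant on the closed
      disc.\<close>
    define Z where "Z \<delta> = Y z0 + \<delta> *\<^sub>R (\<Sum>b\<in>Basis. \<bar>v \<bullet> b\<bar> *\<^sub>R b)" for \<delta>
    have "((\<lambda>\<delta>. norm (Z \<delta>)) \<longlongrightarrow> norm (Z 0)) (at_right 0)"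
      unfolding Z_def by (intro tendsto_intros)
    moreover have "norm (Z 0) < r" using z0 by (simp add: Z_def \<Omega>_def)
    ultimately have "eventually (\<lambda>\<delta>. norm (Z \<delta>) < r) (at_right 0)"
      by (rule order_tendstoD)
    then obtain \<delta> where \<delta>: "\<delta> > 0" "norm (Z \<delta>) < r"
      unfolding eventually_at_right_field using field_lbound_gt_zero[of _ 1]
      by (metis dense zero_less_one)
    have Zb: "Z \<delta> \<bullet> b = cmod (l b z0) + \<delta> * \<bar>v \<bullet> b\<bar>" if "b \<in> Basis" for b
      using that by (simp add: Z_def Y_def inner_add_left inner_sum_left_Basis)
    define M where "M \<alpha> = \<bar>(\<Prod>b\<in>Basis. (Z \<delta> \<bullet> b) ^ \<alpha> b) * c \<alpha>\<bar>" for \<alpha>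
    have "p + Z \<delta> \<in> ball p r" using \<delta> by (simp add: dist_norm)
    from ser[OF this] have "(\<lambda>\<alpha>. (\<Prod>b\<in>Basis. (Z \<delta> \<bullet> b) ^ \<alpha> b) * c \<alpha>) summable_on multi_indices"
      by (auto simp: summable_on_def)
    then have Ms: "M summable_on multi_indices"
      unfolding M_def using summable_on_iff_abs_summable_on_real by fastforce
    have bd: "norm (m \<alpha> z) \<le> M \<alpha>" if z: "z \<in> cball z0 \<delta>" for \<alpha> z
    proof -
      have "cmod (l b z) \<le> Z \<delta> \<bullet> b" if b: "b \<in> Basis" for b
      proof -
        have "l b z = l b z0 + (z - z0) * complex_of_real (v \<bullet> b)"
          by (simp add: l_def algebra_simps)
        then have "cmod (l b z) \<le> cmod (l b z0) + cmod (z - z0) * \<bar>v \<bullet> b\<bar>"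
          by (metis norm_mult norm_of_real norm_triangle_ineq)
        also have "\<dots> \<le> cmod (l b z0) + \<delta> * \<bar>v \<bullet> b\<bar>"
          using z by (intro add_left_mono mult_right_mono) (auto simp: dist_norm norm_minus_commute)
        finally show ?thesis using Zb[OF b] by simp
      qed
      then have "(\<Prod>b\<in>Basis. cmod (l b z) ^ \<alpha> b) \<le> (\<Prod>b\<in>Basis. (Z \<delta> \<bullet> b) ^ \<alpha> b)"
        by (intro prod_mono) (auto intro: power_mono)
      then show ?thesis
        by (simp add: m_def M_def norm_mult norm_power prod_norm[symmetric] abs_mult mult_mono)
    qed
    have ul: "uniform_limit (cball z0 \<delta>) (\<lambda>X z. \<Sum>\<alpha>\<in>X. m \<alpha> z) G (finite_subsets_at_top multi_indices)"
      unfolding G_def by (rule Weierstrass_m_test_general[OF _ Ms]) (use bd in auto)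
    have mh: "m \<alpha> holomorphic_on S" for \<alpha> S
      unfolding m_def l_def by (intro holomorphic_intros)
    have ev: "\<forall>\<^sub>F X in finite_subsets_at_top (multi_indices :: ('a \<Rightarrow> nat) set).
        continuous_on (cball z0 \<delta>) (\<lambda>z. \<Sum>\<alpha>\<in>X. m \<alpha> z) \<and> (\<lambda>z. \<Sum>\<alpha>\<in>X. m \<alpha> z) holomorphic_on ball z0 \<delta>"
      by (intro always_eventually allI conjI holomorphic_on_imp_continuous_on holomorphic_on_sum mh)
    obtain "G holomorphic_on ball z0 \<delta>"
      by (rule holomorphic_uniform_limit[OF ev ul]) auto
    then show "\<exists>f'. (G has_field_derivative f') (at z0)"
      using \<delta> by (simp add: holomorphic_on_open)
  qed
  moreover have "complex_of_real t \<in> \<Omega> \<and> G (complex_of_real t) = complex_of_real (f (q + t *\<^sub>R v))"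
    if t: "q + t *\<^sub>R v \<in> ball p r" for t
  proof
    have l: "l b (of_real t) = of_real ((q + t *\<^sub>R v - p) \<bullet> b)" for b
      by (simp add: l_def inner_simps)
    have "norm (Y (of_real t)) \<le> norm (q + t *\<^sub>R v - p)"
      by (rule norm_le_componentwise) (simp add: Y_def l inner_sum_left_Basis del: inner_add_left)
    then show "complex_of_real t \<in> \<Omega>"
      using t by (simp add: \<Omega>_def dist_norm norm_minus_commute)
    have "((\<lambda>\<alpha>. complex_of_real ((\<Prod>b\<in>Basis. ((q + t *\<^sub>R v - p) \<bullet> b) ^ \<alpha> b) * c \<alpha>))
        has_sum complex_of_real (f (q + t *\<^sub>R v))) multi_indices"
      by (rule has_sum_of_real[OF ser[OF t]])
    then show "G (complex_of_real t) = complex_of_real (f (q + t *\<^sub>R v))"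
      by (simp add: G_def m_def l has_sum_iff)
  qed
  ultimately show ?thesis by (rule that)
qed

text \<open>Along the line the function is the restriction of a holomorphic \<open>G\<close>. A
  derivative that does not vanish identically on a connected open set has countably many zeros
  there; as they may accumulate at the boundary, finiteness cannot be expected.\<close>

lemma analytic_line_dichotomy:
  fixes f :: "'a::euclidean_space \<Rightarrow> real" and p q v :: 'a
  assumes ser: "\<And>x. x \<in> ball p r \<Longrightarrow>
      ((\<lambda>\<alpha>. (\<Prod>b\<in>Basis. ((x - p) \<bullet> b) ^ \<alpha> b) * c \<alpha>) has_sum f x) multi_indices"
    and der: "\<And>x. x \<in> ball p r \<Longrightarrow> (f has_derivative f' x) (at x)"
    and q: "q \<in> ball p r"
  shows "countable {t. q + t *\<^sub>R v \<in> ball p r \<and> f' (q + t *\<^sub>R v) v = 0} \<or>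
    (\<forall>t. q + t *\<^sub>R v \<in> ball p r \<longrightarrow> f (q + t *\<^sub>R v) = f q)"
proof -
  obtain \<Omega> G where G: "open \<Omega>" "G holomorphic_on \<Omega>"
    "\<And>t. q + t *\<^sub>R v \<in> ball p r \<Longrightarrow>
       complex_of_real t \<in> \<Omega> \<and> G (complex_of_real t) = complex_of_real (f (q + t *\<^sub>R v))"
    by (rule power_series_complex_extension[where p = p and r = r and c = c and f = f and q = q and v = v,
        OF ser]) (assumption, rule that, auto)
  define I where "I = {t. q + t *\<^sub>R v \<in> ball p r}"
  have I0: "0 \<in> I" using q by (simp add: I_def)
  have I_eq: "I = (\<lambda>t. q + t *\<^sub>R v) -` ball p r" by (auto simp: I_def)
  have "open I" unfolding I_eq by (intro open_vimage) (auto intro!: continuous_intros)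
  have "convex I"
    unfolding convex_alt
  proof safe
    fix s t u :: real assume "s \<in> I" "t \<in> I" "0 \<le> u" "u \<le> 1"
    then have "(1 - u) *\<^sub>R (q + s *\<^sub>R v) + u *\<^sub>R (q + t *\<^sub>R v) \<in> ball p r"
      using convex_ball[of p r] unfolding convex_alt I_def by blast
    moreover have "(1 - u) *\<^sub>R (q + s *\<^sub>R v) + u *\<^sub>R (q + t *\<^sub>R v) = q + ((1 - u) *\<^sub>R s + u *\<^sub>R t) *\<^sub>R v"
      by (simp add: algebra_simps)
    ultimately show "(1 - u) *\<^sub>R s + u *\<^sub>R t \<in> I" by (simp add: I_def)
  qed
  \<comment> \<open>Counting zeros needs a connected domain, hence the component of 0. It contains
    all admissible real parameters because they form an interval around 0.\<close>
  define C where "C = connected_component_set \<Omega> 0"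
  have C: "open C" "connected C" "C \<subseteq> \<Omega>"
    using G(1) by (auto simp: C_def open_connected_component connected_component_subset)
  have IC: "complex_of_real ` I \<subseteq> C"
    unfolding C_def
  proof (rule connected_component_maximal)
    show "0 \<in> complex_of_real ` I" using I0 by force
    show "connected (complex_of_real ` I)"
      by (intro connected_continuous_image continuous_intros convex_connected \<open>convex I\<close>)
    show "complex_of_real ` I \<subseteq> \<Omega>" using G(3) by (auto simp: I_def)
  qed
  have GC: "G holomorphic_on C" using G(2) C(3) holomorphic_on_subset by blast
  have dG: "deriv G (of_real t) = of_real (f' (q + t *\<^sub>R v) v)" if t: "t \<in> I" for t
  proof -
    have "(G has_field_derivative deriv G (of_real t)) (at (of_real t))"
      using GC IC t C(1) holomorphic_derivI by blast
    then have 1: "((\<lambda>s. G (of_real s)) has_vector_derivative deriv G (of_real t)) (at t)"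
      by (rule has_vector_derivative_real_field)
    have "((\<lambda>s. f (q + s *\<^sub>R v)) has_derivative (\<lambda>s. f' (q + t *\<^sub>R v) (s *\<^sub>R v))) (at t)"
      by (rule has_derivative_compose[of "\<lambda>s. q + s *\<^sub>R v" "\<lambda>s. s *\<^sub>R v", OF _ der])
        (use t in \<open>auto intro!: derivative_eq_intros simp: I_def\<close>)
    moreover have "f' (q + t *\<^sub>R v) (s *\<^sub>R v) = s * f' (q + t *\<^sub>R v) v" for s
      using linear_scale[OF has_derivative_linear[OF der], of "q + t *\<^sub>R v" s v] t by (simp add: I_def)
    ultimately have "((\<lambda>s. f (q + s *\<^sub>R v)) has_vector_derivative f' (q + t *\<^sub>R v) v) (at t)"
      by (simp add: has_vector_derivative_def)
    then have "((\<lambda>s. complex_of_real (f (q + s *\<^sub>R v))) has_vector_derivative of_real (f' (q + t *\<^sub>R v) v)) (at t)"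
      by (rule bounded_linear.has_vector_derivative[OF bounded_linear_of_real])
    then have "((\<lambda>s. G (of_real s)) has_vector_derivative of_real (f' (q + t *\<^sub>R v) v)) (at t)"
      by (rule has_vector_derivative_transform_within_open[OF _ \<open>open I\<close> t])
        (use G(3) in \<open>auto simp: I_def\<close>)
    with 1 show ?thesis by (rule vector_derivative_unique_at)
  qed
  have inj: "countable {t. q + t *\<^sub>R v \<in> ball p r \<and> f' (q + t *\<^sub>R v) v = 0}"
    if "countable {z\<in>C. deriv G z = 0}"
  proof (rule countable_image_inj_on[of complex_of_real])
    show "countable (complex_of_real ` {t. q + t *\<^sub>R v \<in> ball p r \<and> f' (q + t *\<^sub>R v) v = 0})"
      by (rule countable_subset[OF _ that]) (use IC dG in \<open>auto simp: I_def\<close>)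
  qed (auto simp: inj_on_def)
  obtain K where "range K \<subseteq> Collect compact" "C = (\<Union>n::nat. K n)"
    using open_Union_compact_subsets[OF C(1)] by (metis image_subsetI mem_Collect_eq)
  then have fsC: "fsigma C" using fsigma_Union_compact by blast
  have dGh: "deriv G holomorphic_on C" using GC C(1) holomorphic_deriv by blast
  \<comment> \<open>\<open>holomorphic_countable_zeros\<close> is about nonconstant functions, so a
    constant \<open>deriv G\<close> is a case of its own: the constant is nonzero, since otherwise
    \<open>G\<close> would be constant.\<close>
  consider "G constant_on C" | "\<not> G constant_on C" "deriv G constant_on C" | "\<not> deriv G constant_on C"
    by blast
  then show ?thesis
  proof cases
    case 1
    then have "G (of_real t) = G (of_real 0)" if "t \<in> I" for t
      using IC I0 that unfolding constant_on_def by (metis imageI subsetD)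
    then have "\<forall>t. q + t *\<^sub>R v \<in> ball p r \<longrightarrow> f (q + t *\<^sub>R v) = f q"
      using G(3) I0 G(3)[of 0] by (auto simp: I_def)
    then show ?thesis ..
  next
    case 2
    then obtain k where k: "\<And>z. z \<in> C \<Longrightarrow> deriv G z = k" by (auto simp: constant_on_def)
    have "k \<noteq> 0"
    proof
      assume "k = 0"
      then have "(G has_field_derivative 0) (at z)" if "z \<in> C" for z
        using k[OF that] GC C(1) holomorphic_derivI that by metis
      then have "G constant_on C"
        using DERIV_zero_connected_constant_on[OF C(2,1) finite.emptyI, of G] GC
          holomorphic_on_imp_continuous_on by fastforce
      with 2 show False by blast
    qed
    then have "{z\<in>C. deriv G z = 0} = {}" using k by auto
    with inj show ?thesis by simp
  next
    case 3
    with inj holomorphic_countable_zeros[OF dGh C(1,2) fsC]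
    show ?thesis by blast
  qed
qed

text \<open>Tonelli on the product: integrating the indicator of \<tau> s x \<in> Q over
  \<open>x\<close> first gives the measure of \<open>Q\<close> times the mass of \<open>S\<close>,
  integrating over \<open>s\<close> first gives 0. The exceptional set of \<open>s\<close> may vary
  with \<open>x\<close>.\<close>

lemma null_set_by_averaging:
  assumes S: "sigma_finite_measure S" and X: "sigma_finite_measure X"
    and meas[measurable]: "(\<lambda>(s, x). \<tau> s x) \<in> measurable (S \<Otimes>\<^sub>M X) X"
    and inv: "\<And>s. s \<in> space S \<Longrightarrow> distr X X (\<tau> s) = X"
    and S0: "emeasure S (space S) \<noteq> 0"
    and Q[measurable]: "Q \<in> sets X"
    and null: "\<And>x. x \<in> space X \<Longrightarrow> AE s in S. \<tau> s x \<notin> Q"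
  shows "Q \<in> null_sets X"
proof -
  interpret P: pair_sigma_finite S X by (simp add: pair_sigma_finite_def S X)
  have 1: "(\<integral>\<^sup>+x. indicator Q (\<tau> s x) \<partial>X) = emeasure X Q" if s: "s \<in> space S" for s
  proof -
    have t[measurable]: "\<tau> s \<in> measurable X X"
      using measurable_compose[OF measurable_Pair1'[OF s] meas] by simp
    have "(\<integral>\<^sup>+x. indicator Q (\<tau> s x) \<partial>X) = (\<integral>\<^sup>+x. indicator Q x \<partial>distr X X (\<tau> s))"
      by (subst nn_integral_distr) auto
    then show ?thesis by (simp add: inv[OF s])
  qed
  have "emeasure X Q * emeasure S (space S) = (\<integral>\<^sup>+s. emeasure X Q \<partial>S)"
    by simp
  also have "\<dots> = (\<integral>\<^sup>+s. (\<integral>\<^sup>+x. indicator Q (\<tau> s x) \<partial>X) \<partial>S)"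
    by (intro nn_integral_cong) (simp add: 1)
  also have "\<dots> = (\<integral>\<^sup>+x. (\<integral>\<^sup>+s. indicator Q (\<tau> s x) \<partial>S) \<partial>X)"
    by (rule P.Fubini'[symmetric]) measurable
  also have "\<dots> = (\<integral>\<^sup>+x. 0 \<partial>X)"
  proof (intro nn_integral_cong)
    fix x assume x: "x \<in> space X"
    have "(\<integral>\<^sup>+s. indicator Q (\<tau> s x) \<partial>S) = (\<integral>\<^sup>+s. 0 \<partial>S)"
      using null[OF x] by (intro nn_integral_cong_AE) (auto elim!: eventually_mono)
    then show "(\<integral>\<^sup>+s. indicator Q (\<tau> s x) \<partial>S) = 0" by simp
  qed
  finally show ?thesis using S0 Q by (auto simp: null_sets_def)
qed

lemma null_set_by_lines:
  fixes Q :: "'a::euclidean_space set"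
  assumes Q: "Q \<in> sets borel" and c: "\<And>x. countable {s::real. x + s *\<^sub>R v \<in> Q}"
  shows "Q \<in> null_sets lborel"
proof (rule null_set_by_averaging[where S = lborel and \<tau> = "\<lambda>s x. x + s *\<^sub>R v"])
  show "(\<lambda>(s, x). x + s *\<^sub>R v) \<in> measurable (lborel \<Otimes>\<^sub>M lborel) lborel"
    by (simp add: split_beta' cong: measurable_cong_sets)
  show "distr lborel lborel (\<lambda>x. x + s *\<^sub>R v) = lborel" for s
  proof -
    have "distr lborel lborel (\<lambda>x. x + s *\<^sub>R v) = distr lborel borel ((+) (s *\<^sub>R v))"
      by (intro distr_cong) (auto simp: add.commute)
    also have "\<dots> = lborel" by (rule lborel_distr_plus)
    finally show ?thesis .
  qed
  show "AE s in lborel. x + s *\<^sub>R v \<notin> Q" for x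
    using AE_not_in[OF countable_imp_null_set_lborel[OF c[of x]]] by simp
qed (auto simp: Q sigma_finite_lborel)

section \<open>Critical points and the identity theorem for analytic functions on a ball\<close>

context
  fixes f :: "'a::euclidean_space \<Rightarrow> real" and f' c p r
  assumes ser: "\<And>x. x \<in> ball p r \<Longrightarrow>
      ((\<lambda>\<alpha>. (\<Prod>b\<in>Basis. ((x - p) \<bullet> b) ^ \<alpha> b) * c \<alpha>) has_sum f x) multi_indices"
    and der: "\<And>x. x \<in> ball p r \<Longrightarrow> (f has_derivative f' x) (at x)"
begin

text \<open>The direction that exhibits nonconstancy depends on the point: for a critical
  \<open>x\<close>, the vectors \<open>v\<close> such that \<open>x + v\<close> lies in the ball and
  has a different value form a nonempty open set. One of them lies in a fixed countable dense set,
  and for each fixed \<open>v\<close> the line dichotomy yields a null set.\<close>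

lemma analytic_critical_points_null:
  assumes cont: "\<And>v. continuous_on (ball p r) (\<lambda>x. f' x v)"
    and nonconst: "\<not> f constant_on ball p r"
  shows "AE x in lborel. x \<in> ball p r \<longrightarrow> (\<exists>v. f' x v \<noteq> 0)"
proof -
  let ?U = "ball p r"
  have fc: "continuous_on ?U f"
    using der by (meson continuous_at_imp_continuous_on has_derivative_continuous)
  have opn: "open {x \<in> ?U. x + w \<in> ?U \<and> f (x + w) \<noteq> f x}" for w
  proof -
    have W: "open {x. x \<in> ?U \<and> x + w \<in> ?U}"
      by (intro open_Collect_conj open_ball) (auto intro!: open_Collect_less continuous_intros simp: mem_ball simp del: dist_commute)
    have "continuous_on {x. x \<in> ?U \<and> x + w \<in> ?U} (\<lambda>x. f (x + w) - f x)"
      by (intro continuous_intros continuous_on_compose2[OF fc]) auto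
    from continuous_open_preimage[OF this W, of "- {0}"]
    show ?thesis by (simp add: vimage_def Int_def conj_ac open_Compl)
  qed
  \<comment> \<open>The second condition excludes lines on which \<open>f\<close> is constant. It is
    a union of open sets over all \<open>t\<close>, which makes \<open>C v\<close> Borel.\<close>
  define C where "C v = {x \<in> ?U. f' x v = 0} \<inter>
    (\<Union>t. {x \<in> ?U. x + t *\<^sub>R v \<in> ?U \<and> f (x + t *\<^sub>R v) \<noteq> f x})" for v
  have Cm: "C v \<in> sets borel" for v
  proof -
    have "open (?U \<inter> (\<lambda>x. f' x v) -` (- {0}))"
      by (intro continuous_open_preimage cont) auto
    moreover have "{x \<in> ?U. f' x v = 0} = ?U - (?U \<inter> (\<lambda>x. f' x v) -` (- {0}))"
      by auto
    ultimately have "{x \<in> ?U. f' x v = 0} \<in> sets borel" by auto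
    moreover have "open (\<Union>t. {x \<in> ?U. x + t *\<^sub>R v \<in> ?U \<and> f (x + t *\<^sub>R v) \<noteq> f x})"
      by (intro open_UN ballI opn)
    ultimately show ?thesis unfolding C_def by auto
  qed
  have C: "C v \<in> null_sets lborel" for v
  proof (rule null_set_by_lines[OF Cm, of v])
    fix x
    show "countable {s. x + s *\<^sub>R v \<in> C v}"
    proof (cases "{s. x + s *\<^sub>R v \<in> C v} = {}")
      case False
      then obtain s0 where s0: "x + s0 *\<^sub>R v \<in> C v" by auto
      define q where "q = x + s0 *\<^sub>R v"
      have q: "q \<in> ?U" using s0 by (auto simp: C_def q_def)
      have "\<not> (\<forall>t. q + t *\<^sub>R v \<in> ?U \<longrightarrow> f (q + t *\<^sub>R v) = f q)"
        using s0 by (auto simp: C_def q_def)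
      with analytic_line_dichotomy[OF ser der q, of v]
      have "countable {t. q + t *\<^sub>R v \<in> ?U \<and> f' (q + t *\<^sub>R v) v = 0}" by blast
      then have "countable ((\<lambda>t. t + s0) ` {t. q + t *\<^sub>R v \<in> ?U \<and> f' (q + t *\<^sub>R v) v = 0})"
        by (rule countable_image)
      moreover have "{s. x + s *\<^sub>R v \<in> C v} \<subseteq> (\<lambda>t. t + s0) ` {t. q + t *\<^sub>R v \<in> ?U \<and> f' (q + t *\<^sub>R v) v = 0}"
      proof
        fix s assume "s \<in> {s. x + s *\<^sub>R v \<in> C v}"
        moreover have "x + s *\<^sub>R v = q + (s - s0) *\<^sub>R v" by (simp add: q_def algebra_simps)
        ultimately have "s - s0 \<in> {t. q + t *\<^sub>R v \<in> ?U \<and> f' (q + t *\<^sub>R v) v = 0}"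
          by (auto simp: C_def)
        then show "s \<in> (\<lambda>t. t + s0) ` {t. q + t *\<^sub>R v \<in> ?U \<and> f' (q + t *\<^sub>R v) v = 0}"
          by (rule rev_image_eqI) simp
      qed
      ultimately show ?thesis by (rule countable_subset[rotated])
    next
      case True
      show ?thesis unfolding True by simp
    qed
  qed
  obtain D :: "'a set" where D: "countable D" "\<And>X. open X \<Longrightarrow> X \<noteq> {} \<Longrightarrow> \<exists>d\<in>D. d \<in> X"
    using countable_dense_setE by blast
  have "AE x in lborel. \<forall>v\<in>D. x \<notin> C v"
    unfolding AE_ball_countable[OF D(1)] using C AE_not_in by blast
  then show ?thesis
  proof eventually_elim
    fix x assume x: "\<forall>v\<in>D. x \<notin> C v"
    show "x \<in> ?U \<longrightarrow> (\<exists>v. f' x v \<noteq> 0)"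
    proof (intro impI, rule ccontr)
      assume xU: "x \<in> ?U" and 0: "\<nexists>v. f' x v \<noteq> 0"
      have "open ((+) (- x) ` (?U \<inter> f -` (- {f x})))"
        by (intro open_translation continuous_open_preimage fc) auto
      moreover have "(+) (- x) ` (?U \<inter> f -` (- {f x})) \<noteq> {}"
        using nonconst by (auto simp: constant_on_def)
      ultimately obtain v where v: "v \<in> D" "v \<in> (+) (- x) ` (?U \<inter> f -` (- {f x}))"
        using D(2) by blast
      then have "x + 1 *\<^sub>R v \<in> ?U \<and> f (x + 1 *\<^sub>R v) \<noteq> f x" by auto
      then have "x \<in> C v" using xU 0 unfolding C_def by blast
      with x v(1) show False by blast
    qed
  qed
qed

text \<open>Join \<open>x\<close> to \<open>q\<close> by a line. The derivative vanishes on it for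
  an open interval of parameters, thus uncountably often, and the dichotomy leaves only
  constancy.\<close>

lemma analytic_identity:
  assumes W: "open W" "q \<in> W" "W \<subseteq> ball p r" and k: "\<And>x. x \<in> W \<Longrightarrow> f x = k"
    and x: "x \<in> ball p r"
  shows "f x = k"
proof -
  define v where "v = x - q"
  have qU: "q \<in> ball p r" using W by auto
  have d0: "f' y = (\<lambda>_. 0)" if y: "y \<in> W" for y
  proof -
    have "(f has_derivative (\<lambda>_. 0)) (at y)"
      by (rule has_derivative_transform_within_open[OF has_derivative_const[of k] W(1) y]) (simp add: k)
    then show ?thesis using der[of y] y W(3) has_derivative_unique by blast
  qed
  have "open ((\<lambda>t. q + t *\<^sub>R v) -` W)"
    by (intro open_vimage W continuous_intros)
  moreover have "0 \<in> (\<lambda>t. q + t *\<^sub>R v) -` W" using W by simp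
  ultimately obtain e where e: "e > 0" "ball 0 e \<subseteq> (\<lambda>t. q + t *\<^sub>R v) -` W"
    unfolding open_contains_ball by blast
  have "ball 0 e \<subseteq> {t. q + t *\<^sub>R v \<in> ball p r \<and> f' (q + t *\<^sub>R v) v = 0}"
    using e(2) W(3) d0 by auto
  then have "uncountable {t. q + t *\<^sub>R v \<in> ball p r \<and> f' (q + t *\<^sub>R v) v = 0}"
    using uncountable_ball[OF e(1), of 0] countable_subset by blast
  then have "f (q + 1 *\<^sub>R v) = f q"
    using analytic_line_dichotomy[OF ser der qU, of v] x by (auto simp: v_def dest: spec[of _ 1])
  then show ?thesis using k W(2) by (simp add: v_def)
qed

end

section \<open>Charts of a real-analytic submanifold\<close>

lemma smooth_on_derivative:
  assumes "smooth_on V \<phi>" "x \<in> V"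
  shows "(\<phi> has_derivative frechet_derivative \<phi> (at x)) (at x)"
proof -
  have "Ck_on (Suc 0) V \<phi>" using assms by (simp add: smooth_on_def)
  then show ?thesis using assms(2) frechet_derivative_works by auto
qed

lemma smooth_on_derivative_continuous:
  assumes "smooth_on V \<phi>"
  shows "continuous_on V (\<lambda>x. frechet_derivative \<phi> (at x) v)"
proof -
  have "Ck_on (Suc 0) V \<phi>" using assms by (simp add: smooth_on_def)
  then show ?thesis by auto
qed

lemma regular_parametrization_openin:
  assumes "regular_parametrization M V \<phi>" "open W" "W \<subseteq> V"
  shows "openin (top_of_set M) (\<phi> ` W)"
proof -
  obtain \<phi>' where h: "homeomorphism V (\<phi> ` V) \<phi> \<phi>'" and o: "openin (top_of_set M) (\<phi> ` V)"
    using assms(1) by (auto simp: regular_parametrization_def)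
  have "openin (top_of_set (\<phi> ` V)) (\<phi> ` W)"
    by (rule homeomorphism_imp_open_map[OF h]) (use assms in \<open>auto intro: open_subset\<close>)
  with o show ?thesis using openin_trans by blast
qed

text \<open>The image of \<open>A\<close> is its preimage under the continuous inverse. That inverse
  lives on the image of \<open>V\<close>, which is Borel because \<open>V\<close>, and with it the
  image, is a countable union of compact sets.\<close>

lemma regular_parametrization_borel:
  fixes \<phi> :: "real^'k \<Rightarrow> 'a::euclidean_space"
  assumes "regular_parametrization M V \<phi>" and A: "A \<in> sets borel" "A \<subseteq> V"
  shows "\<phi> ` A \<in> sets borel"
proof -
  obtain \<phi>' where h: "homeomorphism V (\<phi> ` V) \<phi> \<phi>'" and V: "open V"
    using assms(1) by (auto simp: regular_parametrization_def)
  obtain C :: "nat \<Rightarrow> (real^'k) set" where C: "\<And>n. compact (C n)" "\<And>n. C n \<subseteq> V" "\<Union>(range C) = V"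
    using open_Union_compact_subsets[OF V] by metis
  have "continuous_on (C n) \<phi>" for n
    using h C(2) by (meson continuous_on_subset homeomorphism_def)
  then have "compact (\<phi> ` C n)" for n using C(1) compact_continuous_image by blast
  then have "(\<Union>n. \<phi> ` C n) \<in> sets borel" by (intro sets.countable_UN') (auto intro: borel_compact)
  then have [measurable]: "\<phi> ` V \<in> sets borel" using C(3) by (simp flip: image_UN)
  have "\<phi>' \<in> borel_measurable (restrict_space borel (\<phi> ` V))"
    using h by (intro borel_measurable_continuous_on_restrict) (auto simp: homeomorphism_def)
  then have "\<phi>' -` A \<inter> space (restrict_space borel (\<phi> ` V)) \<in> sets (restrict_space borel (\<phi> ` V))"
    using A by measurable
  then have "\<phi>' -` A \<inter> \<phi> ` V \<in> sets borel"
    by (simp add: space_restrict_space sets_restrict_space_iff)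
  moreover have "\<phi>' -` A \<inter> \<phi> ` V = \<phi> ` A"
    using h A(2) by (force simp: homeomorphism_def)
  ultimately show ?thesis by simp
qed

lemma volume_density_continuous:
  assumes "smooth_on V \<phi>"
  shows "continuous_on V (volume_density \<phi>)"
  unfolding volume_density_def det_def
  unfolding vec_lambda_beta
  by (intro continuous_on_real_sqrt continuous_on_sum continuous_on_mult continuous_on_const continuous_on_prod
      continuous_on_inner smooth_on_derivative_continuous[OF assms])

text \<open>One power series serves the whole open ball, so that the arguments along lines apply to
  it. The closed ball lies in \<open>V\<close>, which bounds the volume density on the ball and
  makes its image a set of finite volume.\<close>

definition analytic_chart :: "'a::euclidean_space set \<Rightarrow> (real^'k) set \<Rightarrow> (real^'k \<Rightarrow> 'a) \<Rightarrow> real^'k \<Rightarrow> real \<Rightarrow> bool"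
  where "analytic_chart M V \<phi> p r \<longleftrightarrow> regular_parametrization M V \<phi> \<and> 0 < r \<and> cball p r \<subseteq> V \<and>
    (\<exists>c. \<forall>x\<in>ball p r. ((\<lambda>\<alpha>. (\<Prod>b\<in>Basis. ((x - p) \<bullet> b) ^ \<alpha> b) *\<^sub>R c \<alpha>) has_sum \<phi> x) multi_indices)"

lemma analytic_chart_exists:
  assumes "real_analytic_submanifold TYPE('k::finite) M" "z \<in> M"
  obtains V and \<phi> :: "real^'k \<Rightarrow> _" and p r where "analytic_chart M V \<phi> p r" "\<phi> p = z"
proof -
  obtain V and \<phi> :: "real^'k \<Rightarrow> _" where reg: "regular_parametrization M V \<phi>"
    and an: "real_analytic_on V \<phi>" and "z \<in> \<phi> ` V"
    using assms unfolding real_analytic_submanifold_def by blast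
  then obtain p where p: "p \<in> V" "\<phi> p = z" by auto
  obtain r c where r: "r > 0"
    "\<And>x. x \<in> ball p r \<Longrightarrow> ((\<lambda>\<alpha>. (\<Prod>b\<in>Basis. ((x - p) \<bullet> b) ^ \<alpha> b) *\<^sub>R c \<alpha>) has_sum \<phi> x) multi_indices"
    using an p(1) unfolding real_analytic_on_def by blast
  obtain e where e: "e > 0" "cball p e \<subseteq> V"
    using reg p(1) unfolding regular_parametrization_def open_contains_cball by blast
  have "analytic_chart M V \<phi> p (min r e)"
    unfolding analytic_chart_def
    using reg r e by (auto intro!: exI[of _ c] simp: subset_eq)
  then show ?thesis using p(2) that by blast
qed

context
  fixes M :: "'a::euclidean_space set" and V and \<phi> :: "real^'k \<Rightarrow> 'a" and p r
  assumes ch: "analytic_chart M V \<phi> p r"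
begin

lemma analytic_chart_smooth: "smooth_on V \<phi>"
  and analytic_chart_ball: "ball p r \<subseteq> V"
  using ch by (auto simp: analytic_chart_def regular_parametrization_def)

lemma analytic_chart_series:
  obtains c where "\<And>x. x \<in> ball p r \<Longrightarrow>
    ((\<lambda>\<alpha>. (\<Prod>b\<in>Basis. ((x - p) \<bullet> b) ^ \<alpha> b) * c \<alpha>) has_sum a \<bullet> \<phi> x) multi_indices"
proof -
  obtain c where c: "\<And>x. x \<in> ball p r \<Longrightarrow>
      ((\<lambda>\<alpha>. (\<Prod>b\<in>Basis. ((x - p) \<bullet> b) ^ \<alpha> b) *\<^sub>R c \<alpha>) has_sum \<phi> x) multi_indices"
    using ch unfolding analytic_chart_def by blast
  have "((\<lambda>\<alpha>. (\<Prod>b\<in>Basis. ((x - p) \<bullet> b) ^ \<alpha> b) * (a \<bullet> c \<alpha>)) has_sum a \<bullet> \<phi> x) multi_indices"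
    if "x \<in> ball p r" for x
    using has_sum_bounded_linear[OF bounded_linear_inner_right c[OF that], of a] by (simp add: o_def)
  then show ?thesis by (rule that)
qed

lemma analytic_chart_derivative:
  assumes "x \<in> ball p r"
  shows "((\<lambda>x. a \<bullet> \<phi> x) has_derivative (\<lambda>v. a \<bullet> frechet_derivative \<phi> (at x) v)) (at x)"
  using smooth_on_derivative[OF analytic_chart_smooth, of x] analytic_chart_ball assms
  by (intro derivative_intros) auto

text \<open>Analytic continuation inside one chart: \<open>a \<bullet> \<phi>\<close> is constant on
  a nonempty open part of the ball, hence on all of it. The set \<open>N\<close> may meet the chart
  anywhere, not only at its centre.\<close>

lemma analytic_chart_hyperplane:
  assumes "openin (top_of_set M) N" "z \<in> N" "z \<in> \<phi> ` ball p r" and N: "N \<subseteq> {z. a \<bullet> z = b}"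
  shows "\<phi> ` ball p r \<subseteq> {z. a \<bullet> z = b}"
proof
  fix y assume "y \<in> \<phi> ` ball p r"
  then obtain x where x: "x \<in> ball p r" "y = \<phi> x" by auto
  obtain T where T: "open T" "N = M \<inter> T" using assms(1) by (auto simp: openin_open)
  have sub: "\<phi> ` ball p r \<subseteq> M"
    using regular_parametrization_openin[of M V \<phi> "ball p r"] ch analytic_chart_ball openin_imp_subset
    by (fastforce simp: analytic_chart_def)
  have "continuous_on (ball p r) \<phi>"
    by (meson analytic_chart_ball analytic_chart_smooth continuous_at_imp_continuous_on
        has_derivative_continuous smooth_on_derivative subsetD)
  then have W: "open (ball p r \<inter> \<phi> -` T)" using T(1) by (intro continuous_open_preimage) auto
  obtain q where q: "q \<in> ball p r \<inter> \<phi> -` T" using assms T(2) by auto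
  obtain c where c: "\<And>x. x \<in> ball p r \<Longrightarrow>
    ((\<lambda>\<alpha>. (\<Prod>b\<in>Basis. ((x - p) \<bullet> b) ^ \<alpha> b) * c \<alpha>) has_sum a \<bullet> \<phi> x) multi_indices"
    by (rule analytic_chart_series[where a = a]) (rule that, assumption)
  have "a \<bullet> \<phi> x = b"
    by (rule analytic_identity[OF c analytic_chart_derivative W q]) (use sub T(2) N x in \<open>blast+\<close>)
  then show "y \<in> {z. a \<bullet> z = b}" using x by simp
qed

end

text \<open>If \<open>a \<bullet> \<phi>\<close> were constant on one chart, the hyperplane would
  swallow the neighbouring charts and, by connectedness, all of \<open>M\<close>. Being nonconstant,
  it has a null set of critical points, and these are the points whose tangent space is orthogonal
  to \<open>a\<close>.\<close>

lemma analytic_chart_nondegenerate: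
  fixes M :: "'a::euclidean_space set" and \<phi> :: "real^'k \<Rightarrow> 'a"
  assumes M: "real_analytic_submanifold TYPE('k::finite) M" and con: "connected M"
    and hyp: "\<forall>a b. a \<noteq> 0 \<longrightarrow> \<not> M \<subseteq> {z. a \<bullet> z = b}"
    and ch: "analytic_chart M V \<phi> p r" and a: "a \<noteq> 0"
  shows "AE x in lborel. x \<in> ball p r \<longrightarrow> (\<exists>v. a \<bullet> frechet_derivative \<phi> (at x) v \<noteq> 0)"
proof -
  have nc: "\<not> (\<lambda>x. a \<bullet> \<phi> x) constant_on ball p r"
  proof
    assume "(\<lambda>x. a \<bullet> \<phi> x) constant_on ball p r"
    then obtain b where b: "\<And>x. x \<in> ball p r \<Longrightarrow> a \<bullet> \<phi> x = b" by (auto simp: constant_on_def)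
    \<comment> \<open>The property asks for a whole neighbourhood in the hyperplane rather than for
      membership of \<open>z\<close>, because only a neighbourhood can be continued across a
      chart.\<close>
    define P where "P z \<longleftrightarrow> (\<exists>N. openin (top_of_set M) N \<and> z \<in> N \<and> N \<subseteq> {z. a \<bullet> z = b})" for z
    have op: "openin (top_of_set M) (\<psi> ` ball q s)" if "analytic_chart M W \<psi> q s" for W \<psi> q s
      using that regular_parametrization_openin[of M W \<psi> "ball q s"] analytic_chart_ball[OF that]
      by (simp add: analytic_chart_def)
    have p: "\<phi> p \<in> \<phi> ` ball p r" using ch by (simp add: analytic_chart_def)
    have "P (\<phi> p)" unfolding P_def using op[OF ch] b p by blast
    moreover have pM: "\<phi> p \<in> M" using op[OF ch] p openin_imp_subset by blast
    moreover have "\<exists>T. openin (top_of_set M) T \<and> z \<in> T \<and> (\<forall>x\<in>T. \<forall>y\<in>T. P x \<longrightarrow> P y)" if zM: "z \<in> M" for z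
    proof -
      obtain W and \<psi> :: "real^'k \<Rightarrow> 'a" and q s where ch': "analytic_chart M W \<psi> q s" and q: "\<psi> q = z"
        by (rule analytic_chart_exists[OF M zM])
      have "z \<in> \<psi> ` ball q s" using q ch' by (auto simp: analytic_chart_def)
      moreover have "P y" if "x \<in> \<psi> ` ball q s" "y \<in> \<psi> ` ball q s" "P x" for x y
        using that analytic_chart_hyperplane[OF ch'] op[OF ch'] unfolding P_def by meson
      ultimately show ?thesis using op[OF ch'] by blast
    qed
    ultimately have "P z" if "z \<in> M" for z
      using connected_induction_simple[OF con, of "\<phi> p" z P] that by blast
    then have "M \<subseteq> {z. a \<bullet> z = b}" unfolding P_def by blast
    with hyp a show False by blast
  qed
  obtain c where c: "\<And>x. x \<in> ball p r \<Longrightarrow>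
    ((\<lambda>\<alpha>. (\<Prod>b\<in>Basis. ((x - p) \<bullet> b) ^ \<alpha> b) * c \<alpha>) has_sum a \<bullet> \<phi> x) multi_indices"
    by (rule analytic_chart_series[OF ch, where a = a]) (rule that, assumption)
  have cont: "continuous_on (ball p r) (\<lambda>x. a \<bullet> frechet_derivative \<phi> (at x) v)" for v
    by (intro continuous_on_inner continuous_on_const continuous_on_subset[OF smooth_on_derivative_continuous
          [OF analytic_chart_smooth[OF ch]] analytic_chart_ball[OF ch]])
  show ?thesis
    by (rule analytic_critical_points_null[OF c analytic_chart_derivative[OF ch] cont nc])
qed

lemma chart_null_set:
  fixes M :: "'a::euclidean_space set" and \<phi> :: "real^'k \<Rightarrow> 'a"
  assumes \<sigma>: "riemannian_volume TYPE('k::finite) M \<sigma>" and reg: "regular_parametrization M V \<phi>"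
    and A: "A \<in> null_sets lborel" "A \<subseteq> V"
  shows "\<phi> ` A \<in> null_sets \<sigma>"
proof -
  have Ab: "A \<in> sets borel" using A by auto
  have "emeasure \<sigma> (\<phi> ` A) = (\<integral>\<^sup>+x\<in>A. ennreal (volume_density \<phi> x) \<partial>lborel)"
    using \<sigma> reg Ab A(2) by (auto simp: riemannian_volume_def)
  also have "\<dots> = (\<integral>\<^sup>+x. 0 \<partial>(lborel :: (real^'k) measure))"
    by (rule nn_integral_cong_AE) (use AE_not_in[OF A(1)] in eventually_elim, simp)
  finally show ?thesis
    using regular_parametrization_borel[OF reg Ab A(2)] \<sigma> by (simp add: null_sets_def riemannian_volume_def)
qed

lemma chart_ball_finite:
  fixes M :: "'a::euclidean_space set" and \<phi> :: "real^'k \<Rightarrow> 'a"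
  assumes \<sigma>: "riemannian_volume TYPE('k::finite) M \<sigma>" and ch: "analytic_chart M V \<phi> p r"
  shows "emeasure \<sigma> (\<phi> ` ball p r) < \<infinity>"
proof -
  have "continuous_on (cball p r) (volume_density \<phi>)"
    by (rule continuous_on_subset[OF volume_density_continuous[OF analytic_chart_smooth[OF ch]]])
      (use ch in \<open>simp add: analytic_chart_def\<close>)
  then have "compact (volume_density \<phi> ` cball p r)"
    by (rule compact_continuous_image) simp
  from compact_imp_bounded[OF this]
  obtain B where "\<forall>y\<in>volume_density \<phi> ` cball p r. norm y \<le> B"
    unfolding bounded_iff by (rule exE)
  then have B: "volume_density \<phi> x \<le> B" if "x \<in> ball p r" for x
    using that by (auto simp: abs_le_iff)
  have "emeasure \<sigma> (\<phi> ` ball p r) = (\<integral>\<^sup>+x\<in>ball p r. ennreal (volume_density \<phi> x) \<partial>lborel)"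
    using \<sigma> ch analytic_chart_ball[OF ch] by (auto simp: riemannian_volume_def analytic_chart_def)
  also have "\<dots> \<le> (\<integral>\<^sup>+x. ennreal B * indicator (ball p r) x \<partial>lborel)"
    using B by (intro nn_integral_mono) (simp add: indicator_def ennreal_leI)
  also have "\<dots> < \<infinity>"
    using emeasure_lborel_ball_finite[of p r] by (simp add: nn_integral_cmult_indicator ennreal_mult_less_top)
  finally show ?thesis .
qed

text \<open>Finiteness of the cover serves twice: the supporting compact set gets finite volume, and
  there are finitely many ways of assigning charts to the summands of a convolution.\<close>

lemma compact_chart_cover:
  fixes M :: "'a::euclidean_space set"
  assumes M: "real_analytic_submanifold TYPE('k::finite) M" and K: "compact K" "K \<subseteq> M"
  obtains C :: "((real^'k) set \<times> (real^'k \<Rightarrow> 'a) \<times> (real^'k) \<times> real) set" where "finite C"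
    "\<And>V \<phi> p r. (V, \<phi>, p, r) \<in> C \<Longrightarrow> analytic_chart M V \<phi> p r"
    "K \<subseteq> (\<Union>(V, \<phi>, p, r)\<in>C. \<phi> ` ball p r)"
proof -
  have "\<exists>V \<phi> p r T. analytic_chart M V (\<phi> :: real^'k \<Rightarrow> 'a) p r \<and> \<phi> ` ball p r = M \<inter> T \<and> open T \<and> z \<in> T"
    if zM: "z \<in> M" for z
  proof -
    obtain V and \<phi> :: "real^'k \<Rightarrow> 'a" and p r where ch: "analytic_chart M V \<phi> p r" "\<phi> p = z"
      by (rule analytic_chart_exists[OF M zM])
    have "openin (top_of_set M) (\<phi> ` ball p r)"
      using regular_parametrization_openin[of M V \<phi> "ball p r"] analytic_chart_ball[OF ch(1)] ch(1)
      by (simp add: analytic_chart_def)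
    then obtain T where T: "open T" "\<phi> ` ball p r = M \<inter> T" by (auto simp: openin_open)
    have "z \<in> \<phi> ` ball p r" using ch by (auto simp: analytic_chart_def)
    then show ?thesis using T ch(1) by blast
  qed
  then obtain V \<phi> p r T where *: "\<And>z. z \<in> M \<Longrightarrow> analytic_chart M (V z) (\<phi> z :: real^'k \<Rightarrow> 'a) (p z) (r z) \<and>
      \<phi> z ` ball (p z) (r z) = M \<inter> T z \<and> open (T z) \<and> z \<in> T z"
    by metis
  have "open (T z)" "z \<in> T z" if "z \<in> K" for z
    using *[of z] K(2) that by auto
  then obtain F where F: "F \<subseteq> K" "finite F" "K \<subseteq> (\<Union>z\<in>F. T z)"
    using compactE_image[OF K(1), of K T] by (metis UN_I subsetI)
  show ?thesis
  proof (rule that[of "(\<lambda>z. (V z, \<phi> z, p z, r z)) ` F"])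
    show "K \<subseteq> (\<Union>(V, \<phi>, p, r)\<in>(\<lambda>z. (V z, \<phi> z, p z, r z)) ` F. \<phi> ` ball p r)"
    proof
      fix z assume "z \<in> K"
      then obtain w where w: "w \<in> F" "z \<in> T w" using F(3) by blast
      have "w \<in> M" "z \<in> M" using F(1) K(2) w(1) \<open>z \<in> K\<close> by auto
      then have "z \<in> \<phi> w ` ball (p w) (r w)" using *[of w] w(2) by auto
      then show "z \<in> (\<Union>(V, \<phi>, p, r)\<in>(\<lambda>z. (V z, \<phi> z, p z, r z)) ` F. \<phi> ` ball p r)"
        using w(1) by (intro UN_I[OF imageI[OF w(1)]]) simp
    qed
  next
    fix V' \<phi>' p' r' assume "(V', \<phi>', p', r') \<in> (\<lambda>z. (V z, \<phi> z, p z, r z)) ` F"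
    then obtain w where "w \<in> F" "V' = V w" "\<phi>' = \<phi> w" "p' = p w" "r' = r w" by auto
    then show "analytic_chart M V' \<phi>' p' r'" using *[of w] F(1) K(2) by blast
  qed (use F(2) in simp)
qed

section \<open>Sums of independent points of the charts\<close>

text \<open>Near a regular point the preimage of \<open>E\<close> is the image of a part of
  \<open>E\<close> under the differentiable local inverse, hence negligible. The Lindelof property
  reduces the union to countably many neighbourhoods.\<close>

lemma C1_regular_preimage_negligible:
  fixes \<Psi> :: "'z::euclidean_space \<Rightarrow> 'z"
  assumes S: "open S" and der: "\<And>s. s \<in> S \<Longrightarrow> (\<Psi> has_derivative \<Psi>' s) (at s)"
    and cont: "\<And>t. continuous_on S (\<lambda>s. \<Psi>' s t)" and E: "negligible E"
  shows "negligible {s \<in> S. inj (\<Psi>' s) \<and> \<Psi> s \<in> E}"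
proof -
  define R where "R = {s \<in> S. inj (\<Psi>' s)}"
  have bl: "bounded_linear (\<Psi>' s)" if "s \<in> S" for s
    using der[OF that] by (rule has_derivative_bounded_linear)
  have ap: "blinfun_apply (Blinfun (\<Psi>' s)) = \<Psi>' s" if "s \<in> S" for s
    using bl[OF that] by (rule bounded_linear_Blinfun_apply)
  have loc: "\<exists>W. open W \<and> s \<in> W \<and> negligible {s \<in> W. \<Psi> s \<in> E}" if s: "s \<in> R" for s
  proof -
    have sO: "s \<in> S" and inj: "inj (\<Psi>' s)" using s by (auto simp: R_def)
    \<comment> \<open>\<open>inverse_function_theorem\<close> asks for continuity of the derivative
      in the operator norm; in finite dimension this follows from continuity on each basis
      vector.\<close>
    have c: "continuous_on S (\<lambda>s. Blinfun (\<Psi>' s))"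
    proof (rule continuous_on_blinfun_componentwise)
      fix i
      show "continuous_on S (\<lambda>s. blinfun_apply (Blinfun (\<Psi>' s)) i)"
        using cont[of i] by (subst continuous_on_cong[OF refl]) (auto simp: ap)
    qed
    obtain g where g: "linear g" "g \<circ> \<Psi>' s = id"
      using linear_injective_left_inverse[OF bounded_linear.linear[OF bl[OF sO]] inj] by auto
    have li: "Blinfun g o\<^sub>L Blinfun (\<Psi>' s) = id_blinfun"
      using g ap[OF sO] by (intro blinfun_eqI)
        (simp add: linear_conv_bounded_linear bounded_linear_Blinfun_apply fun_eq_iff)
    have d: "(\<Psi> has_derivative blinfun_apply (Blinfun (\<Psi>' y))) (at y)" if "y \<in> S" for y
      using der[OF that] ap[OF that] by simp
    obtain W V h h' where W: "open W" "s \<in> W" "homeomorphism W V \<Psi> h"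
      "\<And>y. y \<in> V \<Longrightarrow> (h has_derivative h' y) (at y)"
      using inverse_function_theorem[OF S d c sO li] by metis
    have "negligible (h ` (V \<inter> E))"
    proof (rule negligible_differentiable_image_negligible)
      show "negligible (V \<inter> E)" using E negligible_Int by blast
      show "h differentiable_on V \<inter> E"
        using W(4) unfolding differentiable_on_def differentiable_def
        by (meson IntD1 has_derivative_at_withinI)
    qed simp
    moreover have "{s \<in> W. \<Psi> s \<in> E} \<subseteq> h ` (V \<inter> E)"
      using W(3) by (force simp: homeomorphism_def)
    ultimately show ?thesis using W negligible_subset by blast
  qed
  define \<F> where "\<F> = {W. open W \<and> negligible {s \<in> W. \<Psi> s \<in> E}}"
  obtain \<F>' where \<F>': "\<F>' \<subseteq> \<F>" "countable \<F>'" "\<Union>\<F>' = \<Union>\<F>"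
    by (rule Lindelof[of \<F>]) (auto simp: \<F>_def)
  have "negligible (\<Union>W\<in>\<F>'. {s \<in> W. \<Psi> s \<in> E})"
    using \<F>' by (intro negligible_countable_Union) (auto simp: \<F>_def)
  moreover have "{s \<in> S. inj (\<Psi>' s) \<and> \<Psi> s \<in> E} \<subseteq> (\<Union>W\<in>\<F>'. {s \<in> W. \<Psi> s \<in> E})"
  proof
    fix s assume s: "s \<in> {s \<in> S. inj (\<Psi>' s) \<and> \<Psi> s \<in> E}"
    then have "s \<in> \<Union>\<F>" using loc[of s] by (auto simp: R_def \<F>_def)
    then show "s \<in> (\<Union>W\<in>\<F>'. {s \<in> W. \<Psi> s \<in> E})" using s \<F>'(3) by auto
  qed
  ultimately show ?thesis using negligible_subset by blast
qed

text \<open>The invariance hypothesis of \<open>null_set_by_averaging\<close> for families of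
  points, each shifted by a vector of its own.\<close>

lemma PiM_lborel_translation:
  fixes a :: "'i \<Rightarrow> 'x::euclidean_space"
  assumes I: "finite I"
  shows "distr (PiM I (\<lambda>_. lborel)) (PiM I (\<lambda>_. lborel)) (\<lambda>x. \<lambda>i\<in>I. x i + a i) = PiM I (\<lambda>_. lborel)"
proof -
  interpret product_sigma_finite "\<lambda>_::'i. lborel :: 'x measure" by standard
  show ?thesis
  proof (rule PiM_eqI[OF I])
    fix A :: "'i \<Rightarrow> 'x set" assume A: "\<And>i. i \<in> I \<Longrightarrow> A i \<in> sets lborel"
    have [measurable]: "(\<lambda>x. \<lambda>i\<in>I. x i + a i) \<in> measurable (PiM I (\<lambda>_. lborel)) (PiM I (\<lambda>_. lborel))"
      by measurable
    have t: "(\<lambda>x. x + a i) \<in> measurable lborel (lborel :: 'x measure)" for i by measurable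
    have eq: "(\<lambda>x. \<lambda>i\<in>I. x i + a i) -` Pi\<^sub>E I A \<inter> space (PiM I (\<lambda>_. lborel)) = Pi\<^sub>E I (\<lambda>i. (\<lambda>x. x + a i) -` A i)"
      by (auto simp: space_PiM PiE_iff extensional_def)
    have "emeasure (distr (PiM I (\<lambda>_. lborel)) (PiM I (\<lambda>_. lborel)) (\<lambda>x. \<lambda>i\<in>I. x i + a i)) (Pi\<^sub>E I A)
       = emeasure (PiM I (\<lambda>_. lborel)) (Pi\<^sub>E I (\<lambda>i. (\<lambda>x. x + a i) -` A i))"
      using A I by (subst emeasure_distr) (auto simp: eq intro!: sets_PiM_I_finite)
    also have "\<dots> = (\<Prod>i\<in>I. emeasure lborel ((\<lambda>x. x + a i) -` A i))"
      using I A measurable_sets[OF t] by (subst emeasure_PiM) auto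
    also have "\<dots> = (\<Prod>i\<in>I. emeasure lborel (A i))"
    proof (rule prod.cong[OF refl])
      fix i assume i: "i \<in> I"
      have "emeasure lborel (A i) = emeasure (distr lborel borel ((+) (a i))) (A i)"
        by (simp add: lborel_distr_plus)
      also have "\<dots> = emeasure lborel ((\<lambda>x. x + a i) -` A i)"
        using A[OF i] by (subst emeasure_distr) (auto simp: vimage_def add.commute)
      finally show "emeasure lborel ((\<lambda>x. x + a i) -` A i) = emeasure lborel (A i)" by simp
    qed
    finally show "emeasure (distr (PiM I (\<lambda>_. lborel)) (PiM I (\<lambda>_. lborel)) (\<lambda>x. \<lambda>i\<in>I. x i + a i)) (Pi\<^sub>E I A)
       = (\<Prod>i\<in>I. emeasure lborel (A i))" .
  qed simp
qed

text \<open>Makes injectivity a measurable condition, by countably many inequalities. An injective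
  linear map in finite dimension is bounded below, and a lower bound on a dense set extends by
  continuity.\<close>

lemma inj_linear_iff_countable:
  fixes L :: "'a::euclidean_space \<Rightarrow> 'b::euclidean_space"
  assumes L: "linear L" and D: "closure D = UNIV"
  shows "inj L \<longleftrightarrow> (\<exists>m::nat. \<forall>s\<in>D. norm s \<le> real m * norm (L s))"
proof
  assume "inj L"
  then obtain B where B: "B > 0" "\<And>x. B * norm x \<le> norm (L x)"
    using linear_inj_bounded_below_pos[OF L] by blast
  obtain m where m: "1 / B \<le> real m" using real_arch_simple by blast
  have "norm s \<le> real m * norm (L s)" for s
  proof -
    have "norm s = 1 / B * (B * norm s)" using B by simp
    also have "\<dots> \<le> real m * norm (L s)"
      using m B by (intro mult_mono) auto
    finally show ?thesis .
  qed
  then show "\<exists>m::nat. \<forall>s\<in>D. norm s \<le> real m * norm (L s)" by blast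
next
  assume "\<exists>m::nat. \<forall>s\<in>D. norm s \<le> real m * norm (L s)"
  then obtain m where m: "\<And>s. s \<in> D \<Longrightarrow> norm s \<le> real m * norm (L s)" by blast
  have "closed {s. norm s \<le> real m * norm (L s)}"
    using L by (intro closed_Collect_le continuous_intros linear_continuous_on) (simp add: linear_conv_bounded_linear)
  then have "closure D \<subseteq> {s. norm s \<le> real m * norm (L s)}"
    using m by (intro closure_minimal) auto
  then have "norm s \<le> real m * norm (L s)" for s using D by auto
  then have "s = 0" if "L s = 0" for s using that by (metis mult_zero_right norm_le_zero_iff norm_zero)
  then show "inj L" using linear_injective_0[OF L] by blast
qed

text \<open>Shift each point \<open>x b\<close> by \<open>(s \<bullet> b)\<close> times
  \<open>v b\<close>. The sum becomes a map of the single variable \<open>s\<close> from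
  \<open>'z\<close> to itself, and its derivative is exactly the linear map that the statement asks
  to be injective. So almost every \<open>s\<close> misses the set, and averaging over
  \<open>s\<close> shows that the set is null in the product.\<close>

lemma regular_fibre_null:
  fixes \<Phi> :: "'z::euclidean_space \<Rightarrow> 'x::euclidean_space \<Rightarrow> 'z" and v :: "'z \<Rightarrow> 'x"
  assumes U: "\<And>b. b \<in> Basis \<Longrightarrow> open (U b)"
    and der: "\<And>b x. b \<in> Basis \<Longrightarrow> x \<in> U b \<Longrightarrow> (\<Phi> b has_derivative \<Phi>' b x) (at x)"
    and cont: "\<And>b v. b \<in> Basis \<Longrightarrow> continuous_on (U b) (\<lambda>x. \<Phi>' b x v)"
    and E: "E \<in> null_sets lborel"
  shows "{x \<in> space (PiM Basis (\<lambda>_. lborel)). (\<forall>b\<in>Basis. x b \<in> U b) \<and>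
      inj (\<lambda>s. \<Sum>b\<in>Basis. (s \<bullet> b) *\<^sub>R \<Phi>' b (x b) (v b)) \<and> (\<Sum>b\<in>Basis. \<Phi> b (x b)) \<in> E}
    \<in> null_sets (PiM Basis (\<lambda>_. lborel))"
proof -
  let ?P = "PiM (Basis :: 'z set) (\<lambda>_. lborel :: 'x measure)"
  interpret product_sigma_finite "\<lambda>_::'z. lborel :: 'x measure" by standard
  define L where "L x s = (\<Sum>b\<in>Basis. (s \<bullet> b) *\<^sub>R \<Phi>' b (x b) (v b))" for x s
  have linL: "linear (L x)" for x
    unfolding L_def by (intro linear_compose_sum ballI linearI) (auto simp: inner_simps scaleR_left_distrib)
  obtain d :: "nat \<Rightarrow> 'z" where d: "closure (range d) = UNIV"
  proof -
    obtain D :: "'z set" where D: "countable D" "UNIV \<subseteq> closure D"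
      using separable[of "UNIV :: 'z set"] by auto
    then have "D \<noteq> {}" by auto
    then have "range (from_nat_into D) = D" using D(1) by (rule range_from_nat_into)
    with D(2) that[of "from_nat_into D"] show ?thesis by auto
  qed
  define Q where "Q = {x \<in> space ?P. (\<forall>b\<in>Basis. x b \<in> U b) \<and> inj (L x) \<and> (\<Sum>b\<in>Basis. \<Phi> b (x b)) \<in> E}"
  have "Q \<in> sets ?P"
  proof -
    \<comment> \<open>Cut off to 0 outside the open sets, where nothing is known about the
      functions. This makes them Borel on the whole space and leaves \<open>Q\<close>
      unchanged.\<close>
    define \<Phi>0 where "\<Phi>0 b x = indicator (U b) x *\<^sub>R \<Phi> b x" for b x
    define \<Phi>1 where "\<Phi>1 b x = indicator (U b) x *\<^sub>R \<Phi>' b x (v b)" for b x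
    have [measurable]: "\<Phi>0 b \<in> borel_measurable borel" "\<Phi>1 b \<in> borel_measurable borel" "U b \<in> sets borel"
      if "b \<in> Basis" for b
    proof -
      show "U b \<in> sets borel" using U[OF that] by auto
      have "continuous_on (U b) (\<Phi> b)"
        using der[OF that] by (meson continuous_at_imp_continuous_on has_derivative_continuous)
      then show "\<Phi>0 b \<in> borel_measurable borel" "\<Phi>1 b \<in> borel_measurable borel"
        unfolding \<Phi>0_def \<Phi>1_def using U[OF that] cont[OF that]
        by (auto intro!: borel_measurable_continuous_on_indicator)
    qed
    note [measurable] = null_setsD2[OF E, simplified]
    have "Q = {x \<in> space ?P. (\<forall>b\<in>Basis. x b \<in> U b) \<and>
       (\<exists>m::nat. \<forall>k. norm (d k) \<le> real m * norm (\<Sum>b\<in>Basis. (d k \<bullet> b) *\<^sub>R \<Phi>1 b (x b))) \<and>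
       (\<Sum>b\<in>Basis. \<Phi>0 b (x b)) \<in> E}"
      unfolding Q_def inj_linear_iff_countable[OF linL d] ball_simps(9)
      by (intro Collect_cong conj_cong refl) (auto simp: L_def \<Phi>0_def \<Phi>1_def)
    also have "\<dots> \<in> sets ?P"
    proof -
      have c: "(\<lambda>x. \<Phi>1 b (x b)) \<in> borel_measurable ?P" "(\<lambda>x. \<Phi>0 b (x b)) \<in> borel_measurable ?P"
        "Measurable.pred ?P (\<lambda>x. x b \<in> U b)" if b: "b \<in> Basis" for b
      proof -
        have [measurable]: "(\<lambda>x. x b) \<in> measurable ?P borel"
          using measurable_component_singleton[OF b, of "\<lambda>_. lborel :: 'x measure"] by simp
        note [measurable] = \<open>b \<in> Basis \<Longrightarrow> \<Phi>0 b \<in> borel_measurable borel\<close>[OF b]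
          \<open>b \<in> Basis \<Longrightarrow> \<Phi>1 b \<in> borel_measurable borel\<close>[OF b] \<open>b \<in> Basis \<Longrightarrow> U b \<in> sets borel\<close>[OF b]
        show "(\<lambda>x. \<Phi>1 b (x b)) \<in> borel_measurable ?P" "(\<lambda>x. \<Phi>0 b (x b)) \<in> borel_measurable ?P"
          "Measurable.pred ?P (\<lambda>x. x b \<in> U b)" by measurable
      qed
      have 1: "Measurable.pred ?P (\<lambda>x. \<forall>b\<in>Basis. x b \<in> U b)"
        by (intro pred_intros_finite c) auto
      have "(\<lambda>x. \<Sum>b\<in>Basis. (d k \<bullet> b) *\<^sub>R \<Phi>1 b (x b)) \<in> borel_measurable ?P" for k
        using c by (intro borel_measurable_sum borel_measurable_scaleR borel_measurable_const) auto
      then have 2: "Measurable.pred ?P (\<lambda>x. \<forall>k. norm (d k) \<le> real m * norm (\<Sum>b\<in>Basis. (d k \<bullet> b) *\<^sub>R \<Phi>1 b (x b)))" for m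
        by measurable
      have 3: "(\<lambda>x. \<Sum>b\<in>Basis. \<Phi>0 b (x b)) \<in> borel_measurable ?P"
        using c by (intro borel_measurable_sum) auto
      show ?thesis using 1 2 3 by measurable
    qed
    finally show ?thesis .
  qed
  moreover have "AE s in lborel. (\<lambda>b\<in>Basis. x b + (s \<bullet> b) *\<^sub>R v b) \<notin> Q" if "x \<in> space ?P" for x
  proof -
    define S where "S = {s. \<forall>b\<in>Basis. x b + (s \<bullet> b) *\<^sub>R v b \<in> U b}"
    define \<Psi> where "\<Psi> s = (\<Sum>b\<in>Basis. \<Phi> b (x b + (s \<bullet> b) *\<^sub>R v b))" for s
    define \<Psi>' where "\<Psi>' s = L (\<lambda>b. x b + (s \<bullet> b) *\<^sub>R v b)" for s
    have "S = (\<Inter>b\<in>Basis. (\<lambda>s. x b + (s \<bullet> b) *\<^sub>R v b) -` U b)" by (auto simp: S_def)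
    also have "open \<dots>"
      by (intro open_INT finite_Basis ballI open_vimage U continuous_intros) auto
    finally have "open S" .
    have "negligible {s \<in> S. inj (\<Psi>' s) \<and> \<Psi> s \<in> E}"
    proof (rule C1_regular_preimage_negligible[OF \<open>open S\<close>])
      fix s assume s: "s \<in> S"
      have "((\<lambda>s. \<Phi> b (x b + (s \<bullet> b) *\<^sub>R v b)) has_derivative (\<lambda>t. (t \<bullet> b) *\<^sub>R \<Phi>' b (x b + (s \<bullet> b) *\<^sub>R v b) (v b))) (at s)"
        if b: "b \<in> Basis" for b
      proof -
        have sb: "x b + (s \<bullet> b) *\<^sub>R v b \<in> U b" using s b by (simp add: S_def)
        have "((\<lambda>s. \<Phi> b (x b + (s \<bullet> b) *\<^sub>R v b)) has_derivative (\<lambda>t. \<Phi>' b (x b + (s \<bullet> b) *\<^sub>R v b) ((t \<bullet> b) *\<^sub>R v b))) (at s)"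
          by (rule has_derivative_compose[of "\<lambda>s. x b + (s \<bullet> b) *\<^sub>R v b" "\<lambda>t. (t \<bullet> b) *\<^sub>R v b", OF _ der[OF b sb]])
            (auto intro!: derivative_eq_intros)
        then show ?thesis
          by (simp add: linear_scale[OF has_derivative_linear[OF der[OF b sb]]])
      qed
      then show "(\<Psi> has_derivative \<Psi>' s) (at s)"
        unfolding \<Psi>_def \<Psi>'_def L_def by (intro has_derivative_sum) auto
    next
      fix t
      show "continuous_on S (\<lambda>s. \<Psi>' s t)"
        unfolding \<Psi>'_def L_def
        by (intro continuous_on_sum continuous_on_scaleR continuous_on_const
            continuous_on_compose2[OF cont]) (auto simp: S_def intro!: continuous_intros)
      show "negligible E" using E by (simp add: negligible_iff_null_sets null_sets_completionI)
    qed
    then have "AE s in lebesgue. s \<notin> {s \<in> S. inj (\<Psi>' s) \<and> \<Psi> s \<in> E}"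
      by (intro AE_not_in) (simp add: negligible_iff_null_sets)
    then have "AE s in lborel. s \<notin> {s \<in> S. inj (\<Psi>' s) \<and> \<Psi> s \<in> E}"
      by (simp add: AE_completion_iff)
    then show ?thesis
    proof eventually_elim
      fix s assume s: "s \<notin> {s \<in> S. inj (\<Psi>' s) \<and> \<Psi> s \<in> E}"
      have "L (\<lambda>b\<in>Basis. x b + (s \<bullet> b) *\<^sub>R v b) = \<Psi>' s"
        by (auto simp: \<Psi>'_def L_def)
      then show "(\<lambda>b\<in>Basis. x b + (s \<bullet> b) *\<^sub>R v b) \<notin> Q"
        using s by (auto simp: Q_def S_def \<Psi>_def)
    qed
  qed
  moreover have "(\<lambda>(s, x). \<lambda>b\<in>Basis. x b + (s \<bullet> b) *\<^sub>R v b) \<in> measurable (lborel \<Otimes>\<^sub>M ?P) ?P"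
    unfolding split_beta'
  proof (rule measurable_restrict)
    fix b :: 'z assume b: "b \<in> Basis"
    have [measurable]: "(\<lambda>w. snd w b) \<in> borel_measurable ((lborel :: 'z measure) \<Otimes>\<^sub>M ?P)"
      using measurable_compose[OF measurable_snd[of "lborel :: 'z measure" ?P]
          measurable_component_singleton[OF b, of "\<lambda>_. lborel :: 'x measure"]] by simp
    have [measurable]: "fst \<in> borel_measurable ((lborel :: 'z measure) \<Otimes>\<^sub>M ?P)"
      using measurable_fst[of "lborel :: 'z measure" ?P] by simp
    show "(\<lambda>w. snd w b + (fst w \<bullet> b) *\<^sub>R v b) \<in> measurable (lborel \<Otimes>\<^sub>M ?P) lborel"
      by simp
  qed
  ultimately have "Q \<in> null_sets ?P"
    by (intro null_set_by_averaging[where S = "lborel :: 'z measure" and X = ?P and Q = Q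
          and \<tau> = "\<lambda>s x. \<lambda>b\<in>Basis. x b + (s \<bullet> b) *\<^sub>R v b", OF sigma_finite_lborel sigma_finite[OF finite_Basis]])
      (simp_all add: PiM_lborel_translation)
  then show ?thesis by (simp add: Q_def L_def[abs_def])
qed

text \<open>Iterated quantifiers stand in for \<open>AE\<close> on a product measure: they make
  sense for nonmeasurable \<open>P\<close>, and what is chosen for one variable may depend on the
  earlier ones. The point \<open>x\<close> supplies the coordinates outside the list.\<close>

primrec nested_AE :: "'b list \<Rightarrow> (('b \<Rightarrow> 'x::euclidean_space) \<Rightarrow> bool) \<Rightarrow> ('b \<Rightarrow> 'x) \<Rightarrow> bool" where
  "nested_AE [] P x = P x"
| "nested_AE (b # bs) P x = (AE y in lborel. nested_AE bs P (x(b := y)))"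

lemma nested_AE_mono:
  assumes "nested_AE bs P x" "\<And>x. P x \<Longrightarrow> Q x"
  shows "nested_AE bs Q x"
  using assms(1) by (induction bs arbitrary: x) (auto simp: assms(2) elim!: eventually_mono)

lemma nested_AE_conj:
  assumes "nested_AE bs P x" "nested_AE bs Q x"
  shows "nested_AE bs (\<lambda>x. P x \<and> Q x) x"
  using assms by (induction bs arbitrary: x) (auto elim: eventually_elim2)

lemma nested_AE_ball_countable:
  assumes "countable I" "\<And>i. i \<in> I \<Longrightarrow> nested_AE bs (P i) x"
  shows "nested_AE bs (\<lambda>x. \<forall>i\<in>I. P i x) x"
  using assms(2)
proof (induction bs arbitrary: x)
  case (Cons b bs)
  have "AE y in lborel. \<forall>i\<in>I. nested_AE bs (P i) (x(b := y))"
    using Cons.prems by (simp add: AE_ball_countable[OF assms(1)])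
  then show ?case by (auto elim!: eventually_mono intro: Cons.IH)
qed simp

lemma nested_AE_fixed: "b \<notin> set bs \<Longrightarrow> nested_AE bs (\<lambda>x'. x' b = x b) x"
proof (induction bs arbitrary: x)
  case (Cons c bs)
  have "nested_AE bs (\<lambda>x'. x' b = x b) (x(c := y))" for y
    using Cons.IH[of "x(c := y)"] Cons.prems by (simp del: fun_upd_apply add: fun_upd_other)
  then show ?case by simp
qed simp

lemma nested_AE_upd:
  "b \<notin> set bs \<Longrightarrow> nested_AE bs P (x(b := y)) = nested_AE bs (\<lambda>x. P (x(b := y))) x"
proof (induction bs arbitrary: x)
  case (Cons c bs)
  then have "x(b := y, c := z) = x(c := z, b := y)" for z by (auto simp: fun_upd_twist)
  then show ?case using Cons by (simp del: fun_upd_apply)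
qed simp

text \<open>Tonelli, one coordinate at a time. The starting point is \<open>undefined\<close>
  everywhere because that is the value of an element of a product space off its index set.\<close>

lemma nested_AE_PiM:
  fixes P :: "('b \<Rightarrow> 'x::euclidean_space) \<Rightarrow> bool"
  assumes "distinct bs" "{x \<in> space (PiM (set bs) (\<lambda>_. lborel)). \<not> P x} \<in> null_sets (PiM (set bs) (\<lambda>_. lborel))"
  shows "nested_AE bs P (\<lambda>_. undefined)"
  using assms
proof (induction bs arbitrary: P)
  case Nil
  then have "emeasure (count_space {\<lambda>_. undefined}) {x \<in> {\<lambda>_. undefined}. \<not> P x} = 0"
    by (auto simp: PiM_empty null_sets_def)
  then have "\<not> \<not> P (\<lambda>_. undefined)" by (auto simp: emeasure_count_space_eq_0)
  then show ?case by simp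
next
  case (Cons b bs)
  interpret product_sigma_finite "\<lambda>_::'b. lborel :: 'x measure" by standard
  let ?I = "set bs"
  let ?P = "PiM ?I (\<lambda>_. lborel :: 'x measure)"
  let ?P' = "PiM (insert b ?I) (\<lambda>_. lborel :: 'x measure)"
  have b: "b \<notin> ?I" "distinct bs" using Cons.prems by auto
  define N where "N = {x \<in> space ?P'. \<not> P x}"
  have N: "N \<in> null_sets ?P'" using Cons.prems by (simp add: N_def)
  have [measurable]: "N \<in> sets ?P'" using N by auto
  have upd: "(\<lambda>x. x(b := y)) \<in> measurable ?P ?P'" for y
    by (rule measurable_fun_upd[where J = ?I]) auto
  have upd2: "(\<lambda>(y, x). x(b := y)) \<in> measurable (lborel \<Otimes>\<^sub>M ?P) ?P'"
    unfolding split_beta' by (rule measurable_fun_upd[where J = ?I]) auto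
  have iN: "(\<lambda>(y, x). indicator N (x(b := y)) :: ennreal) \<in> borel_measurable (lborel \<Otimes>\<^sub>M ?P)"
    using measurable_compose[OF upd2 borel_measurable_indicator[of N ?P', where 'b = ennreal]] by (simp add: split_beta')
  interpret sf: sigma_finite_measure ?P by (rule sigma_finite) simp
  have m: "(\<lambda>y. \<integral>\<^sup>+x. indicator N (x(b := y)) \<partial>?P) \<in> borel_measurable lborel"
    using sf.borel_measurable_nn_integral_fst[OF iN] by simp
  have "0 = emeasure ?P' N" using N by auto
  also have "\<dots> = (\<integral>\<^sup>+x. indicator N x \<partial>?P')" by simp
  also have "\<dots> = (\<integral>\<^sup>+y. \<integral>\<^sup>+x. indicator N (x(b := y)) \<partial>?P \<partial>lborel)"
    by (rule product_nn_integral_insert_rev) (use b in auto)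
  finally have "AE y in lborel. (\<integral>\<^sup>+x. indicator N (x(b := y)) \<partial>?P) = 0"
    using nn_integral_0_iff_AE[OF m] by simp
  then have "AE y in lborel. nested_AE bs P ((\<lambda>_. undefined)(b := y))"
  proof eventually_elim
    fix y assume y: "(\<integral>\<^sup>+x. indicator N (x(b := y)) \<partial>?P) = 0"
    have eq: "(\<lambda>x. x(b := y)) -` N \<inter> space ?P = {x \<in> space ?P. \<not> P (x(b := y))}"
      using measurable_space[OF upd] by (auto simp: N_def)
    have s: "{x \<in> space ?P. \<not> P (x(b := y))} \<in> sets ?P"
      unfolding eq[symmetric] by (rule measurable_sets[OF upd]) simp
    have "emeasure ?P {x \<in> space ?P. \<not> P (x(b := y))} = (\<integral>\<^sup>+x. indicator {x \<in> space ?P. \<not> P (x(b := y))} x \<partial>?P)"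
      using s by simp
    also have "\<dots> = (\<integral>\<^sup>+x. indicator N (x(b := y)) \<partial>?P)"
      using measurable_space[OF upd] by (intro nn_integral_cong) (auto simp: indicator_def N_def)
    finally have "{x \<in> space ?P. \<not> P (x(b := y))} \<in> null_sets ?P"
      using s y by auto
    then have "nested_AE bs (\<lambda>x. P (x(b := y))) (\<lambda>_. undefined)"
      by (rule Cons.IH[OF b(2)])
    then show "nested_AE bs P ((\<lambda>_. undefined)(b := y))"
      using nested_AE_upd[OF b(1)] by metis
  qed
  then show ?case by simp
qed

text \<open>\<open>B\<close> holds the vectors already found. While there are fewer than
  \<open>DIM('z)\<close> of them, some \<open>a \<noteq> 0\<close> is orthogonal to all; for almost
  every next point the derivative has a value not orthogonal to \<open>a\<close>, hence outside the
  span. This value can be taken at a basis vector, which keeps the choices of \<open>v\<close>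
  finite in number.\<close>

lemma nested_AE_independent:
  fixes \<Phi>' :: "'b \<Rightarrow> 'x::euclidean_space \<Rightarrow> 'x \<Rightarrow> 'z::euclidean_space"
  assumes lin: "\<And>b y. b \<in> set bs \<Longrightarrow> y \<in> U b \<Longrightarrow> linear (\<Phi>' b y)"
    and nondeg: "\<And>b a. b \<in> set bs \<Longrightarrow> a \<noteq> 0 \<Longrightarrow> AE y in lborel. y \<in> U b \<longrightarrow> (\<exists>v. a \<bullet> \<Phi>' b y v \<noteq> 0)"
    and "distinct bs" "independent B" "card B + length bs \<le> DIM('z)"
  shows "nested_AE bs (\<lambda>x. (\<forall>b\<in>set bs. x b \<in> U b) \<longrightarrow> (\<exists>v. (\<forall>b\<in>set bs. v b \<in> Basis) \<and>
    inj_on (\<lambda>b. \<Phi>' b (x b) (v b)) (set bs) \<and> B \<inter> (\<lambda>b. \<Phi>' b (x b) (v b)) ` set bs = {} \<and>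
    independent (B \<union> (\<lambda>b. \<Phi>' b (x b) (v b)) ` set bs))) x"
  using assms
proof (induction bs arbitrary: x B)
  case (Cons b bs)
  have fB: "finite B" using independent_bound[OF Cons.prems(4)] by simp
  have "dim B < DIM('z)" using Cons.prems(4,5) by (simp add: dim_eq_card_independent)
  then have "span B \<noteq> UNIV" by (metis dim_UNIV dim_span less_irrefl)
  then obtain a :: 'z where a: "a \<noteq> 0" "\<And>z. z \<in> span B \<Longrightarrow> a \<bullet> z = 0"
    using span_not_UNIV_orthogonal by blast
  have "AE y in lborel. y \<in> U b \<longrightarrow> (\<exists>v. a \<bullet> \<Phi>' b y v \<noteq> 0)"
    using Cons.prems(2) a(1) by simp
  then show ?case unfolding nested_AE.simps
  proof eventually_elim
    fix y assume y: "y \<in> U b \<longrightarrow> (\<exists>v. a \<bullet> \<Phi>' b y v \<noteq> 0)"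
    have bb: "b \<notin> set bs" using Cons.prems(3) by simp
    show "nested_AE bs (\<lambda>x. (\<forall>b\<in>set (b # bs). x b \<in> U b) \<longrightarrow> (\<exists>v. (\<forall>b\<in>set (b # bs). v b \<in> Basis) \<and>
      inj_on (\<lambda>b. \<Phi>' b (x b) (v b)) (set (b # bs)) \<and> B \<inter> (\<lambda>b. \<Phi>' b (x b) (v b)) ` set (b # bs) = {} \<and>
      independent (B \<union> (\<lambda>b. \<Phi>' b (x b) (v b)) ` set (b # bs)))) (x(b := y))"
    proof (cases "y \<in> U b")
      case False
      \<comment> \<open>Coordinate \<open>b\<close> keeps the value \<open>y\<close> while the later
        variables are drawn, so the premise of the implication fails.\<close>
      show ?thesis
        by (rule nested_AE_mono[OF nested_AE_fixed[OF bb]]) (use False in auto)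
    next
      case True
      then obtain v1 where v1: "a \<bullet> \<Phi>' b y v1 \<noteq> 0" using y by blast
      have lin: "linear (\<Phi>' b y)" using Cons.prems(1) True by simp
      obtain v0 where v0: "v0 \<in> Basis" "a \<bullet> \<Phi>' b y v0 \<noteq> 0"
      proof (rule ccontr)
        assume "\<not> thesis"
        then have z: "\<And>v. v \<in> Basis \<Longrightarrow> a \<bullet> \<Phi>' b y v = 0" using that by blast
        have "\<Phi>' b y v1 = \<Phi>' b y (\<Sum>i\<in>Basis. (v1 \<bullet> i) *\<^sub>R i)" by (simp add: euclidean_representation)
        also have "\<dots> = (\<Sum>i\<in>Basis. (v1 \<bullet> i) *\<^sub>R \<Phi>' b y i)"
          by (simp add: linear_sum[OF lin] linear_scale[OF lin])
        finally show False using v1 z by (simp add: inner_sum_right)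
      qed
      define w where "w = \<Phi>' b y v0"
      have w: "w \<notin> span B" using a(2) v0(2) by (auto simp: w_def)
      then have wB: "w \<notin> B" using span_base by blast
      have ind: "independent (insert w B)" using w Cons.prems(4) by (simp add: independent_insert wB)
      have "nested_AE bs (\<lambda>x. (\<forall>b\<in>set bs. x b \<in> U b) \<longrightarrow> (\<exists>v. (\<forall>b\<in>set bs. v b \<in> Basis) \<and>
        inj_on (\<lambda>b. \<Phi>' b (x b) (v b)) (set bs) \<and> insert w B \<inter> (\<lambda>b. \<Phi>' b (x b) (v b)) ` set bs = {} \<and>
        independent (insert w B \<union> (\<lambda>b. \<Phi>' b (x b) (v b)) ` set bs))) (x(b := y))"
        by (rule Cons.IH) (use Cons.prems ind wB fB in auto)
      from nested_AE_conj[OF this nested_AE_fixed[OF bb]] show ?thesis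
      proof (rule nested_AE_mono)
        fix x' assume x': "((\<forall>b\<in>set bs. x' b \<in> U b) \<longrightarrow> (\<exists>v. (\<forall>b\<in>set bs. v b \<in> Basis) \<and>
          inj_on (\<lambda>b. \<Phi>' b (x' b) (v b)) (set bs) \<and> insert w B \<inter> (\<lambda>b. \<Phi>' b (x' b) (v b)) ` set bs = {} \<and>
          independent (insert w B \<union> (\<lambda>b. \<Phi>' b (x' b) (v b)) ` set bs))) \<and> x' b = (x(b := y)) b"
        show "(\<forall>b\<in>set (b # bs). x' b \<in> U b) \<longrightarrow> (\<exists>v. (\<forall>b\<in>set (b # bs). v b \<in> Basis) \<and>
          inj_on (\<lambda>b. \<Phi>' b (x' b) (v b)) (set (b # bs)) \<and> B \<inter> (\<lambda>b. \<Phi>' b (x' b) (v b)) ` set (b # bs) = {} \<and>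
          independent (B \<union> (\<lambda>b. \<Phi>' b (x' b) (v b)) ` set (b # bs)))"
        proof
          assume "\<forall>b\<in>set (b # bs). x' b \<in> U b"
          then obtain v where v: "\<forall>b\<in>set bs. v b \<in> Basis" "inj_on (\<lambda>b. \<Phi>' b (x' b) (v b)) (set bs)"
            "insert w B \<inter> (\<lambda>b. \<Phi>' b (x' b) (v b)) ` set bs = {}"
            "independent (insert w B \<union> (\<lambda>b. \<Phi>' b (x' b) (v b)) ` set bs)"
            using x' by auto
          define v' where "v' = v(b := v0)"
          have vb: "\<Phi>' b (x' b) (v' b) = w" using x' by (simp add: v'_def w_def)
          have vr: "\<Phi>' c (x' c) (v' c) = \<Phi>' c (x' c) (v c)" if "c \<in> set bs" for c
            using that bb by (auto simp: v'_def)
          have im: "(\<lambda>b. \<Phi>' b (x' b) (v' b)) ` set bs = (\<lambda>b. \<Phi>' b (x' b) (v b)) ` set bs"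
            by (rule image_cong[OF refl vr])
          have "inj_on (\<lambda>b. \<Phi>' b (x' b) (v' b)) (set bs)"
            using v(2) by (simp add: inj_on_def vr)
          then have "inj_on (\<lambda>b. \<Phi>' b (x' b) (v' b)) (set (b # bs))"
            using v(3) bb im vb by auto
          moreover have "\<forall>c\<in>set (b # bs). v' c \<in> Basis" using v(1) v0(1) by (auto simp: v'_def)
          moreover have "B \<inter> (\<lambda>b. \<Phi>' b (x' b) (v' b)) ` set (b # bs) = {}"
            using v(3) im vb wB by auto
          moreover have "independent (B \<union> (\<lambda>b. \<Phi>' b (x' b) (v' b)) ` set (b # bs))"
            using v(4) im vb by simp
          ultimately show "\<exists>v. (\<forall>b\<in>set (b # bs). v b \<in> Basis) \<and>
            inj_on (\<lambda>b. \<Phi>' b (x' b) (v b)) (set (b # bs)) \<and> B \<inter> (\<lambda>b. \<Phi>' b (x' b) (v b)) ` set (b # bs) = {} \<and>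
            independent (B \<union> (\<lambda>b. \<Phi>' b (x' b) (v b)) ` set (b # bs))" by blast
        qed
      qed
    qed
  qed
qed auto

section \<open>Convolution powers\<close>

definition finite_borel :: "'a::topological_space measure \<Rightarrow> bool"
  where "finite_borel M \<longleftrightarrow> finite_measure M \<and> sets M = sets borel"

lemma finite_borelD:
  assumes "finite_borel M"
  shows "finite_measure M" "sigma_finite_measure M" "sets M = sets borel" "space M = UNIV"
  using assms sets_eq_imp_space_eq[of M borel]
  by (auto simp: finite_borel_def finite_measure.axioms)

definition conv :: "'a::euclidean_space measure \<Rightarrow> 'a measure \<Rightarrow> 'a measure"
  where "conv M N = distr (M \<Otimes>\<^sub>M N) borel (\<lambda>(x, y). x + y)"

lemma conv_map_measurable:
  fixes M N :: "'a::euclidean_space measure"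
  assumes "finite_borel M" "finite_borel N"
  shows "(\<lambda>(x, y). x + y) \<in> measurable (M \<Otimes>\<^sub>M N) borel"
proof -
  have "(\<lambda>(x, y). x + y :: 'a) \<in> measurable (borel \<Otimes>\<^sub>M borel) borel" by simp
  moreover have "sets (M \<Otimes>\<^sub>M N) = sets (borel \<Otimes>\<^sub>M borel)"
    using assms by (intro sets_pair_measure_cong) (auto simp: finite_borel_def)
  ultimately show ?thesis using measurable_cong_sets[OF _ refl] by blast
qed

lemma emeasure_conv:
  assumes M: "finite_borel M" and N: "finite_borel N" and A[measurable]: "A \<in> sets borel"
  shows "emeasure (conv M N) A = (\<integral>\<^sup>+x. emeasure N {y. x + y \<in> A} \<partial>M)"
    and "(\<lambda>x. emeasure N {y. x + y \<in> A}) \<in> borel_measurable M"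
proof -
  interpret N: finite_measure N by (rule finite_borelD[OF N])
  let ?S = "(\<lambda>(x, y). x + y) -` A \<inter> space (M \<Otimes>\<^sub>M N)"
  have S: "?S \<in> sets (M \<Otimes>\<^sub>M N)"
    by (rule measurable_sets[OF conv_map_measurable[OF M N] A])
  have P: "Pair x -` ?S = {y. x + y \<in> A}" for x
    by (auto simp: space_pair_measure finite_borelD(4)[OF M] finite_borelD(4)[OF N])
  have "emeasure (conv M N) A = emeasure (M \<Otimes>\<^sub>M N) ?S"
    unfolding conv_def by (rule emeasure_distr[OF conv_map_measurable[OF M N] A])
  also have "\<dots> = (\<integral>\<^sup>+x. emeasure N (Pair x -` ?S) \<partial>M)"
    by (rule N.emeasure_pair_measure_alt[OF S])
  finally show "emeasure (conv M N) A = (\<integral>\<^sup>+x. emeasure N {y. x + y \<in> A} \<partial>M)"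
    unfolding P .
  show "(\<lambda>x. emeasure N {y. x + y \<in> A}) \<in> borel_measurable M"
    using N.measurable_emeasure_Pair[OF S] unfolding P .
qed

lemma finite_borel_conv:
  assumes M: "finite_borel M" and N: "finite_borel N"
  shows "finite_borel (conv M N)"
proof -
  interpret M: finite_measure M by (rule finite_borelD[OF M])
  interpret N: finite_measure N by (rule finite_borelD[OF N])
  have "finite_measure (conv M N)"
  proof
    have "emeasure (conv M N) UNIV = (\<integral>\<^sup>+x. emeasure N UNIV \<partial>M)"
      by (simp add: emeasure_conv(1)[OF M N])
    also have "\<dots> \<noteq> \<infinity>"
      using finite_borelD(4)[OF M] M.emeasure_finite N.emeasure_finite
      by (simp add: ennreal_mult_eq_top_iff)
    finally show "emeasure (conv M N) (space (conv M N)) \<noteq> \<infinity>" by (simp add: conv_def)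
  qed
  then show ?thesis by (simp add: finite_borel_def conv_def)
qed

lemma null_sets_conv_iff:
  assumes M: "finite_borel M" and N: "finite_borel N" and A: "A \<in> sets borel"
  shows "A \<in> null_sets (conv M N) \<longleftrightarrow> (AE x in M. {y. x + y \<in> A} \<in> null_sets N)"
proof -
  have s: "{y. x + y \<in> A} \<in> sets N" for x
  proof -
    have "(\<lambda>y. x + y) -` A \<inter> space borel \<in> sets borel"
      by (rule measurable_sets[OF _ A]) simp
    then show ?thesis by (simp add: vimage_def finite_borelD(3)[OF N])
  qed
  have "A \<in> null_sets (conv M N) \<longleftrightarrow> emeasure (conv M N) A = 0"
    using A by (simp add: null_sets_def conv_def)
  also have "\<dots> \<longleftrightarrow> (AE x in M. emeasure N {y. x + y \<in> A} = 0)"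
    unfolding emeasure_conv(1)[OF M N A] by (rule nn_integral_0_iff_AE[OF emeasure_conv(2)[OF M N A]])
  finally show ?thesis using s by (simp add: null_sets_def)
qed

lemma nn_integral_conv:
  assumes M: "finite_borel M" and N: "finite_borel N" and f: "f \<in> borel_measurable borel"
  shows "(\<integral>\<^sup>+z. f z \<partial>conv M N) = (\<integral>\<^sup>+x. \<integral>\<^sup>+y. f (x + y) \<partial>N \<partial>M)"
proof -
  interpret N: finite_measure N by (rule finite_borelD[OF N])
  have m: "(\<lambda>z. f (case z of (x, y) \<Rightarrow> x + y)) \<in> borel_measurable (M \<Otimes>\<^sub>M N)"
    by (rule measurable_compose[OF conv_map_measurable[OF M N] f])
  have "(\<integral>\<^sup>+z. f z \<partial>conv M N) = (\<integral>\<^sup>+z. f (case z of (x, y) \<Rightarrow> x + y) \<partial>(M \<Otimes>\<^sub>M N))"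
    unfolding conv_def using f by (intro nn_integral_distr conv_map_measurable[OF M N]) simp
  also have "\<dots> = (\<integral>\<^sup>+x. \<integral>\<^sup>+y. f (x + y) \<partial>N \<partial>M)"
    using N.nn_integral_fst[OF m] by simp
  finally show ?thesis .
qed

text \<open>The exponent 0 gives the unit mass at 0, the neutral element of convolution.\<close>

primrec conv_power :: "'a::euclidean_space measure \<Rightarrow> nat \<Rightarrow> 'a measure" where
  "conv_power M 0 = distr (count_space {()}) borel (\<lambda>_. 0)"
| "conv_power M (Suc k) = conv M (conv_power M k)"

lemma finite_borel_conv_power: "finite_borel M \<Longrightarrow> finite_borel (conv_power M k)"
proof (induction k)
  case 0
  have "finite_measure (distr (count_space {()}) borel (\<lambda>_. 0 :: 'a))"
    by (intro finite_measure.finite_measure_distr finite_measure_count_space) auto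
  then show ?case by (simp add: finite_borel_def)
qed (simp add: finite_borel_conv)

text \<open>Peels off one factor at a time; \<open>w\<close> is the sum of the points already drawn.
  By \<open>charts\<close>, a property holds \<kappa>-almost everywhere once it holds for almost all
  parameters in each chart. A drawn point may lie in any chart, hence the quantifier over all
  assignments \<open>i\<close> of charts to factors.\<close>

lemma conv_power_null:
  fixes \<Phi> :: "'c \<Rightarrow> 'x::euclidean_space \<Rightarrow> 'z::euclidean_space" and bs :: "'b list"
  assumes \<kappa>: "finite_borel \<kappa>"
    and charts: "\<And>P. (\<And>c. c \<in> C \<Longrightarrow> AE x in lborel. x \<in> U c \<longrightarrow> P (\<Phi> c x)) \<Longrightarrow> AE z in \<kappa>. P z"
    and E: "E \<in> sets borel" and "distinct bs"
    and "nested_AE bs (\<lambda>x. \<forall>i\<in>PiE (set bs) (\<lambda>_. C). (\<forall>b\<in>set bs. x b \<in> U (i b)) \<longrightarrow>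
      w + (\<Sum>b\<in>set bs. \<Phi> (i b) (x b)) \<notin> E) x0"
  shows "{z. w + z \<in> E} \<in> null_sets (conv_power \<kappa> (length bs))"
  using assms(4,5)
proof (induction bs arbitrary: w x0)
  case Nil
  have "{z. w + z \<in> E} = (\<lambda>z. w + z) -` E \<inter> space borel" by auto
  also have "\<dots> \<in> sets borel" by (rule measurable_sets[OF _ E]) simp
  finally show ?case using Nil by (auto simp: null_sets_def emeasure_distr)
next
  case (Cons b bs)
  have bb: "b \<notin> set bs" "distinct bs" using Cons.prems by auto
  have Ew: "{z. w + z \<in> E} \<in> sets borel" for w
  proof -
    have "{z. w + z \<in> E} = (\<lambda>z. w + z) -` E \<inter> space borel" by auto
    also have "\<dots> \<in> sets borel" by (rule measurable_sets[OF _ E]) simp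
    finally show ?thesis .
  qed
  have "AE z in \<kappa>. {z'. (w + z) + z' \<in> E} \<in> null_sets (conv_power \<kappa> (length bs))"
  proof (rule charts)
    fix c assume c: "c \<in> C"
    have "AE y in lborel. nested_AE bs (\<lambda>x. \<forall>i\<in>PiE (set (b # bs)) (\<lambda>_. C). (\<forall>b\<in>set (b # bs). x b \<in> U (i b)) \<longrightarrow>
      w + (\<Sum>b\<in>set (b # bs). \<Phi> (i b) (x b)) \<notin> E) (x0(b := y))"
      using Cons.prems(2) by (simp only: nested_AE.simps)
    then show "AE y in lborel. y \<in> U c \<longrightarrow> {z'. (w + \<Phi> c y) + z' \<in> E} \<in> null_sets (conv_power \<kappa> (length bs))"
    proof eventually_elim
      fix y assume y: "nested_AE bs (\<lambda>x. \<forall>i\<in>PiE (set (b # bs)) (\<lambda>_. C). (\<forall>b\<in>set (b # bs). x b \<in> U (i b)) \<longrightarrow>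
        w + (\<Sum>b\<in>set (b # bs). \<Phi> (i b) (x b)) \<notin> E) (x0(b := y))"
      show "y \<in> U c \<longrightarrow> {z'. (w + \<Phi> c y) + z' \<in> E} \<in> null_sets (conv_power \<kappa> (length bs))"
      proof
        assume yU: "y \<in> U c"
        from nested_AE_conj[OF y nested_AE_fixed[OF bb(1)]]
        have "nested_AE bs (\<lambda>x. \<forall>i\<in>PiE (set bs) (\<lambda>_. C). (\<forall>b\<in>set bs. x b \<in> U (i b)) \<longrightarrow>
          (w + \<Phi> c y) + (\<Sum>b\<in>set bs. \<Phi> (i b) (x b)) \<notin> E) (x0(b := y))"
        proof (rule nested_AE_mono, intro ballI impI)
          fix x i assume x: "(\<forall>i\<in>PiE (set (b # bs)) (\<lambda>_. C). (\<forall>b\<in>set (b # bs). x b \<in> U (i b)) \<longrightarrow>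
              w + (\<Sum>b\<in>set (b # bs). \<Phi> (i b) (x b)) \<notin> E) \<and> x b = (x0(b := y)) b"
            and i: "i \<in> PiE (set bs) (\<lambda>_. C)" "\<forall>b\<in>set bs. x b \<in> U (i b)"
          define i' where "i' = i(b := c)"
          have i': "i' \<in> PiE (set (b # bs)) (\<lambda>_. C)"
            using i(1) c by (auto simp: i'_def PiE_iff extensional_def)
          have "\<forall>b\<in>set (b # bs). x b \<in> U (i' b)" using i(2) x yU bb by (auto simp: i'_def)
          with x i' have "w + (\<Sum>b\<in>set (b # bs). \<Phi> (i' b) (x b)) \<notin> E" by blast
          moreover have "(\<Sum>d\<in>set bs. \<Phi> (i' d) (x d)) = (\<Sum>d\<in>set bs. \<Phi> (i d) (x d))"
            using bb by (intro sum.cong refl) (auto simp: i'_def)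
          ultimately show "(w + \<Phi> c y) + (\<Sum>b\<in>set bs. \<Phi> (i b) (x b)) \<notin> E"
            using bb x by (simp add: i'_def add.assoc)
        qed
        then show "{z'. (w + \<Phi> c y) + z' \<in> E} \<in> null_sets (conv_power \<kappa> (length bs))"
          by (rule Cons.IH[OF bb(2)])
      qed
    qed
  qed
  then show ?case
    using null_sets_conv_iff[OF \<kappa> finite_borel_conv_power[OF \<kappa>] Ew] by (simp add: add.assoc)
qed

text \<open>The sum of \<open>DIM('z)\<close> independent random points of the charts has a density: the tangent spaces
  almost surely span \<open>'z\<close>, so one direction can be chosen in each chart such that the sum map is
  a local diffeomorphism along the corresponding translates.\<close>

lemma conv_power_absolutely_continuous:
  fixes \<Phi> :: "'c \<Rightarrow> 'x::euclidean_space \<Rightarrow> 'z::euclidean_space"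
  assumes \<kappa>: "finite_borel \<kappa>" and C: "finite C"
    and charts: "\<And>P. (\<And>c. c \<in> C \<Longrightarrow> AE x in lborel. x \<in> U c \<longrightarrow> P (\<Phi> c x)) \<Longrightarrow> AE z in \<kappa>. P z"
    and U: "\<And>c. c \<in> C \<Longrightarrow> open (U c)"
    and der: "\<And>c x. c \<in> C \<Longrightarrow> x \<in> U c \<Longrightarrow> (\<Phi> c has_derivative \<Phi>' c x) (at x)"
    and cont: "\<And>c v. c \<in> C \<Longrightarrow> continuous_on (U c) (\<lambda>x. \<Phi>' c x v)"
    and nondeg: "\<And>c a. c \<in> C \<Longrightarrow> a \<noteq> 0 \<Longrightarrow> AE x in lborel. x \<in> U c \<longrightarrow> (\<exists>v. a \<bullet> \<Phi>' c x v \<noteq> 0)"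
  shows "absolutely_continuous lborel (conv_power \<kappa> (DIM('z)))"
  unfolding absolutely_continuous_def
proof
  fix E :: "'z set" assume E: "E \<in> null_sets lborel"
  obtain bs where bs: "set bs = (Basis :: 'z set)" "distinct bs"
    using finite_distinct_list[OF finite_Basis] by blast
  have len: "length bs = DIM('z)" using distinct_card[OF bs(2)] bs(1) by simp
  let ?I = "PiE (set bs) (\<lambda>_. C)"
  let ?V = "PiE (Basis :: 'z set) (\<lambda>_. Basis :: 'x set)"
  have "nested_AE bs (\<lambda>x. (\<forall>b\<in>set bs. x b \<in> U (i b)) \<longrightarrow> 0 + (\<Sum>b\<in>set bs. \<Phi> (i b) (x b)) \<notin> E) (\<lambda>_. undefined)"
    if i: "i \<in> ?I" for i
  proof -
    have iC: "i b \<in> C" if "b \<in> Basis" for b using i that bs(1) by auto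
    have 1: "nested_AE bs (\<lambda>x. (\<forall>b\<in>set bs. x b \<in> U (i b)) \<longrightarrow> (\<exists>v. (\<forall>b\<in>set bs. v b \<in> Basis) \<and>
      inj_on (\<lambda>b. \<Phi>' (i b) (x b) (v b)) (set bs) \<and> {} \<inter> (\<lambda>b. \<Phi>' (i b) (x b) (v b)) ` set bs = {} \<and>
      independent ({} \<union> (\<lambda>b. \<Phi>' (i b) (x b) (v b)) ` set bs))) (\<lambda>_. undefined)"
    proof (rule nested_AE_independent)
      show "linear (\<Phi>' (i b) y)" if "b \<in> set bs" "y \<in> U (i b)" for b y
        using has_derivative_linear[OF der] iC that bs by auto
      show "AE y in lborel. y \<in> U (i b) \<longrightarrow> (\<exists>v. a \<bullet> \<Phi>' (i b) y v \<noteq> 0)" if "b \<in> set bs" "a \<noteq> 0" for b a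
        using nondeg iC that bs by auto
    qed (use bs len in \<open>auto simp: independent_empty\<close>)
    \<comment> \<open>The directions produced by \<open>1\<close> depend on the points drawn,
      whereas \<open>regular_fibre_null\<close> is about fixed directions. As they range over the
      finite set \<open>?V\<close>, the null sets belonging to all of them are discarded
      together.\<close>
    have 2: "nested_AE bs (\<lambda>x. \<forall>v\<in>?V. \<not> ((\<forall>b\<in>Basis. x b \<in> U (i b)) \<and>
      inj (\<lambda>s. \<Sum>b\<in>Basis. (s \<bullet> b) *\<^sub>R \<Phi>' (i b) (x b) (v b)) \<and> (\<Sum>b\<in>Basis. \<Phi> (i b) (x b)) \<in> E)) (\<lambda>_. undefined)"
    proof (rule nested_AE_ball_countable)
      show "countable ?V" by (intro countable_finite finite_PiE) auto
      fix v assume "v \<in> ?V"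
      show "nested_AE bs (\<lambda>x. \<not> ((\<forall>b\<in>Basis. x b \<in> U (i b)) \<and>
        inj (\<lambda>s. \<Sum>b\<in>Basis. (s \<bullet> b) *\<^sub>R \<Phi>' (i b) (x b) (v b)) \<and> (\<Sum>b\<in>Basis. \<Phi> (i b) (x b)) \<in> E)) (\<lambda>_. undefined)"
      proof (rule nested_AE_PiM[OF bs(2)], unfold bs(1) not_not)
        show "{x \<in> space (PiM Basis (\<lambda>_. lborel)). (\<forall>b\<in>Basis. x b \<in> U (i b)) \<and>
          inj (\<lambda>s. \<Sum>b\<in>Basis. (s \<bullet> b) *\<^sub>R \<Phi>' (i b) (x b) (v b)) \<and> (\<Sum>b\<in>Basis. \<Phi> (i b) (x b)) \<in> E}
          \<in> null_sets (PiM Basis (\<lambda>_. lborel))"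
          by (rule regular_fibre_null[where U = "\<lambda>b. U (i b)" and \<Phi> = "\<lambda>b. \<Phi> (i b)" and \<Phi>' = "\<lambda>b. \<Phi>' (i b)"])
            (use U der cont iC E in auto)
      qed
    qed
    from nested_AE_conj[OF 1 2] show ?thesis
    proof (rule nested_AE_mono, intro impI)
      fix x assume x: "((\<forall>b\<in>set bs. x b \<in> U (i b)) \<longrightarrow> (\<exists>v. (\<forall>b\<in>set bs. v b \<in> Basis) \<and>
          inj_on (\<lambda>b. \<Phi>' (i b) (x b) (v b)) (set bs) \<and> {} \<inter> (\<lambda>b. \<Phi>' (i b) (x b) (v b)) ` set bs = {} \<and>
          independent ({} \<union> (\<lambda>b. \<Phi>' (i b) (x b) (v b)) ` set bs))) \<and>
        (\<forall>v\<in>?V. \<not> ((\<forall>b\<in>Basis. x b \<in> U (i b)) \<and>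
          inj (\<lambda>s. \<Sum>b\<in>Basis. (s \<bullet> b) *\<^sub>R \<Phi>' (i b) (x b) (v b)) \<and> (\<Sum>b\<in>Basis. \<Phi> (i b) (x b)) \<in> E))"
        and xU: "\<forall>b\<in>set bs. x b \<in> U (i b)"
      then obtain v where v: "\<forall>b\<in>Basis. v b \<in> (Basis :: 'x set)"
        "inj_on (\<lambda>b. \<Phi>' (i b) (x b) (v b)) Basis" "independent ((\<lambda>b. \<Phi>' (i b) (x b) (v b)) ` Basis)"
        unfolding bs(1) by auto
      define L where "L s = (\<Sum>b\<in>Basis. (s \<bullet> b) *\<^sub>R \<Phi>' (i b) (x b) (v b))" for s :: 'z
      have lL: "linear L"
        unfolding L_def by (intro linear_compose_sum ballI linearI) (auto simp: inner_simps scaleR_left_distrib)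
      have "s = 0" if "L s = 0" for s
      proof -
        define F where "F = (\<lambda>b. \<Phi>' (i b) (x b) (v b))"
        have inj: "inj_on F Basis" and ind: "independent (F ` Basis)" using v by (simp_all add: F_def)
        \<comment> \<open>Transports the coordinates of \<open>s\<close> to the image vectors, so
          that \<open>L s\<close> becomes a linear combination of an independent family.\<close>
        define u where "u w = s \<bullet> the_inv_into Basis F w" for w
        have u: "u (F b) = s \<bullet> b" if "b \<in> Basis" for b
          using the_inv_into_f_f[OF inj that] by (simp add: u_def)
        have "(\<Sum>w\<in>F ` Basis. u w *\<^sub>R w) = L s"
          unfolding L_def by (subst sum.reindex[OF inj]) (auto simp: u F_def[symmetric] intro!: sum.cong, simp add: F_def)
        then have 0: "(\<Sum>w\<in>F ` Basis. u w *\<^sub>R w) = 0" using that by simp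
        have "s \<bullet> b = 0" if b: "b \<in> Basis" for b
          using independentD[OF ind _ subset_refl 0 imageI[OF b]] u[OF b] by simp
        then show "s = 0" by (simp add: euclidean_eq_iff[of s 0])
      qed
      then have "inj L" using linear_injective_0[OF lL] by blast
      have v': "restrict v Basis \<in> ?V" using v(1) by auto
      have "inj (\<lambda>s. \<Sum>b\<in>Basis. (s \<bullet> b) *\<^sub>R \<Phi>' (i b) (x b) (restrict v Basis b))"
        using \<open>inj L\<close> by (simp add: L_def[abs_def])
      moreover have "\<forall>b\<in>Basis. x b \<in> U (i b)" using xU bs(1) by simp
      ultimately have "(\<Sum>b\<in>Basis. \<Phi> (i b) (x b)) \<notin> E"
        using bspec[OF conjunct2[OF x] v'] by blast
      then show "0 + (\<Sum>b\<in>set bs. \<Phi> (i b) (x b)) \<notin> E" by (simp add: bs(1))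
    qed
  qed
  then have "nested_AE bs (\<lambda>x. \<forall>i\<in>?I. (\<forall>b\<in>set bs. x b \<in> U (i b)) \<longrightarrow>
      0 + (\<Sum>b\<in>set bs. \<Phi> (i b) (x b)) \<notin> E) (\<lambda>_. undefined)"
    by (intro nested_AE_ball_countable countable_finite finite_PiE) (use C in auto)
  then have "{z. 0 + z \<in> E} \<in> null_sets (conv_power \<kappa> (length bs))"
    using E by (intro conv_power_null[where C = C and U = U and \<Phi> = \<Phi>, OF \<kappa> _ _ bs(2)] charts) auto
  then show "E \<in> null_sets (conv_power \<kappa> (DIM('z)))" by (simp add: len)
qed

section \<open>Algebra of convolution, and null sets up to translation\<close>

lemma borel_translate: "E \<in> sets borel \<Longrightarrow> {z. w + z \<in> E} \<in> sets borel" for w :: "'a::euclidean_space"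
  using measurable_sets[of "\<lambda>z. w + z" borel borel E] by (simp add: vimage_def)

lemma sets_conv [simp]: "sets (conv M N) = sets borel"
  by (simp add: conv_def)

lemma conv_commute:
  assumes M: "finite_borel M" and N: "finite_borel N"
  shows "conv M N = conv N M"
proof (rule measure_eqI)
  fix A assume "A \<in> sets (conv M N)"
  then have A: "A \<in> sets borel" by simp
  interpret P: pair_sigma_finite M N
    using finite_borelD(2)[OF M] finite_borelD(2)[OF N] by (simp add: pair_sigma_finite_def)
  have m: "(\<lambda>(x, y). indicator A (x + y) :: ennreal) \<in> borel_measurable (M \<Otimes>\<^sub>M N)"
    using measurable_compose[OF conv_map_measurable[OF M N], of "indicator A :: 'a \<Rightarrow> ennreal" borel] A
    by (simp add: split_beta')
  have "emeasure (conv M N) A = (\<integral>\<^sup>+z. indicator A z \<partial>conv M N)" using A by simp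
  also have "\<dots> = (\<integral>\<^sup>+x. \<integral>\<^sup>+y. indicator A (x + y) \<partial>N \<partial>M)"
    using A by (intro nn_integral_conv M N) simp
  also have "\<dots> = (\<integral>\<^sup>+y. \<integral>\<^sup>+x. indicator A (x + y) \<partial>M \<partial>N)"
    by (rule P.Fubini'[OF m, symmetric])
  also have "\<dots> = (\<integral>\<^sup>+z. indicator A z \<partial>conv N M)"
    using A by (subst nn_integral_conv[OF N M]) (simp_all add: add.commute)
  finally show "emeasure (conv M N) A = emeasure (conv N M) A" using A by simp
qed simp

lemma conv_assoc:
  assumes "finite_borel K" "finite_borel M" "finite_borel N"
  shows "conv (conv K M) N = conv K (conv M N)"
proof (rule measure_eqI)
  fix A assume "A \<in> sets (conv (conv K M) N)"
  then have A: "A \<in> sets borel" by simp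
  note fb = assms finite_borel_conv
  have "emeasure (conv (conv K M) N) A = (\<integral>\<^sup>+z. emeasure N {y. z + y \<in> A} \<partial>conv K M)"
    using fb A by (intro emeasure_conv) auto
  also have "\<dots> = (\<integral>\<^sup>+x. \<integral>\<^sup>+y. emeasure N {z. (x + y) + z \<in> A} \<partial>M \<partial>K)"
    using fb emeasure_conv(2)[OF finite_borel_conv[OF assms(1,2)] assms(3) A]
    by (intro nn_integral_conv) (auto simp: measurable_cong_sets[OF sets_conv refl])
  also have "\<dots> = (\<integral>\<^sup>+x. emeasure (conv M N) {z. x + z \<in> A} \<partial>K)"
    using fb A by (intro nn_integral_cong) (simp add: emeasure_conv(1) borel_translate add.assoc)
  also have "\<dots> = emeasure (conv K (conv M N)) A"
    using fb A by (intro emeasure_conv(1)[symmetric]) auto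
  finally show "emeasure (conv (conv K M) N) A = emeasure (conv K (conv M N)) A" .
qed simp

lemma conv_power_add:
  assumes M: "finite_borel M"
  shows "conv (conv_power M k) (conv_power M l) = conv_power M (k + l)"
proof (induction k)
  case 0
  let ?N = "conv_power M l"
  show ?case
  proof (rule measure_eqI)
    show "sets (conv (conv_power M 0) ?N) = sets (conv_power M (0 + l))"
      using finite_borelD(3)[OF finite_borel_conv_power[OF M]] by simp
    fix A assume "A \<in> sets (conv (conv_power M 0) ?N)"
    then have A: "A \<in> sets borel" by simp
    have fb: "finite_borel (conv_power M k)" for k by (rule finite_borel_conv_power[OF M])
    have m: "(\<lambda>x. emeasure ?N {y. x + y \<in> A}) \<in> borel_measurable borel"
      using emeasure_conv(2)[OF fb[of 0] fb[of l] A] by simp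
    have "emeasure (conv (conv_power M 0) ?N) A = (\<integral>\<^sup>+x. emeasure ?N {y. x + y \<in> A} \<partial>conv_power M 0)"
      by (rule emeasure_conv(1)[OF fb fb A])
    also have "\<dots> = emeasure ?N A"
      using m by (simp add: nn_integral_distr nn_integral_count_space_finite)
    finally show "emeasure (conv (conv_power M 0) ?N) A = emeasure (conv_power M (0 + l)) A" by simp
  qed
qed (simp add: conv_assoc M finite_borel_conv_power flip: conv_power.simps(2) del: conv_power.simps(1),
    simp add: conv_assoc M finite_borel_conv_power)

text \<open>Modelled on \<open>conv N R\<close> against \<open>R\<close>, where the point drawn from
  the left factor acts as a translation. For a Lebesgue null set the quantifier over
  \<open>w\<close> is harmless, since all its translates are null too; so absolute continuity of
  \<open>R\<close> passes to the dominated measure.\<close>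

definition translate_dominated :: "'a::euclidean_space measure \<Rightarrow> 'a measure \<Rightarrow> bool"
  where "translate_dominated N R \<longleftrightarrow>
    (\<forall>E\<in>sets borel. (\<forall>w. {z. w + z \<in> E} \<in> null_sets R) \<longrightarrow> E \<in> null_sets N)"

lemma translate_dominated_conv_left:
  assumes "finite_borel N" "finite_borel R"
  shows "translate_dominated (conv N R) R"
  unfolding translate_dominated_def using null_sets_conv_iff[OF assms] by auto

text \<open>The factors are replaced one at a time, from \<open>conv R1 R2\<close> to
  \<open>conv N2 R1\<close> and then to \<open>conv N1 N2\<close>. Domination is applied to the set
  of left points that see too much of \<open>E\<close>, so it acts on the left factor; commutativity
  brings each factor there in turn.\<close>

lemma translate_dominated_conv:
  assumes fb: "finite_borel N1" "finite_borel N2" "finite_borel R1" "finite_borel R2"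
    and 1: "translate_dominated N1 R1" and 2: "translate_dominated N2 R2"
  shows "translate_dominated (conv N1 N2) (conv R1 R2)"
  unfolding translate_dominated_def
proof (intro ballI impI)
  fix E assume E: "E \<in> sets borel" and null: "\<forall>w. {z. w + z \<in> E} \<in> null_sets (conv R1 R2)"
  \<comment> \<open>A set is null for a convolution iff its \<open>bad\<close> set for the right
    factor is null for the left factor. Translating the set translates its \<open>bad\<close> set,
    so the hypothesis on all translates is inherited.\<close>
  define bad where "bad M F = {u. {z. u + z \<in> F} \<notin> null_sets M}" for M :: "'a measure" and F
  have bad: "bad M F \<in> sets borel" "{z. w + z \<in> bad M F} = {u. {z. u + z \<in> {z. w + z \<in> F}} \<notin> null_sets M}"
    if M: "finite_borel M" and F: "F \<in> sets borel" for M F w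
  proof -
    have "emeasure M {z. u + z \<in> F} \<noteq> 0 \<longleftrightarrow> u \<in> bad M F" for u
      using borel_translate[OF F, of u] finite_borelD(3)[OF M] by (auto simp: bad_def null_sets_def)
    then have "bad M F = (\<lambda>u. emeasure M {z. u + z \<in> F}) -` (- {0}) \<inter> space M"
      using finite_borelD(4)[OF M] by auto
    also have "\<dots> \<in> sets M"
      using emeasure_conv(2)[OF M M F] by (rule measurable_sets) auto
    finally show "bad M F \<in> sets borel" using finite_borelD(3)[OF M] by simp
    show "{z. w + z \<in> bad M F} = {u. {z. u + z \<in> {z. w + z \<in> F}} \<notin> null_sets M}"
      by (simp add: bad_def add.assoc)
  qed
  have null_iff: "F \<in> null_sets (conv M N) \<longleftrightarrow> bad N F \<in> null_sets M"
    if M: "finite_borel M" and N: "finite_borel N" and F: "F \<in> sets borel" for M N F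
  proof -
    have "(AE u in M. {z. u + z \<in> F} \<in> null_sets N) \<longleftrightarrow> bad N F \<in> null_sets M"
      using AE_iff_null_sets[of "bad N F" M] bad(1)[OF N F] finite_borelD(3)[OF M]
      by (simp add: bad_def)
    then show ?thesis using null_sets_conv_iff[OF M N F] by simp
  qed
  have N2R1: "{z. w + z \<in> E} \<in> null_sets (conv N2 R1)" for w
  proof -
    let ?E = "{z. w + z \<in> E}"
    have Ew: "?E \<in> sets borel" by (rule borel_translate[OF E])
    have "{z. v + z \<in> bad R1 ?E} \<in> null_sets R2" for v
    proof -
      have "{z. v + z \<in> ?E} \<in> null_sets (conv R2 R1)"
        using null conv_commute[OF fb(3,4)] by (metis (no_types, lifting) Collect_cong add.assoc mem_Collect_eq)
      then have "bad R1 {z. v + z \<in> ?E} \<in> null_sets R2"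
        using null_iff[OF fb(4,3) borel_translate[OF Ew]] by blast
      then show ?thesis by (simp add: bad_def add.assoc)
    qed
    then have "bad R1 ?E \<in> null_sets N2"
      using 2 bad(1)[OF fb(3) Ew] unfolding translate_dominated_def by blast
    then show ?thesis using null_iff[OF fb(2,3) Ew] by blast
  qed
  have "{z. w + z \<in> bad N2 E} \<in> null_sets R1" for w
  proof -
    have "{z. w + z \<in> E} \<in> null_sets (conv R1 N2)"
      using N2R1 conv_commute[OF fb(3,2)] by simp
    then have "bad N2 {z. w + z \<in> E} \<in> null_sets R1"
      using null_iff[OF fb(3,2) borel_translate[OF E]] by blast
    then show ?thesis by (simp add: bad_def add.assoc)
  qed
  then have "bad N2 E \<in> null_sets N1"
    using 1 bad(1)[OF fb(2) E] unfolding translate_dominated_def by blast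
  then show "E \<in> null_sets (conv N1 N2)" using null_iff[OF fb(1,2) E] by blast
qed

section \<open>Completeness of \<open>L\<^sup>2\<close>\<close>

text \<open>The squared norm takes values in \<open>ennreal\<close>, so that bounds can be stated
  before square integrability is known, and then imply it.\<close>

definition sqnorm :: "('a::euclidean_space \<Rightarrow> complex) \<Rightarrow> ennreal"
  where "sqnorm f = (\<integral>\<^sup>+t. ennreal ((cmod (f t))\<^sup>2) \<partial>lborel)"

lemma square_integrable_iff_sqnorm: "square_integrable f \<longleftrightarrow> f \<in> borel_measurable borel \<and> sqnorm f < \<infinity>"
  unfolding square_integrable_def sqnorm_def by (auto simp: integrable_iff_bounded)

lemma square_integrableD: "square_integrable f \<Longrightarrow> f \<in> borel_measurable borel"
  by (simp add: square_integrable_def)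

lemma sqnorm_cong_AE: "AE t in lborel. f t = g t \<Longrightarrow> sqnorm f = sqnorm g"
  unfolding sqnorm_def by (rule nn_integral_cong_AE) auto

lemma sqnorm_add_le:
  assumes [measurable]: "f \<in> borel_measurable borel" "g \<in> borel_measurable borel"
  shows "sqnorm (\<lambda>t. f t + g t) \<le> 2 * sqnorm f + 2 * sqnorm g"
proof -
  have b: "(cmod (a + c))\<^sup>2 \<le> 2 * (cmod a)\<^sup>2 + 2 * (cmod c)\<^sup>2" for a c :: complex
  proof -
    have "(cmod (a + c))\<^sup>2 \<le> (cmod a + cmod c)\<^sup>2"
      by (intro power_mono norm_triangle_ineq) auto
    also have "\<dots> \<le> 2 * (cmod a)\<^sup>2 + 2 * (cmod c)\<^sup>2"
      using sum_squares_bound[of "cmod a" "cmod c"] by (simp add: power2_sum)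
    finally show ?thesis .
  qed
  have "sqnorm (\<lambda>t. f t + g t) \<le> (\<integral>\<^sup>+t. 2 * ennreal ((cmod (f t))\<^sup>2) + 2 * ennreal ((cmod (g t))\<^sup>2) \<partial>lborel)"
    unfolding sqnorm_def
    using b by (intro nn_integral_mono) (simp add: ennreal_mult'[symmetric] ennreal_plus[symmetric] ennreal_leI
      flip: ennreal_numeral del: ennreal_plus)
  also have "\<dots> = 2 * sqnorm f + 2 * sqnorm g"
    unfolding sqnorm_def by (simp add: nn_integral_add nn_integral_cmult)
  finally show ?thesis .
qed

lemma sqnorm_mult: "f \<in> borel_measurable borel \<Longrightarrow> sqnorm (\<lambda>t. c * f t) = ennreal ((cmod c)\<^sup>2) * sqnorm f"
  unfolding sqnorm_def by (simp add: norm_mult power_mult_distrib ennreal_mult nn_integral_cmult)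

lemma sqnorm_zero_iff:
  assumes [measurable]: "f \<in> borel_measurable borel"
  shows "sqnorm f = 0 \<longleftrightarrow> (AE t in lborel. f t = 0)"
  unfolding sqnorm_def by (subst nn_integral_0_iff_AE) (auto simp: ennreal_eq_0_iff)

lemma L2_rel_rep: "L2_rel (rep_L2 F) (rep_L2 F)"
  by (rule Quotient3_rep_reflp[OF Quotient3_L2])

lemma square_integrable_rep: "square_integrable (rep_L2 F)"
  using L2_rel_rep by (auto simp: L2_rel_def)

lemma abs_rep_L2: "abs_L2 (rep_L2 F) = F"
  by (rule Quotient3_abs_rep[OF Quotient3_L2])

lemma rep_abs_L2:
  assumes "square_integrable f"
  shows "AE t in lborel. rep_L2 (abs_L2 f) t = f t"
proof -
  have "L2_rel f f" using assms by (simp add: L2_rel_def)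
  then have "L2_rel (rep_L2 (abs_L2 f)) f"
    by (rule rep_abs_rsp_left[OF Quotient3_L2])
  then show ?thesis by (simp add: L2_rel_def)
qed

lemma abs_L2_eq:
  assumes "square_integrable f" "square_integrable g" "AE t in lborel. f t = g t"
  shows "abs_L2 f = abs_L2 g"
  using assms by (intro Quotient3_rel_abs[OF Quotient3_L2]) (simp add: L2_rel_def)

lemma abs_L2_add:
  assumes "square_integrable f" "square_integrable g"
  shows "abs_L2 f + abs_L2 g = abs_L2 (\<lambda>t. f t + g t)"
  using assms by (intro plus_L2.abs_eq) (auto simp: L2_rel_def)

lemma abs_L2_scaleC:
  assumes "square_integrable f"
  shows "scaleC_L2 c (abs_L2 f) = abs_L2 (\<lambda>t. c * f t)"
  using assms by (intro scaleC_L2.abs_eq) (auto simp: L2_rel_def)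

lemma scaleR_L2_eq_scaleC: "r *\<^sub>R F = scaleC_L2 (complex_of_real r) F"
  by transfer (use square_integrable_mult in \<open>auto simp: L2_rel_def\<close>)

lemma abs_L2_diff:
  assumes f: "square_integrable f" and g: "square_integrable g"
  shows "abs_L2 f - abs_L2 g = abs_L2 (\<lambda>t. f t - g t)"
proof -
  have "abs_L2 f - abs_L2 g = abs_L2 f + (-1) *\<^sub>R abs_L2 g" by simp
  also have "\<dots> = abs_L2 f + abs_L2 (\<lambda>t. (-1) * g t)"
    unfolding scaleR_L2_eq_scaleC using g by (simp add: abs_L2_scaleC)
  also have "\<dots> = abs_L2 (\<lambda>t. f t + (-1) * g t)"
    by (intro abs_L2_add f square_integrable_mult g)
  finally show ?thesis by simp
qed

lemma inner_abs_L2: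
  assumes "square_integrable f" "square_integrable g"
  shows "abs_L2 f \<bullet> abs_L2 g = (LINT t|lborel. f t \<bullet> g t)"
  using assms by (intro inner_L2.abs_eq) (auto simp: L2_rel_def)

lemma norm_abs_L2:
  assumes f: "square_integrable f"
  shows "ennreal ((norm (abs_L2 f))\<^sup>2) = sqnorm f"
proof -
  have "(norm (abs_L2 f))\<^sup>2 = (LINT t|lborel. (cmod (f t))\<^sup>2)"
    unfolding power2_norm_eq_inner inner_abs_L2[OF f f] by (simp add: power2_norm_eq_inner)
  also have "ennreal \<dots> = sqnorm f"
    unfolding sqnorm_def using f
    by (intro nn_integral_eq_integral[symmetric]) (auto simp: square_integrable_def)
  finally show ?thesis .
qed

lemma norm_L2_rep: "ennreal ((norm F)\<^sup>2) = sqnorm (rep_L2 F)"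
  using norm_abs_L2[OF square_integrable_rep, of F] by (simp add: abs_rep_L2)

lemma sqnorm_rep_diff: "sqnorm (\<lambda>t. rep_L2 F t - rep_L2 G t) = ennreal ((norm (F - G))\<^sup>2)"
proof -
  have F: "square_integrable (rep_L2 F)" and G: "square_integrable (rep_L2 G)" by (rule square_integrable_rep)+
  have d: "square_integrable (\<lambda>t. rep_L2 F t - rep_L2 G t)"
    using square_integrable_add[OF F square_integrable_mult[OF G, of "-1"]] by simp
  show ?thesis
    using norm_abs_L2[OF d] abs_L2_diff[OF F G] by (simp add: abs_rep_L2)
qed

lemma L2_rapidly_Cauchy_converges:
  fixes F :: "nat \<Rightarrow> 'a::euclidean_space L2"
  assumes d: "\<And>k. norm (F (Suc k) - F k) \<le> (1/2) ^ k"
  shows "\<exists>G. F \<longlonglongrightarrow> G"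
proof -
  define f where "f k = rep_L2 (F k)" for k
  have fm[measurable]: "f k \<in> borel_measurable borel" for k
    using square_integrable_rep[of "F k"] by (simp add: f_def square_integrable_def)
  \<comment> \<open>Weighting the squared increments by \<open>2 ^ k\<close> keeps their integrals
    summable. Finiteness of the weighted sum at a point bounds the increments there by a multiple of
    \<open>sqrt (1/2) ^ k\<close>, hence the sequence converges at that point.\<close>
  define D where "D k t = (cmod (f (Suc k) t - f k t))\<^sup>2" for k t
  have Dm[measurable]: "D k \<in> borel_measurable borel" for k by (simp add: D_def[abs_def])
  have "(\<integral>\<^sup>+t. ennreal (2 ^ k * D k t) \<partial>lborel) \<le> ennreal ((1/2) ^ k)" for k
  proof -
    have "(\<integral>\<^sup>+t. ennreal (2 ^ k * D k t) \<partial>lborel) = ennreal (2 ^ k) * (\<integral>\<^sup>+t. ennreal (D k t) \<partial>lborel)"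
      by (simp add: ennreal_mult D_def nn_integral_cmult)
    also have "(\<integral>\<^sup>+t. ennreal (D k t) \<partial>lborel) = ennreal ((norm (F (Suc k) - F k))\<^sup>2)"
      using sqnorm_rep_diff[of "F (Suc k)" "F k"] by (simp add: sqnorm_def D_def f_def)
    also have "ennreal (2 ^ k) * \<dots> = ennreal (2 ^ k * (norm (F (Suc k) - F k))\<^sup>2)"
      by (simp add: ennreal_mult)
    also have "\<dots> \<le> ennreal (2 ^ k * ((1/2) ^ k)\<^sup>2)"
      by (intro ennreal_leI mult_left_mono power_mono d) auto
    also have "2 ^ k * ((1/2) ^ k)\<^sup>2 = ((1/2) ^ k :: real)"
      by (simp add: power2_eq_square power_divide)
    finally show ?thesis .
  qed
  then have "(\<Sum>k. \<integral>\<^sup>+t. ennreal (2 ^ k * D k t) \<partial>lborel) \<le> (\<Sum>k. ennreal ((1/2) ^ k))"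
    by (intro suminf_le) auto
  also have "\<dots> = ennreal (\<Sum>k. (1/2) ^ k)"
    by (intro suminf_ennreal2) (auto simp: summable_geometric)
  also have "\<dots> < \<infinity>" by simp
  finally have "(\<integral>\<^sup>+t. (\<Sum>k. ennreal (2 ^ k * D k t)) \<partial>lborel) \<noteq> \<infinity>"
    by (simp add: nn_integral_suminf)
  then have "AE t in lborel. (\<Sum>k. ennreal (2 ^ k * D k t)) \<noteq> \<infinity>"
    by (intro nn_integral_PInf_AE) auto
  then have AEc: "AE t in lborel. convergent (\<lambda>k. f k t)"
  proof eventually_elim
    fix t assume t: "(\<Sum>k. ennreal (2 ^ k * D k t)) \<noteq> \<infinity>"
    have "summable (\<lambda>k. 2 ^ k * D k t)"
      using t by (intro summable_suminf_not_top) (auto simp: D_def)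
    then have "(\<lambda>k. 2 ^ k * D k t) \<longlonglongrightarrow> 0" by (rule summable_LIMSEQ_zero)
    then have "Bseq (\<lambda>k. 2 ^ k * D k t)" by (intro convergent_imp_Bseq convergentI)
    then obtain K where K: "K > 0" "\<And>k. norm (2 ^ k * D k t) \<le> K" by (auto simp: Bseq_def)
    have bd: "norm (f (Suc k) t - f k t) \<le> sqrt K * sqrt (1/2) ^ k" for k
    proof -
      have "2 ^ k * D k t \<le> K" using K(2)[of k] by (simp add: D_def)
      then have "D k t \<le> K * (1/2) ^ k" by (simp add: power_divide field_simps)
      then have "sqrt (D k t) \<le> sqrt (K * (1/2) ^ k)" by (rule real_sqrt_le_mono)
      then show ?thesis by (simp add: D_def real_sqrt_mult real_sqrt_power)
    qed
    have "summable (\<lambda>k. sqrt K * sqrt (1/2) ^ k)"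
      by (intro summable_mult summable_geometric) simp
    then have "summable (\<lambda>k. f (Suc k) t - f k t)"
      using bd by (rule summable_comparison_test'[where N = 0])
    then have "convergent (\<lambda>n. \<Sum>k<n. f (Suc k) t - f k t)"
      by (simp add: summable_iff_convergent)
    then have "convergent (\<lambda>n. f n t - f 0 t)" by (simp add: sum_lessThan_telescope[of "\<lambda>k. f k t"])
    then have "convergent (\<lambda>n. (f n t - f 0 t) + f 0 t)" by (rule convergent_add) (rule convergent_const)
    then show "convergent (\<lambda>k. f k t)" by simp
  qed
  define g where "g t = lim (\<lambda>k. f k t)" for t
  have gm[measurable]: "g \<in> borel_measurable borel"
    unfolding g_def by (rule borel_measurable_lim_metric) simp
  have AEl: "AE t in lborel. (\<lambda>k. f k t) \<longlonglongrightarrow> g t"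
    using AEc by eventually_elim (simp add: g_def convergent_LIMSEQ_iff)
  have dist_le: "norm (F (k + j) - F k) \<le> 2 * (1/2) ^ k" for k j
  proof -
    have "norm (F (k + j) - F k) \<le> 2 * (1/2) ^ k - 2 * (1/2) ^ (k + j)"
    proof (induction j)
      case (Suc j)
      have "norm (F (k + Suc j) - F k) \<le> norm (F (Suc (k + j)) - F (k + j)) + norm (F (k + j) - F k)"
        using norm_triangle_ineq[of "F (Suc (k + j)) - F (k + j)" "F (k + j) - F k"] by simp
      also have "\<dots> \<le> (1/2) ^ (k + j) + (2 * (1/2) ^ k - 2 * (1/2) ^ (k + j))"
        by (intro add_mono d Suc)
      finally show ?case by simp
    qed simp
    also have "\<dots> \<le> 2 * (1/2) ^ k" by simp
    finally show ?thesis .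
  qed
  \<comment> \<open>Fatou in \<open>j\<close>: the distance from the limit to term \<open>k\<close>
    is at most the lower limit of the distances from later terms to it.\<close>
  have gd: "sqnorm (\<lambda>t. g t - f k t) \<le> ennreal ((2 * (1/2) ^ k)\<^sup>2)" for k
  proof -
    have "sqnorm (\<lambda>t. g t - f k t) = (\<integral>\<^sup>+t. liminf (\<lambda>j. ennreal ((cmod (f (k + j) t - f k t))\<^sup>2)) \<partial>lborel)"
      unfolding sqnorm_def
    proof (rule nn_integral_cong_AE, use AEl in eventually_elim)
      fix t assume "(\<lambda>k. f k t) \<longlonglongrightarrow> g t"
      then have "(\<lambda>j. f (k + j) t) \<longlonglongrightarrow> g t" using LIMSEQ_ignore_initial_segment[of "\<lambda>k. f k t" "g t" k] by (simp add: add.commute)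
      then have "(\<lambda>j. ennreal ((cmod (f (k + j) t - f k t))\<^sup>2)) \<longlonglongrightarrow> ennreal ((cmod (g t - f k t))\<^sup>2)"
        by (intro tendsto_ennrealI tendsto_intros)
      then show "ennreal ((cmod (g t - f k t))\<^sup>2) = liminf (\<lambda>j. ennreal ((cmod (f (k + j) t - f k t))\<^sup>2))"
        by (intro lim_imp_Liminf[symmetric]) simp
    qed
    also have "\<dots> \<le> liminf (\<lambda>j. \<integral>\<^sup>+t. ennreal ((cmod (f (k + j) t - f k t))\<^sup>2) \<partial>lborel)"
      by (rule nn_integral_liminf) simp
    also have "\<dots> \<le> liminf (\<lambda>j. ennreal ((2 * (1/2) ^ k)\<^sup>2))"
    proof (intro Liminf_mono always_eventually allI)
      fix j
      have "(\<integral>\<^sup>+t. ennreal ((cmod (f (k + j) t - f k t))\<^sup>2) \<partial>lborel) = ennreal ((norm (F (k + j) - F k))\<^sup>2)"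
        using sqnorm_rep_diff[of "F (k + j)" "F k"] by (simp add: sqnorm_def f_def)
      also have "\<dots> \<le> ennreal ((2 * (1/2) ^ k)\<^sup>2)"
        by (intro ennreal_leI power_mono dist_le) auto
      finally show "(\<integral>\<^sup>+t. ennreal ((cmod (f (k + j) t - f k t))\<^sup>2) \<partial>lborel) \<le> ennreal ((2 * (1/2) ^ k)\<^sup>2)" .
    qed
    also have "\<dots> = ennreal ((2 * (1/2) ^ k)\<^sup>2)" by (simp add: Liminf_const)
    finally show ?thesis .
  qed
  have fs: "square_integrable (f k)" for k unfolding f_def by (rule square_integrable_rep)
  have gfs: "square_integrable (\<lambda>t. g t - f k t)" for k
    unfolding square_integrable_iff_sqnorm using le_less_trans[OF gd[of k] ennreal_less_top] by simp
  have gs: "square_integrable g"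
    using square_integrable_add[OF gfs[of 0] fs[of 0]] by simp
  have "norm (abs_L2 g - F k) \<le> 2 * (1/2) ^ k" for k
  proof -
    have "abs_L2 g - F k = abs_L2 (\<lambda>t. g t - f k t)"
      using abs_L2_diff[OF gs fs] by (simp add: f_def abs_rep_L2)
    then have "ennreal ((norm (abs_L2 g - F k))\<^sup>2) \<le> ennreal ((2 * (1/2) ^ k)\<^sup>2)"
      using gd[of k] norm_abs_L2[OF gfs[of k]] by simp
    then have "(norm (abs_L2 g - F k))\<^sup>2 \<le> (2 * (1/2) ^ k)\<^sup>2" by (subst (asm) ennreal_le_iff) auto
    then show ?thesis by (rule power2_le_imp_le) simp
  qed
  moreover have "(\<lambda>k. 2 * (1/2) ^ k :: real) \<longlonglongrightarrow> 2 * 0"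
    by (rule tendsto_mult[OF tendsto_const LIMSEQ_power_zero]) simp
  ultimately have "(\<lambda>k. abs_L2 g - F k) \<longlonglongrightarrow> 0"
    by (auto intro: Lim_null_comparison[where g = "\<lambda>k. 2 * (1/2) ^ k", OF always_eventually])
  then have "(\<lambda>k. abs_L2 g - (abs_L2 g - F k)) \<longlonglongrightarrow> abs_L2 g - 0" by (intro tendsto_diff tendsto_const)
  then show ?thesis by auto
qed

instance L2 :: (euclidean_space) complete_space
proof
  fix X :: "nat \<Rightarrow> 'a L2" assume X: "Cauchy X"
  have "\<exists>m. \<forall>i\<ge>m. \<forall>j\<ge>m. norm (X i - X j) < (1/2) ^ k" for k
    using metric_CauchyD[OF X, of "(1/2) ^ k"] by (auto simp: dist_norm)
  then obtain m where m: "\<And>k i j. i \<ge> m k \<Longrightarrow> j \<ge> m k \<Longrightarrow> norm (X i - X j) < (1/2) ^ k"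
    by metis
  \<comment> \<open>The summand \<open>k\<close> makes the indices strictly increasing, and the sum
    lifts them above \<open>m k\<close>.\<close>
  define s where "s k = k + (\<Sum>i\<le>k. m i)" for k
  have s: "strict_mono s" by (intro strict_monoI_Suc) (simp add: s_def)
  have sm: "m k \<le> s k" for k
    using member_le_sum[of k "{..k}" m] by (simp add: s_def trans_le_add2)
  have "norm (X (s (Suc k)) - X (s k)) \<le> (1/2) ^ k" for k
    using m[of k "s (Suc k)" "s k"] sm[of k] strict_mono_less_eq[OF s, of k "Suc k"] by simp
  then obtain G where "(\<lambda>k. X (s k)) \<longlonglongrightarrow> G"
    using L2_rapidly_Cauchy_converges[of "\<lambda>k. X (s k)"] by auto
  then show "convergent X"
    using Cauchy_converges_subseq[OF X s] convergentI by (auto simp: o_def)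
qed

instance L2 :: (euclidean_space) banach ..

section \<open>Weyl operators of finite measures\<close>

lemma borel_measurable_fst_snd [measurable]:
  "(fst :: 'a::euclidean_space \<times> 'b::euclidean_space \<Rightarrow> 'a) \<in> borel_measurable borel"
  "(snd :: 'a \<times> 'b \<Rightarrow> 'b) \<in> borel_measurable borel"
  by (intro borel_measurable_continuous_onI continuous_intros)+

lemma borel_measurable_cnj [measurable (raw)]:
  "f \<in> borel_measurable M \<Longrightarrow> (\<lambda>x. cnj (f x)) \<in> borel_measurable M"
  by (rule measurable_compose[OF _ borel_measurable_continuous_onI[OF continuous_on_cnj[OF continuous_on_id]]])

lemma lborel_translate_nn_integral:
  fixes a :: "'a::euclidean_space"
  assumes "f \<in> borel_measurable borel"
  shows "(\<integral>\<^sup>+t. f (t + a) \<partial>lborel) = (\<integral>\<^sup>+t. f t \<partial>lborel)"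
  using nn_integral_distr[of "(+) a" lborel borel f] assms by (simp add: lborel_distr_plus add.commute)

lemma lborel_translate_integral:
  fixes a :: "'a::euclidean_space" and f :: "'a \<Rightarrow> 'b::{banach, second_countable_topology}"
  assumes "f \<in> borel_measurable borel"
  shows "(LINT t|lborel. f (t + a)) = (LINT t|lborel. f t)"
  using integral_distr[of "(+) a" lborel borel f] assms by (simp add: lborel_distr_plus add.commute)

text \<open>Integrability is not at stake, because the Bochner integral of a nonintegrable function
  is 0.\<close>

lemma norm_integral_le_nn_integral:
  fixes g :: "'b \<Rightarrow> complex"
  shows "ennreal (cmod (LINT z|\<nu>. g z)) \<le> (\<integral>\<^sup>+z. ennreal (cmod (g z)) \<partial>\<nu>)"
  by (cases "integrable \<nu> g") (simp_all add: integral_norm_bound_ennreal not_integrable_integral_eq)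

section \<open>Averages of translates in the square norm\<close>

context
  fixes \<Theta> :: "'w measure" and X :: "'w \<Rightarrow> 'a::euclidean_space"
  assumes \<Theta>: "finite_measure \<Theta>" and X[measurable]: "X \<in> borel_measurable \<Theta>"
begin

lemma nn_integral_translates:
  assumes [measurable]: "f \<in> borel_measurable borel"
  shows "(\<integral>\<^sup>+t. (\<integral>\<^sup>+w. ennreal ((cmod (f (t + X w)))\<^sup>2) \<partial>\<Theta>) \<partial>lborel) = emeasure \<Theta> (space \<Theta>) * sqnorm f"
proof -
  interpret finite_measure \<Theta> by (rule \<Theta>)
  interpret P: pair_sigma_finite \<Theta> "lborel :: 'a measure" ..
  have "(\<integral>\<^sup>+t. (\<integral>\<^sup>+w. ennreal ((cmod (f (t + X w)))\<^sup>2) \<partial>\<Theta>) \<partial>lborel) =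
      (\<integral>\<^sup>+w. (\<integral>\<^sup>+t. ennreal ((cmod (f (t + X w)))\<^sup>2) \<partial>lborel) \<partial>\<Theta>)"
    by (rule P.Fubini') measurable
  also have "\<dots> = (\<integral>\<^sup>+w. sqnorm f \<partial>\<Theta>)"
    unfolding sqnorm_def by (intro nn_integral_cong lborel_translate_nn_integral) measurable
  finally show ?thesis by (simp add: mult.commute)
qed

text \<open>One factor of the mass comes from Cauchy-Schwarz in \<open>w\<close>, the other from
  Tonelli and the translation invariance of Lebesgue measure. Only the mass of \<Theta> is seen, so
  singular measures are covered as well as densities.\<close>

lemma sqnorm_average_le:
  assumes [measurable]: "f \<in> borel_measurable borel"
    and k: "\<And>w t. cmod (k w t) \<le> 1"
  shows "sqnorm (\<lambda>t. LINT w|\<Theta>. k w t * f (t + X w)) \<le> (emeasure \<Theta> (space \<Theta>))\<^sup>2 * sqnorm f"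
proof -
  interpret finite_measure \<Theta> by (rule \<Theta>)
  let ?m = "emeasure \<Theta> (space \<Theta>)"
  have "sqnorm (\<lambda>t. LINT w|\<Theta>. k w t * f (t + X w)) \<le>
      (\<integral>\<^sup>+t. ?m * (\<integral>\<^sup>+w. ennreal ((cmod (f (t + X w)))\<^sup>2) \<partial>\<Theta>) \<partial>lborel)"
    unfolding sqnorm_def
  proof (intro nn_integral_mono)
    fix t
    have "ennreal (cmod (LINT w|\<Theta>. k w t * f (t + X w))) \<le> (\<integral>\<^sup>+w. ennreal (cmod (k w t * f (t + X w))) \<partial>\<Theta>)"
      by (rule norm_integral_le_nn_integral)
    also have "\<dots> \<le> (\<integral>\<^sup>+w. ennreal (cmod (f (t + X w))) * 1 \<partial>\<Theta>)"
      using mult_right_mono[OF k norm_ge_zero]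
      by (intro nn_integral_mono) (simp add: norm_mult ennreal_leI)
    finally have "ennreal ((cmod (LINT w|\<Theta>. k w t * f (t + X w)))\<^sup>2) \<le> (\<integral>\<^sup>+w. ennreal (cmod (f (t + X w))) * 1 \<partial>\<Theta>)\<^sup>2"
      by (simp add: ennreal_power[symmetric] power_mono)
    also have "\<dots> \<le> (\<integral>\<^sup>+w. (ennreal (cmod (f (t + X w))))\<^sup>2 \<partial>\<Theta>) * (\<integral>\<^sup>+w. 1\<^sup>2 \<partial>\<Theta>)"
      by (rule Cauchy_Schwarz_nn_integral) measurable
    finally show "ennreal ((cmod (LINT w|\<Theta>. k w t * f (t + X w)))\<^sup>2) \<le> ?m * (\<integral>\<^sup>+w. ennreal ((cmod (f (t + X w)))\<^sup>2) \<partial>\<Theta>)"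
      by (simp add: ennreal_power mult.commute)
  qed
  also have "\<dots> = ?m * (?m * sqnorm f)"
    by (subst nn_integral_cmult) (auto simp: nn_integral_translates)
  finally show ?thesis by (simp add: power2_eq_square mult.assoc)
qed

lemma AE_integrable_translates:
  assumes f: "square_integrable f"
  shows "AE t in lborel. integrable \<Theta> (\<lambda>w. f (t + X w))"
proof -
  interpret finite_measure \<Theta> by (rule \<Theta>)
  have [measurable]: "f \<in> borel_measurable borel" and "sqnorm f < \<infinity>"
    using f by (auto simp: square_integrable_iff_sqnorm)
  then have "(\<integral>\<^sup>+t. (\<integral>\<^sup>+w. ennreal ((cmod (f (t + X w)))\<^sup>2) \<partial>\<Theta>) \<partial>lborel) \<noteq> \<infinity>"
    by (auto simp: nn_integral_translates ennreal_mult_eq_top_iff)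
  then have "AE t in lborel. (\<integral>\<^sup>+w. ennreal ((cmod (f (t + X w)))\<^sup>2) \<partial>\<Theta>) \<noteq> \<infinity>"
    by (intro nn_integral_PInf_AE) measurable
  then show ?thesis
  proof eventually_elim
    fix t assume "(\<integral>\<^sup>+w. ennreal ((cmod (f (t + X w)))\<^sup>2) \<partial>\<Theta>) \<noteq> \<infinity>"
    then have i: "integrable \<Theta> (\<lambda>w. (cmod (f (t + X w)))\<^sup>2)"
      by (simp add: integrable_iff_bounded top.not_eq_extremum)
    have i1: "integrable \<Theta> (\<lambda>w. 1 + (cmod (f (t + X w)))\<^sup>2)" using i by simp
    have b: "norm a \<le> norm (1 + (cmod a)\<^sup>2)" for a :: complex
    proof -
      have "0 \<le> cmod a" "2 * cmod a \<le> (cmod a)\<^sup>2 + 1"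
        using sum_squares_bound[of "cmod a" 1] by simp_all
      then show ?thesis unfolding real_norm_def by linarith
    qed
    show "integrable \<Theta> (\<lambda>w. f (t + X w))"
      by (rule Bochner_Integration.integrable_bound[OF i1 _ AE_I2[OF b]]) measurable
  qed
qed

end

definition wchar :: "'a::euclidean_space \<times> 'a \<Rightarrow> 'a \<Rightarrow> complex"
  where "wchar z t = exp (\<i> * complex_of_real (pi * (fst z \<bullet> snd z + 2 * (snd z \<bullet> t))))"

lemma norm_wchar [simp]: "cmod (wchar z t) = 1"
  by (simp add: wchar_def)

lemma borel_measurable_wchar [measurable (raw)]:
  assumes [measurable]: "f \<in> borel_measurable M" "g \<in> borel_measurable M"
  shows "(\<lambda>x. wchar (f x) (g x)) \<in> borel_measurable M"
  unfolding wchar_def by measurable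

text \<open>Represents the complex measure with density \<open>h\<close> with respect to \<nu>. The
  modulus of \<open>h\<close> is only bounded by 1 instead of equal to 1, so that \<open>sgn\<close>
  of a function with zeros qualifies.\<close>

definition weight :: "'z::topological_space measure \<Rightarrow> ('z \<Rightarrow> complex) \<Rightarrow> bool"
  where "weight \<nu> h \<longleftrightarrow> finite_borel \<nu> \<and> h \<in> borel_measurable borel \<and> (\<forall>z. cmod (h z) \<le> 1)"

lemma weightD:
  assumes "weight \<nu> h"
  shows "finite_borel \<nu>" "finite_measure \<nu>" "sets \<nu> = sets borel" "space \<nu> = UNIV"
    "h \<in> borel_measurable borel" "cmod (h z) \<le> 1"
  using assms finite_borelD[of \<nu>] by (auto simp: weight_def)

definition weyl_fun :: "('a::euclidean_space \<times> 'a) measure \<Rightarrow> ('a \<times> 'a \<Rightarrow> complex) \<Rightarrow> ('a \<Rightarrow> complex) \<Rightarrow> 'a \<Rightarrow> complex"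
  where "weyl_fun \<nu> h f t = (LINT z|\<nu>. h z * wchar z t * f (t + fst z))"

context
  fixes \<nu> :: "('a::euclidean_space \<times> 'a) measure" and h
  assumes w: "weight \<nu> h"
begin

lemma fst_weight_measurable: "fst \<in> borel_measurable \<nu>"
  using weightD(3)[OF w] borel_measurable_fst_snd(1) by (simp cong: measurable_cong_sets)

lemma weyl_fun_measurable [measurable]:
  assumes [measurable]: "f \<in> borel_measurable borel"
  shows "weyl_fun \<nu> h f \<in> borel_measurable borel"
proof -
  note [measurable_cong] = weightD(3)[OF w]
  note [measurable] = weightD(5)[OF w]
  interpret finite_measure \<nu> by (rule weightD[OF w])
  show ?thesis unfolding weyl_fun_def[abs_def]
    by (rule borel_measurable_lebesgue_integral) measurable
qed

lemma sqnorm_weyl_fun_le: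
  assumes "f \<in> borel_measurable borel"
  shows "sqnorm (weyl_fun \<nu> h f) \<le> (emeasure \<nu> UNIV)\<^sup>2 * sqnorm f"
  using sqnorm_average_le[OF weightD(2)[OF w] fst_weight_measurable assms, of "\<lambda>z t. h z * wchar z t"] weightD[OF w]
  by (simp add: weyl_fun_def[abs_def] norm_mult)

lemma square_integrable_weyl_fun:
  assumes "square_integrable f"
  shows "square_integrable (weyl_fun \<nu> h f)"
proof -
  interpret finite_measure \<nu> by (rule weightD[OF w])
  have "emeasure \<nu> UNIV < top" using emeasure_finite[of UNIV] by (simp add: less_top[symmetric])
  then have "(emeasure \<nu> UNIV)\<^sup>2 * sqnorm f < \<infinity>"
    using assms by (auto simp: square_integrable_iff_sqnorm ennreal_mult_less_top power_less_top_ennreal)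
  then show ?thesis
    using assms sqnorm_weyl_fun_le[of f] by (auto simp: square_integrable_iff_sqnorm weyl_fun_measurable)
qed

lemma AE_integrable_weyl_fun:
  assumes f: "square_integrable f"
  shows "AE t in lborel. integrable \<nu> (\<lambda>z. h z * wchar z t * f (t + fst z))"
  using AE_integrable_translates[OF weightD(2)[OF w] fst_weight_measurable f]
proof eventually_elim
  fix t assume i: "integrable \<nu> (\<lambda>z. f (t + fst z))"
  note [measurable_cong] = weightD(3)[OF w]
  note [measurable] = weightD(5)[OF w] square_integrableD[OF f]
  show "integrable \<nu> (\<lambda>z. h z * wchar z t * f (t + fst z))"
    by (rule Bochner_Integration.integrable_bound[OF i])
      (use weightD(6)[OF w] in \<open>auto simp: norm_mult mult_left_le_one_le\<close>)
qed

lemma weyl_fun_add: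
  assumes "square_integrable f" "square_integrable g"
  shows "AE t in lborel. weyl_fun \<nu> h (\<lambda>t. f t + g t) t = weyl_fun \<nu> h f t + weyl_fun \<nu> h g t"
  using AE_integrable_weyl_fun[OF assms(1)] AE_integrable_weyl_fun[OF assms(2)]
  by eventually_elim (simp add: weyl_fun_def distrib_left)

lemma weyl_fun_mult: "weyl_fun \<nu> h (\<lambda>t. c * f t) t = c * weyl_fun \<nu> h f t"
  unfolding weyl_fun_def by (subst integral_mult_right_zero[symmetric]) (simp add: mult.left_commute)

text \<open>At a fixed \<open>t\<close>, a singular \<nu> may notice a change of \<open>f\<close> on
  a Lebesgue null set. The norm bound applied to the difference shows that this happens only for a
  null set of \<open>t\<close>.\<close>

lemma weyl_fun_cong_AE:
  assumes f: "square_integrable f" and g: "square_integrable g" and "AE t in lborel. f t = g t"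
  shows "AE t in lborel. weyl_fun \<nu> h f t = weyl_fun \<nu> h g t"
proof -
  have mg: "square_integrable (\<lambda>t. (-1) * g t)" by (rule square_integrable_mult[OF g])
  have d: "square_integrable (\<lambda>t. f t + (-1) * g t)" by (rule square_integrable_add[OF f mg])
  have "AE t in lborel. f t + (-1) * g t = 0" using assms(3) by eventually_elim simp
  then have "sqnorm (\<lambda>t. f t + (-1) * g t) = 0"
    using sqnorm_zero_iff[OF square_integrableD[OF d]] by simp
  then have "sqnorm (weyl_fun \<nu> h (\<lambda>t. f t + (-1) * g t)) = 0"
    using sqnorm_weyl_fun_le[OF square_integrableD[OF d]] by simp
  then have "AE t in lborel. weyl_fun \<nu> h (\<lambda>t. f t + (-1) * g t) t = 0"
    using sqnorm_zero_iff[OF weyl_fun_measurable[OF square_integrableD[OF d]]] by simp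
  with weyl_fun_add[OF f mg] show ?thesis by eventually_elim (simp only: weyl_fun_mult, simp)
qed

text \<open>Brings the integral over \<open>t\<close> inside, where only a single shift has to be
  understood. Fubini applies because the integrand is bounded by two squares, each integrable for
  the product measure.\<close>

lemma weyl_fun_form:
  assumes f: "square_integrable f" and g: "square_integrable g"
  shows "(LINT t|lborel. weyl_fun \<nu> h f t \<bullet> g t) =
    (LINT z|\<nu>. LINT t|lborel. (h z * wchar z t * f (t + fst z)) \<bullet> g t)"
proof -
  note [measurable_cong] = weightD(3)[OF w]
  note [measurable] = weightD(5)[OF w] square_integrableD[OF f] square_integrableD[OF g]
  interpret finite_measure \<nu> by (rule weightD[OF w])
  interpret P: pair_sigma_finite "lborel :: 'a measure" \<nu> ..
  let ?k = "\<lambda>t z. (h z * wchar z t * f (t + fst z)) \<bullet> g t"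
  have b: "\<bar>?k t z\<bar> \<le> (cmod (f (t + fst z)))\<^sup>2 + (cmod (g t))\<^sup>2" for t z
  proof -
    have "\<bar>?k t z\<bar> \<le> cmod (h z * wchar z t * f (t + fst z)) * cmod (g t)" by (rule Cauchy_Schwarz_ineq2)
    also have "\<dots> \<le> cmod (f (t + fst z)) * cmod (g t)"
      using weightD(6)[OF w, of z] by (intro mult_right_mono) (auto simp: norm_mult mult_left_le_one_le)
    also have "\<dots> \<le> (cmod (f (t + fst z)))\<^sup>2 + (cmod (g t))\<^sup>2"
      using sum_squares_bound[of "cmod (f (t + fst z))" "cmod (g t)"]
        mult_nonneg_nonneg[of "cmod (f (t + fst z))" "cmod (g t)", OF norm_ge_zero norm_ge_zero] by linarith
    finally show ?thesis .
  qed
  have "(\<integral>\<^sup>+p. norm (?k (fst p) (snd p)) \<partial>(lborel \<Otimes>\<^sub>M \<nu>)) = (\<integral>\<^sup>+t. \<integral>\<^sup>+z. norm (?k t z) \<partial>\<nu> \<partial>lborel)"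
    using nn_integral_fst[of "\<lambda>p. ennreal (norm (?k (fst p) (snd p)))" lborel] by simp
  also have "\<dots> \<le> (\<integral>\<^sup>+t. \<integral>\<^sup>+z. ennreal ((cmod (f (t + fst z)))\<^sup>2) + ennreal ((cmod (g t))\<^sup>2) \<partial>\<nu> \<partial>lborel)"
    using b by (intro nn_integral_mono) (simp flip: ennreal_plus add: ennreal_leI)
  also have "\<dots> = emeasure \<nu> UNIV * sqnorm f + emeasure \<nu> UNIV * sqnorm g"
    using nn_integral_translates[OF weightD(2)[OF w] fst_weight_measurable, of f] weightD(4)[OF w]
      nn_integral_cmult[of "\<lambda>t. ennreal ((cmod (g t))\<^sup>2)" lborel "emeasure \<nu> UNIV"]
    by (simp add: nn_integral_add sqnorm_def mult.commute)
  also have "emeasure \<nu> UNIV * sqnorm f + emeasure \<nu> UNIV * sqnorm g < \<infinity>"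
  proof -
    have "emeasure \<nu> UNIV < top" using emeasure_finite[of UNIV] by (simp add: less_top[symmetric])
    then show ?thesis using f g by (auto simp: square_integrable_iff_sqnorm ennreal_mult_less_top)
  qed
  finally have int: "integrable (lborel \<Otimes>\<^sub>M \<nu>) (\<lambda>(t, z). ?k t z)"
    by (simp add: integrable_iff_bounded split_beta')
  have "(LINT t|lborel. weyl_fun \<nu> h f t \<bullet> g t) = (LINT t|lborel. LINT z|\<nu>. ?k t z)"
  proof (rule integral_cong_AE)
    show "(\<lambda>t. weyl_fun \<nu> h f t \<bullet> g t) \<in> borel_measurable lborel"
      using weyl_fun_measurable[OF square_integrableD[OF f]] by measurable
    show "(\<lambda>t. LINT z|\<nu>. ?k t z) \<in> borel_measurable lborel"
      by (rule borel_measurable_lebesgue_integral) measurable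
    show "AE t in lborel. weyl_fun \<nu> h f t \<bullet> g t = (LINT z|\<nu>. ?k t z)"
      using AE_integrable_weyl_fun[OF f] by eventually_elim (simp add: weyl_fun_def)
  qed
  also have "\<dots> = (LINT z|\<nu>. LINT t|lborel. ?k t z)"
    using P.Fubini_integral[OF int] by simp
  finally show ?thesis .
qed

end

section \<open>Adjoints and products of Weyl transforms\<close>

definition reflect :: "'z::euclidean_space measure \<Rightarrow> 'z measure"
  where "reflect \<nu> = distr \<nu> borel uminus"

lemma weight_reflect:
  assumes w: "weight \<nu> h"
  shows "weight (reflect \<nu>) (\<lambda>z. cnj (h (- z)))"
proof -
  have "uminus \<in> measurable \<nu> borel"
    using weightD(3)[OF w] by (simp cong: measurable_cong_sets)
  moreover have "(\<lambda>z. cnj (h (- z))) \<in> borel_measurable borel"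
    using weightD(5)[OF w] by measurable
  ultimately show ?thesis
    using weightD[OF w] finite_measure.finite_measure_distr[of \<nu> uminus borel]
    by (auto simp: weight_def finite_borel_def reflect_def)
qed

text \<open>The adjoint of the unitary belonging to \<open>z\<close> is the one belonging to
  \<open>- z\<close>. Substituting \<open>t + fst z\<close> for \<open>t\<close> accounts for the
  phases: with \<open>z = (x, y)\<close>, the shift adds twice \<open>x \<bullet> y\<close> and so
  cancels the sign that conjugation puts in front of it.\<close>

lemma weyl_fun_adjoint:
  fixes \<nu> :: "('a::euclidean_space \<times> 'a) measure"
  assumes w: "weight \<nu> h" and f: "square_integrable f" and g: "square_integrable g"
  shows "(LINT t|lborel. weyl_fun \<nu> h f t \<bullet> g t) = (LINT t|lborel. f t \<bullet> weyl_fun (reflect \<nu>) (\<lambda>z. cnj (h (- z))) g t)"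
proof -
  note [measurable] = weightD(5)[OF w] square_integrableD[OF f] square_integrableD[OF g]
  have um: "uminus \<in> measurable \<nu> borel"
    using weightD(3)[OF w] by (simp cong: measurable_cong_sets)
  have c: "cnj (wchar z (s - fst z)) = wchar (- z) s" for z :: "'a \<times> 'a" and s
      unfolding wchar_def exp_cnj
    by (rule arg_cong[where f = exp]) (simp add: inner_diff_right inner_commute algebra_simps)
  have m: "(\<lambda>z. LINT t|lborel. (cnj (h (- z)) * wchar z t * g (t + fst z)) \<bullet> f t) \<in> borel_measurable borel"
    by (rule lborel.borel_measurable_lebesgue_integral) measurable
  have "(LINT t|lborel. f t \<bullet> weyl_fun (reflect \<nu>) (\<lambda>z. cnj (h (- z))) g t) =
      (LINT t|lborel. weyl_fun (reflect \<nu>) (\<lambda>z. cnj (h (- z))) g t \<bullet> f t)" by (simp add: inner_commute)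
  also have "\<dots> = (LINT z|reflect \<nu>. LINT t|lborel. (cnj (h (- z)) * wchar z t * g (t + fst z)) \<bullet> f t)"
    by (rule weyl_fun_form[OF weight_reflect[OF w] g f])
  also have "\<dots> = (LINT z|\<nu>. LINT t|lborel. (cnj (h z) * wchar (- z) t * g (t + - fst z)) \<bullet> f t)"
    unfolding reflect_def by (subst integral_distr[OF um m]) simp
  also have "\<dots> = (LINT z|\<nu>. LINT t|lborel. (h z * wchar z t * f (t + fst z)) \<bullet> g t)"
  proof (rule Bochner_Integration.integral_cong[OF refl])
    fix z
    let ?F = "\<lambda>t. (cnj (h z) * wchar (- z) t * g (t + - fst z)) \<bullet> f t"
    have eq: "?F (t + fst z) = (h z * wchar z t * f (t + fst z)) \<bullet> g t" for t
    proof -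
      have "wchar (- z) (t + fst z) = cnj (wchar z t)" using c[of z "t + fst z"] by simp
      then have "?F (t + fst z) = (cnj (h z * wchar z t) * g t) \<bullet> f (t + fst z)" by simp
      also have "\<dots> = (h z * wchar z t * f (t + fst z)) \<bullet> g t"
        by (simp add: inner_complex_def algebra_simps)
      finally show ?thesis .
    qed
    have "(LINT t|lborel. ?F t) = (LINT t|lborel. ?F (t + fst z))"
      by (rule lborel_translate_integral[symmetric]) measurable
    also have "\<dots> = (LINT t|lborel. (h z * wchar z t * f (t + fst z)) \<bullet> g t)"
      by (simp only: eq)
    finally show "(LINT t|lborel. ?F t) = (LINT t|lborel. (h z * wchar z t * f (t + fst z)) \<bullet> g t)" .
  qed
  also have "\<dots> = (LINT t|lborel. weyl_fun \<nu> h f t \<bullet> g t)" by (rule weyl_fun_form[OF w f g, symmetric])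
  finally show ?thesis by simp
qed

text \<open>\<open>k\<close> is the conditional expectation of \<open>r\<close> given
  \<open>S\<close>, obtained as the Radon-Nikodym derivative of the image of \<open>r\<close> times
  \<Theta> with respect to the image of \<Theta>. The bound on \<open>r\<close> keeps the former
  finite.\<close>

lemma real_push_density:
  fixes S :: "'w \<Rightarrow> 'z::euclidean_space" and r :: "'w \<Rightarrow> real"
  assumes \<Theta>: "finite_measure \<Theta>" and S[measurable]: "S \<in> borel_measurable \<Theta>"
    and r[measurable]: "r \<in> borel_measurable \<Theta>" and r01: "\<And>w. 0 \<le> r w" "\<And>w. r w \<le> 1"
  shows "\<exists>k\<in>borel_measurable borel. \<forall>g :: 'z \<Rightarrow> complex. g \<in> borel_measurable borel \<longrightarrow> integrable \<Theta> (\<lambda>w. g (S w)) \<longrightarrow>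
      integrable (distr \<Theta> borel S) (\<lambda>u. k u *\<^sub>R g u) \<and>
      (LINT w|\<Theta>. r w *\<^sub>R g (S w)) = (LINT u|distr \<Theta> borel S. k u *\<^sub>R g u)"
proof -
  interpret \<Theta>: finite_measure \<Theta> by (rule \<Theta>)
  define \<nu> where "\<nu> = distr \<Theta> borel S"
  interpret \<nu>: finite_measure \<nu> unfolding \<nu>_def by (rule \<Theta>.finite_measure_distr) simp
  define D where "D = density \<Theta> (\<lambda>w. ennreal (r w))"
  define \<Lambda> where "\<Lambda> = distr D borel S"
  have SD[measurable]: "S \<in> borel_measurable D" by (simp add: D_def)
  have "emeasure D (space D) = (\<integral>\<^sup>+w. ennreal (r w) \<partial>\<Theta>)"
    by (simp add: D_def emeasure_density cong: nn_integral_cong)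
  also have "\<dots> \<le> (\<integral>\<^sup>+w. 1 \<partial>\<Theta>)"
    using r01(2) by (intro nn_integral_mono) (simp add: ennreal_le_1)
  also have "\<dots> < \<infinity>" using \<Theta>.emeasure_finite[of "space \<Theta>"] by (simp add: less_top[symmetric])
  finally have "finite_measure D" by (intro finite_measureI) simp
  then have \<Lambda>: "finite_measure \<Lambda>" unfolding \<Lambda>_def by (rule finite_measure.finite_measure_distr) simp
  have ac: "absolutely_continuous \<nu> \<Lambda>"
    unfolding absolutely_continuous_def
  proof
    fix A assume A: "A \<in> null_sets \<nu>"
    then have [measurable]: "A \<in> sets borel" by (auto simp: \<nu>_def)
    have "S -` A \<inter> space \<Theta> \<in> null_sets \<Theta>"
      using A by (auto simp: \<nu>_def null_sets_def emeasure_distr)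
    then have "S -` A \<inter> space \<Theta> \<in> null_sets D"
      unfolding D_def using absolutely_continuousI_density[of "\<lambda>w. ennreal (r w)" \<Theta>] r
      by (auto simp: absolutely_continuous_def)
    then show "A \<in> null_sets \<Lambda>"
      by (auto simp: \<Lambda>_def null_sets_def emeasure_distr) (auto simp: D_def)
  qed
  have s: "sets \<Lambda> = sets \<nu>" by (simp add: \<Lambda>_def \<nu>_def)
  obtain k where k: "k \<in> borel_measurable \<nu>" "AE u in \<nu>. RN_deriv \<nu> \<Lambda> u = ennreal (k u)" "\<And>u. 0 \<le> k u"
    using \<nu>.real_RN_deriv[OF \<Lambda> ac s] by metis
  have km[measurable]: "k \<in> borel_measurable borel" using k(1) by (simp add: \<nu>_def)
  have "\<Lambda> = density \<nu> (RN_deriv \<nu> \<Lambda>)" using \<nu>.density_RN_deriv[OF ac s] by simp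
  also have "\<dots> = density \<nu> (\<lambda>u. ennreal (k u))" using k by (intro density_cong) auto
  finally have \<Lambda>k: "\<Lambda> = density \<nu> (\<lambda>u. ennreal (k u))" .
  show ?thesis
  proof (intro bexI[OF _ km] allI impI)
    fix g :: "'z \<Rightarrow> complex" assume [measurable]: "g \<in> borel_measurable borel" and i: "integrable \<Theta> (\<lambda>w. g (S w))"
    have "integrable \<Theta> (\<lambda>w. r w *\<^sub>R g (S w))"
      by (rule Bochner_Integration.integrable_bound[OF i]) (use r01 in \<open>auto simp: mult_left_le_one_le\<close>)
    then have "integrable D (\<lambda>w. g (S w))"
      unfolding D_def using r01 by (subst integrable_density) auto
    then have "integrable \<Lambda> g"
      unfolding \<Lambda>_def by (subst integrable_distr_eq) auto
    then have 1: "integrable \<nu> (\<lambda>u. k u *\<^sub>R g u)"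
      unfolding \<Lambda>k using k(3) by (subst (asm) integrable_density) (auto simp: \<nu>_def)
    have "(LINT w|\<Theta>. r w *\<^sub>R g (S w)) = (LINT w|D. g (S w))"
      unfolding D_def using r01 by (subst integral_density) auto
    also have "\<dots> = (LINT u|\<Lambda>. g u)"
      unfolding \<Lambda>_def by (subst integral_distr) auto
    also have "\<dots> = (LINT u|\<nu>. k u *\<^sub>R g u)"
      unfolding \<Lambda>k using k(3) by (subst integral_density) (auto simp: \<nu>_def)
    finally show "integrable (distr \<Theta> borel S) (\<lambda>u. k u *\<^sub>R g u) \<and>
      (LINT w|\<Theta>. r w *\<^sub>R g (S w)) = (LINT u|distr \<Theta> borel S. k u *\<^sub>R g u)"
      using 1 by (simp add: \<nu>_def)
  qed
qed

text \<open>The combination by which \<open>push_density\<close> rebuilds a complex weight from two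
  weights with values in the unit interval.\<close>

lemma integral_complex_combination:
  fixes A B G :: "'w \<Rightarrow> complex"
  assumes "integrable M A" "integrable M B" "integrable M G"
  shows "integrable M (\<lambda>u. 2 * A u - G u + \<i> * (2 * B u - G u))"
    and "(LINT u|M. 2 * A u - G u + \<i> * (2 * B u - G u)) =
      2 * (LINT u|M. A u) - (LINT u|M. G u) + \<i> * (2 * (LINT u|M. B u) - (LINT u|M. G u))"
  using assms by simp_all


text \<open>A weight \<open>c\<close> on the source is averaged over the fibres of \<open>S\<close>
  to give a weight on the values of \<open>S\<close>. This is needed when \<open>c\<close> is not a
  function of \<open>S\<close>, as for the phase in a twisted convolution.\<close>

lemma push_density:
  fixes S :: "'w \<Rightarrow> 'z::euclidean_space" and c :: "'w \<Rightarrow> complex"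
  assumes \<Theta>: "finite_measure \<Theta>" and S[measurable]: "S \<in> borel_measurable \<Theta>"
    and c[measurable]: "c \<in> borel_measurable \<Theta>" and c1: "\<And>w. cmod (c w) \<le> 1"
  obtains \<nu> h where "weight \<nu> h" "absolutely_continuous (distr \<Theta> borel S) \<nu>"
    "\<And>g. g \<in> borel_measurable borel \<Longrightarrow> integrable \<Theta> (\<lambda>w. g (S w)) \<Longrightarrow>
      (LINT w|\<Theta>. c w * g (S w)) = (LINT u|\<nu>. h u * g u)"
proof -
  interpret \<Theta>: finite_measure \<Theta> by (rule \<Theta>)
  define \<nu>0 where "\<nu>0 = distr \<Theta> borel S"
  interpret \<nu>0: finite_measure \<nu>0 unfolding \<nu>0_def by (rule \<Theta>.finite_measure_distr) simp
  have s0: "sets \<nu>0 = sets borel" by (simp add: \<nu>0_def)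
  note [measurable_cong] = s0
  have ri: "\<bar>Re (c w)\<bar> \<le> 1" "\<bar>Im (c w)\<bar> \<le> 1" for w
    using abs_Re_le_cmod[of "c w"] abs_Im_le_cmod[of "c w"] c1[of w] by linarith+
  \<comment> \<open>\<open>real_push_density\<close> handles weights in the unit interval, so real
    and imaginary part are first moved there affinely; \<open>K\<close> below undoes this.\<close>
  have r01: "0 \<le> (Re (c w) + 1) / 2" "(Re (c w) + 1) / 2 \<le> 1" "0 \<le> (Im (c w) + 1) / 2" "(Im (c w) + 1) / 2 \<le> 1" for w
    using ri(1)[of w] ri(2)[of w] by (simp_all add: abs_le_iff)
  have rm: "(\<lambda>w. (Re (c w) + 1) / 2) \<in> borel_measurable \<Theta>" "(\<lambda>w. (Im (c w) + 1) / 2) \<in> borel_measurable \<Theta>"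
    by measurable
  obtain k1 where k1: "k1 \<in> borel_measurable borel"
    "\<And>g :: 'z \<Rightarrow> complex. g \<in> borel_measurable borel \<Longrightarrow> integrable \<Theta> (\<lambda>w. g (S w)) \<Longrightarrow>
      integrable \<nu>0 (\<lambda>u. k1 u *\<^sub>R g u) \<and> (LINT w|\<Theta>. ((Re (c w) + 1) / 2) *\<^sub>R g (S w)) = (LINT u|\<nu>0. k1 u *\<^sub>R g u)"
    using real_push_density[OF \<Theta> S rm(1) r01(1,2)] unfolding \<nu>0_def[symmetric] by blast
  obtain k2 where k2: "k2 \<in> borel_measurable borel"
    "\<And>g :: 'z \<Rightarrow> complex. g \<in> borel_measurable borel \<Longrightarrow> integrable \<Theta> (\<lambda>w. g (S w)) \<Longrightarrow>
      integrable \<nu>0 (\<lambda>u. k2 u *\<^sub>R g u) \<and> (LINT w|\<Theta>. ((Im (c w) + 1) / 2) *\<^sub>R g (S w)) = (LINT u|\<nu>0. k2 u *\<^sub>R g u)"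
    using real_push_density[OF \<Theta> S rm(2) r01(3,4)] unfolding \<nu>0_def[symmetric] by blast
  note [measurable] = k1(1) k2(1)
  define K where "K u = complex_of_real (2 * k1 u - 1) + \<i> * complex_of_real (2 * k2 u - 1)" for u
  have Km[measurable]: "K \<in> borel_measurable borel" unfolding K_def[abs_def] by measurable
  have K: "integrable \<nu>0 (\<lambda>u. K u * g u) \<and> (LINT w|\<Theta>. c w * g (S w)) = (LINT u|\<nu>0. K u * g u)"
    if [measurable]: "g \<in> borel_measurable borel" and i: "integrable \<Theta> (\<lambda>w. g (S w))" for g
  proof -
    have i0: "integrable \<nu>0 g" unfolding \<nu>0_def using i by (subst integrable_distr_eq) auto
    have g0: "(LINT u|\<nu>0. g u) = (LINT w|\<Theta>. g (S w))"
      unfolding \<nu>0_def by (subst integral_distr) auto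
    have e: "K u * g u = 2 * (k1 u *\<^sub>R g u) - g u + \<i> * (2 * (k2 u *\<^sub>R g u) - g u)" for u
      by (simp add: K_def scaleR_conv_of_real algebra_simps)
    have e': "c w * g (S w) = 2 * (((Re (c w) + 1) / 2) *\<^sub>R g (S w)) - g (S w) +
      \<i> * (2 * (((Im (c w) + 1) / 2) *\<^sub>R g (S w)) - g (S w))" for w
      by (subst complex_eq[of "c w"]) (simp add: scaleR_conv_of_real field_simps)
    have sc: "norm (r *\<^sub>R x) \<le> norm x" if "0 \<le> r" "r \<le> 1" for r and x :: complex
      using that by (simp add: mult_left_le_one_le)
    have ic: "integrable \<Theta> (\<lambda>w. ((Re (c w) + 1) / 2) *\<^sub>R g (S w))" "integrable \<Theta> (\<lambda>w. ((Im (c w) + 1) / 2) *\<^sub>R g (S w))"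
      using rm r01 mult_left_le_one_le
      by (auto intro!: Bochner_Integration.integrable_bound[OF i] AE_I2 sc simp del: norm_scaleR)
    show ?thesis
      unfolding e e' using k1(2)[OF that] k2(2)[OF that] g0
        integral_complex_combination[OF ic i]
        integral_complex_combination[OF conjunct1[OF k1(2)[OF that]] conjunct1[OF k2(2)[OF that]] i0]
      by (auto simp only:)
  qed
  have "integrable \<nu>0 (\<lambda>u. K u * 1)" by (rule conjunct1[OF K]) simp_all
  then have Ki: "integrable \<nu>0 K" by simp
  \<comment> \<open>\<open>K\<close> has been shown integrable, not bounded by 1. Its modulus
    therefore goes into the measure and only its phase into the weight.\<close>
  define \<nu> where "\<nu> = density \<nu>0 (\<lambda>u. ennreal (cmod (K u)))"
  have "emeasure \<nu> (space \<nu>) = (\<integral>\<^sup>+u. norm (K u) \<partial>\<nu>0)"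
    by (simp add: \<nu>_def emeasure_density cong: nn_integral_cong)
  also have "\<dots> < \<infinity>" using Ki by (simp add: integrable_iff_bounded)
  finally have fin: "finite_measure \<nu>" by (intro finite_measureI) simp
  show ?thesis
  proof (rule that)
    show "weight \<nu> (\<lambda>u. sgn (K u))"
      using fin by (auto simp: weight_def finite_borel_def \<nu>_def s0 norm_sgn)
    show "absolutely_continuous (distr \<Theta> borel S) \<nu>"
      unfolding \<nu>_def \<nu>0_def[symmetric] by (rule absolutely_continuousI_density) simp
    fix g :: "'z \<Rightarrow> complex" assume g[measurable]: "g \<in> borel_measurable borel" and i: "integrable \<Theta> (\<lambda>w. g (S w))"
    have "(LINT u|\<nu>. sgn (K u) * g u) = (LINT u|\<nu>0. cmod (K u) *\<^sub>R (sgn (K u) * g u))"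
      unfolding \<nu>_def by (subst integral_density) auto
    also have "\<dots> = (LINT u|\<nu>0. K u * g u)"
      by (intro Bochner_Integration.integral_cong refl)
        (auto simp: sgn_div_norm scaleR_conv_of_real)
    finally show "(LINT w|\<Theta>. c w * g (S w)) = (LINT u|\<nu>. sgn (K u) * g u)"
      using K[OF g i] by simp
  qed
qed

text \<open>Two shifts compose to the shift by the sum, up to a phase given by the symplectic form
  of the pair. The phase depends on the pair and not just on its sum, so the product is a twisted
  convolution, and \<open>push_density\<close> turns it into a weight on sums.\<close>

lemma weyl_fun_compose:
  fixes \<nu>1 \<nu>2 :: "('a::euclidean_space \<times> 'a) measure"
  assumes w1: "weight \<nu>1 h1" and w2: "weight \<nu>2 h2"
  obtains \<nu> h where "weight \<nu> h" "absolutely_continuous (conv \<nu>1 \<nu>2) \<nu>"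
    "\<And>f. square_integrable f \<Longrightarrow> AE t in lborel. weyl_fun \<nu>1 h1 (weyl_fun \<nu>2 h2 f) t = weyl_fun \<nu> h f t"
proof -
  let ?\<Theta> = "\<nu>1 \<Otimes>\<^sub>M \<nu>2"
  note [measurable_cong] = weightD(3)[OF w1] weightD(3)[OF w2]
  note [measurable] = weightD(5)[OF w1] weightD(5)[OF w2]
  interpret \<nu>1: finite_measure \<nu>1 by (rule weightD[OF w1])
  interpret \<nu>2: finite_measure \<nu>2 by (rule weightD[OF w2])
  interpret P: pair_sigma_finite \<nu>1 \<nu>2 ..
  have \<Theta>: "finite_measure ?\<Theta>" by (rule finite_measure_pair_measure[OF weightD(2)[OF w2] weightD(2)[OF w1]])
  define S :: "('a \<times> 'a) \<times> ('a \<times> 'a) \<Rightarrow> 'a \<times> 'a" where "S = (\<lambda>(z, w). z + w)"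
  have Sm[measurable]: "S \<in> borel_measurable ?\<Theta>"
    unfolding S_def by (rule conv_map_measurable[OF weightD(1)[OF w1] weightD(1)[OF w2]])
  have dS: "distr ?\<Theta> borel S = conv \<nu>1 \<nu>2" by (simp add: conv_def S_def)
  define c where "c = (\<lambda>(z, w). h1 z * h2 w * exp (\<i> * complex_of_real (pi * (fst z \<bullet> snd w - fst w \<bullet> snd z))))"
  have cm: "c \<in> borel_measurable ?\<Theta>" unfolding c_def by measurable
  have c1: "cmod (c p) \<le> 1" for p
  proof -
    have "cmod (c p) = cmod (h1 (fst p)) * cmod (h2 (snd p))" by (simp add: c_def split_beta' norm_mult)
    also have "\<dots> \<le> 1" by (intro mult_le_one weightD(6)[OF w1] weightD(6)[OF w2] norm_ge_zero)
    finally show ?thesis .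
  qed
  obtain \<nu> h where \<nu>: "weight \<nu> h" "absolutely_continuous (distr ?\<Theta> borel S) \<nu>"
    and eq: "\<And>g. g \<in> borel_measurable borel \<Longrightarrow> integrable ?\<Theta> (\<lambda>w. g (S w)) \<Longrightarrow>
      (LINT w|?\<Theta>. c w * g (S w)) = (LINT u|\<nu>. h u * g u)"
    by (rule push_density[OF \<Theta> Sm cm c1]) (erule (1) that, blast)
  show ?thesis
  proof (rule that[OF \<nu>(1)])
    show "absolutely_continuous (conv \<nu>1 \<nu>2) \<nu>" using \<nu>(2) by (simp add: dS)
    fix f :: "'a \<Rightarrow> complex" assume f: "square_integrable f"
    note [measurable] = square_integrableD[OF f]
    have fS: "(\<lambda>p. fst (S p)) \<in> borel_measurable ?\<Theta>" by measurable
    show "AE t in lborel. weyl_fun \<nu>1 h1 (weyl_fun \<nu>2 h2 f) t = weyl_fun \<nu> h f t"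
      using AE_integrable_translates[OF \<Theta> fS f]
    proof eventually_elim
      fix t assume i: "integrable ?\<Theta> (\<lambda>p. f (t + fst (S p)))"
      define g where "g u = wchar u t * f (t + fst u)" for u
      have gm[measurable]: "g \<in> borel_measurable borel" unfolding g_def[abs_def] by measurable
      have gi: "integrable ?\<Theta> (\<lambda>p. g (S p))"
        by (rule Bochner_Integration.integrable_bound[OF i]) (auto simp: g_def norm_mult)
      have ci: "integrable ?\<Theta> (\<lambda>p. c p * g (S p))"
        by (rule Bochner_Integration.integrable_bound[OF gi]) (use c1 cm in \<open>auto simp: norm_mult mult_left_le_one_le\<close>)
      have char: "h1 z * wchar z t * (h2 w * wchar w (t + fst z) * f (t + fst z + fst w)) = c (z, w) * g (S (z, w))" for z w
      proof -
        have "wchar z t * wchar w (t + fst z) = exp (\<i> * complex_of_real (pi * (fst z \<bullet> snd w - fst w \<bullet> snd z))) * wchar (z + w) t"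
          unfolding wchar_def exp_add[symmetric]
          by (rule arg_cong[where f = exp])
            (simp add: inner_add_left inner_add_right inner_commute[of "snd w" "fst z"] algebra_simps)
        then show ?thesis by (simp add: c_def g_def S_def add.assoc mult_ac)
      qed
      have "weyl_fun \<nu>1 h1 (weyl_fun \<nu>2 h2 f) t =
          (LINT z|\<nu>1. LINT w|\<nu>2. h1 z * wchar z t * (h2 w * wchar w (t + fst z) * f (t + fst z + fst w)))"
        by (simp add: weyl_fun_def)
      also have "\<dots> = (LINT p|?\<Theta>. c p * g (S p))"
        unfolding char by (rule P.integral_fst'[OF ci])
      also have "\<dots> = (LINT u|\<nu>. h u * g u)" by (rule eq[OF gm gi])
      also have "\<dots> = weyl_fun \<nu> h f t" by (simp add: weyl_fun_def g_def mult.assoc)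
      finally show "weyl_fun \<nu>1 h1 (weyl_fun \<nu>2 h2 f) t = weyl_fun \<nu> h f t" .
    qed
  qed
qed

section \<open>Weyl operators on classes of functions\<close>

definition weyl_op :: "('a::euclidean_space \<times> 'a) measure \<Rightarrow> ('a \<times> 'a \<Rightarrow> complex) \<Rightarrow> 'a L2 \<Rightarrow> 'a L2"
  where "weyl_op \<nu> h F = abs_L2 (weyl_fun \<nu> h (rep_L2 F))"

lemma weyl_op_abs_L2:
  assumes w: "weight \<nu> h" and f: "square_integrable f"
  shows "weyl_op \<nu> h (abs_L2 f) = abs_L2 (weyl_fun \<nu> h f)"
  unfolding weyl_op_def
  by (intro abs_L2_eq square_integrable_weyl_fun[OF w] weyl_fun_cong_AE[OF w] square_integrable_rep f rep_abs_L2)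

lemma rep_weyl_op:
  assumes w: "weight \<nu> h"
  shows "AE t in lborel. rep_L2 (weyl_op \<nu> h F) t = weyl_fun \<nu> h (rep_L2 F) t"
  unfolding weyl_op_def by (rule rep_abs_L2[OF square_integrable_weyl_fun[OF w square_integrable_rep]])

lemma weyl_op_add:
  assumes w: "weight \<nu> h"
  shows "weyl_op \<nu> h (F + G) = weyl_op \<nu> h F + weyl_op \<nu> h G"
proof -
  note sq = square_integrable_rep square_integrable_weyl_fun[OF w] square_integrable_add
  have "F + G = abs_L2 (\<lambda>t. rep_L2 F t + rep_L2 G t)"
    using abs_L2_add[OF square_integrable_rep square_integrable_rep, of F G] by (simp add: abs_rep_L2)
  then have "weyl_op \<nu> h (F + G) = abs_L2 (weyl_fun \<nu> h (\<lambda>t. rep_L2 F t + rep_L2 G t))"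
    by (simp add: weyl_op_abs_L2[OF w square_integrable_add[OF square_integrable_rep square_integrable_rep]])
  also have "\<dots> = abs_L2 (\<lambda>t. weyl_fun \<nu> h (rep_L2 F) t + weyl_fun \<nu> h (rep_L2 G) t)"
    by (intro abs_L2_eq weyl_fun_add[OF w] sq)
  also have "\<dots> = weyl_op \<nu> h F + weyl_op \<nu> h G"
    unfolding weyl_op_def by (intro abs_L2_add[symmetric] sq)
  finally show ?thesis .
qed

lemma weyl_op_scaleC:
  assumes w: "weight \<nu> h"
  shows "weyl_op \<nu> h (scaleC_L2 c F) = scaleC_L2 c (weyl_op \<nu> h F)"
proof -
  have "scaleC_L2 c F = abs_L2 (\<lambda>t. c * rep_L2 F t)"
    using abs_L2_scaleC[OF square_integrable_rep, of c F] by (simp add: abs_rep_L2)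
  then have "weyl_op \<nu> h (scaleC_L2 c F) = abs_L2 (weyl_fun \<nu> h (\<lambda>t. c * rep_L2 F t))"
    by (simp add: weyl_op_abs_L2[OF w square_integrable_mult[OF square_integrable_rep]])
  also have "weyl_fun \<nu> h (\<lambda>t. c * rep_L2 F t) = (\<lambda>t. c * weyl_fun \<nu> h (rep_L2 F) t)"
    by (rule ext) (rule weyl_fun_mult[OF w])
  also have "abs_L2 \<dots> = scaleC_L2 c (weyl_op \<nu> h F)"
    unfolding weyl_op_def
    by (rule abs_L2_scaleC[symmetric, OF square_integrable_weyl_fun[OF w square_integrable_rep]])
  finally show ?thesis .
qed

lemma bounded_linear_weyl_op:
  assumes w: "weight \<nu> h"
  shows "bounded_linear (weyl_op \<nu> h)"
proof (rule bounded_linear_intro[where K = "measure \<nu> UNIV"])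
  interpret finite_measure \<nu> by (rule weightD[OF w])
  fix F G and r :: real
  show "weyl_op \<nu> h (F + G) = weyl_op \<nu> h F + weyl_op \<nu> h G" by (rule weyl_op_add[OF w])
  show "weyl_op \<nu> h (r *\<^sub>R F) = r *\<^sub>R weyl_op \<nu> h F"
    unfolding scaleR_L2_eq_scaleC by (rule weyl_op_scaleC[OF w])
  have "ennreal ((norm (weyl_op \<nu> h F))\<^sup>2) = sqnorm (weyl_fun \<nu> h (rep_L2 F))"
    unfolding weyl_op_def by (rule norm_abs_L2[OF square_integrable_weyl_fun[OF w square_integrable_rep]])
  also have "\<dots> \<le> (emeasure \<nu> UNIV)\<^sup>2 * sqnorm (rep_L2 F)"
    by (rule sqnorm_weyl_fun_le[OF w square_integrableD[OF square_integrable_rep]])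
  also have "\<dots> = ennreal ((measure \<nu> UNIV * norm F)\<^sup>2)"
    by (simp add: emeasure_eq_measure norm_L2_rep[symmetric] ennreal_power ennreal_mult power_mult_distrib)
  finally have "(norm (weyl_op \<nu> h F))\<^sup>2 \<le> (measure \<nu> UNIV * norm F)\<^sup>2"
    by (subst (asm) ennreal_le_iff) auto
  then show "norm (weyl_op \<nu> h F) \<le> norm F * measure \<nu> UNIV"
    by (subst mult.commute) (rule power2_le_imp_le, simp_all)
qed

lemma weyl_op_adjoint:
  assumes w: "weight \<nu> h"
  shows "weyl_op \<nu> h F \<bullet> G = F \<bullet> weyl_op (reflect \<nu>) (\<lambda>z. cnj (h (- z))) G"
proof -
  note sq = square_integrable_rep square_integrable_weyl_fun[OF w] square_integrable_weyl_fun[OF weight_reflect[OF w]]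
  have "weyl_op \<nu> h F \<bullet> G = abs_L2 (weyl_fun \<nu> h (rep_L2 F)) \<bullet> abs_L2 (rep_L2 G)"
    by (simp add: weyl_op_def abs_rep_L2)
  also have "\<dots> = (LINT t|lborel. weyl_fun \<nu> h (rep_L2 F) t \<bullet> rep_L2 G t)" by (intro inner_abs_L2 sq)
  also have "\<dots> = (LINT t|lborel. rep_L2 F t \<bullet> weyl_fun (reflect \<nu>) (\<lambda>z. cnj (h (- z))) (rep_L2 G) t)"
    by (intro weyl_fun_adjoint[OF w] sq)
  also have "\<dots> = abs_L2 (rep_L2 F) \<bullet> abs_L2 (weyl_fun (reflect \<nu>) (\<lambda>z. cnj (h (- z))) (rep_L2 G))"
    by (intro inner_abs_L2[symmetric] sq)
  also have "\<dots> = F \<bullet> weyl_op (reflect \<nu>) (\<lambda>z. cnj (h (- z))) G"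
    by (simp add: weyl_op_def abs_rep_L2)
  finally show ?thesis .
qed

lemma weyl_op_compose:
  assumes w1: "weight \<nu>1 h1" and w2: "weight \<nu>2 h2"
  obtains \<nu> h where "weight \<nu> h" "absolutely_continuous (conv \<nu>1 \<nu>2) \<nu>"
    "\<And>F. weyl_op \<nu>1 h1 (weyl_op \<nu>2 h2 F) = weyl_op \<nu> h F"
proof -
  obtain \<nu> h where \<nu>: "weight \<nu> h" "absolutely_continuous (conv \<nu>1 \<nu>2) \<nu>"
    "\<And>f. square_integrable f \<Longrightarrow> AE t in lborel. weyl_fun \<nu>1 h1 (weyl_fun \<nu>2 h2 f) t = weyl_fun \<nu> h f t"
    using weyl_fun_compose[OF w1 w2] by metis
  have "weyl_op \<nu>1 h1 (weyl_op \<nu>2 h2 F) = weyl_op \<nu> h F" for F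
    unfolding weyl_op_def[of \<nu>2] weyl_op_abs_L2[OF w1 square_integrable_weyl_fun[OF w2 square_integrable_rep]]
    unfolding weyl_op_def
    by (intro abs_L2_eq square_integrable_weyl_fun[OF w1] square_integrable_weyl_fun[OF w2] square_integrable_weyl_fun[OF \<nu>(1)]
        \<nu>(3) square_integrable_rep)
  with \<nu> that show ?thesis by blast
qed

section \<open>Compactness for absolutely continuous measures\<close>

definition unit_ball_L2 :: "('a::euclidean_space \<Rightarrow> complex) set"
  where "unit_ball_L2 = {f. square_integrable f \<and> sqnorm f \<le> 1}"

lemma unit_ball_L2D: "f \<in> unit_ball_L2 \<Longrightarrow> f \<in> borel_measurable borel" "f \<in> unit_ball_L2 \<Longrightarrow> square_integrable f"
    "f \<in> unit_ball_L2 \<Longrightarrow> sqnorm f \<le> 1"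
  by (auto simp: unit_ball_L2_def square_integrable_def)

text \<open>Total boundedness of the image of the unit ball, with a finite partition into pieces of small
  diameter given by a labelling.\<close>

definition precompact_op :: "(('a::euclidean_space \<Rightarrow> complex) \<Rightarrow> 'a \<Rightarrow> complex) \<Rightarrow> bool"
  where "precompact_op T \<longleftrightarrow> (\<forall>f\<in>unit_ball_L2. T f \<in> borel_measurable borel) \<and>
    (\<forall>\<epsilon>>0. \<exists>l :: ('a \<Rightarrow> complex) \<Rightarrow> nat. finite (l ` unit_ball_L2) \<and>
      (\<forall>f\<in>unit_ball_L2. \<forall>g\<in>unit_ball_L2. l f = l g \<longrightarrow> sqnorm (\<lambda>t. T f t - T g t) \<le> ennreal \<epsilon>))"

lemma precompact_opD:
  assumes "precompact_op T"
  shows "f \<in> unit_ball_L2 \<Longrightarrow> T f \<in> borel_measurable borel"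
    and "\<epsilon> > 0 \<Longrightarrow> \<exists>l :: ('a::euclidean_space \<Rightarrow> complex) \<Rightarrow> nat. finite (l ` unit_ball_L2) \<and>
      (\<forall>f\<in>unit_ball_L2. \<forall>g\<in>unit_ball_L2. l f = l g \<longrightarrow> sqnorm (\<lambda>t. T f t - T g t) \<le> ennreal \<epsilon>)"
  using assms unfolding precompact_op_def by blast+

lemma sqnorm_add_le_ennreal:
  assumes "f \<in> borel_measurable borel" "g \<in> borel_measurable borel"
    and "sqnorm f \<le> ennreal a" "sqnorm g \<le> ennreal b" "0 \<le> a" "0 \<le> b"
  shows "sqnorm (\<lambda>t. f t + g t) \<le> ennreal (2 * a + 2 * b)"
proof -
  have "sqnorm (\<lambda>t. f t + g t) \<le> 2 * sqnorm f + 2 * sqnorm g" by (rule sqnorm_add_le[OF assms(1,2)])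
  also have "\<dots> \<le> 2 * ennreal a + 2 * ennreal b"
    by (intro add_mono mult_left_mono assms) auto
  also have "\<dots> = ennreal (2 * a + 2 * b)"
    using assms by (simp add: ennreal_plus ennreal_mult)
  finally show ?thesis .
qed

lemma precompact_op_lincomb:
  assumes S: "precompact_op S" and T: "precompact_op T"
  shows "precompact_op (\<lambda>f t. S f t + c * T f t)"
  unfolding precompact_op_def
proof (intro conjI ballI allI impI)
  fix f :: "'a \<Rightarrow> complex" assume f: "f \<in> unit_ball_L2"
  note [measurable] = precompact_opD(1)[OF S f] precompact_opD(1)[OF T f]
  show "(\<lambda>t. S f t + c * T f t) \<in> borel_measurable borel" by measurable
next
  fix \<epsilon> :: real assume \<epsilon>: "\<epsilon> > 0"
  \<comment> \<open>Each summand of a sum costs a factor 2 in \<open>sqnorm_add_le\<close>. With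
    both squared errors at most \<open>\<epsilon> / 4\<close> the total is \<epsilon>; the summand 1
    covers \<open>c = 0\<close>.\<close>
  define \<eta> where "\<eta> = \<epsilon> / (4 * ((cmod c)\<^sup>2 + 1))"
  have c0: "(cmod c)\<^sup>2 + 1 > 0" by (simp add: add_nonneg_pos)
  then have \<eta>: "\<eta> > 0" using \<epsilon> by (simp add: \<eta>_def)
  have \<eta>c: "(cmod c)\<^sup>2 * \<eta> \<le> \<epsilon> / 4"
  proof -
    have "(cmod c)\<^sup>2 * \<eta> \<le> ((cmod c)\<^sup>2 + 1) * \<eta>" using \<eta> by (intro mult_right_mono) auto
    also have "\<dots> = \<epsilon> / 4" unfolding \<eta>_def using c0 by (simp add: divide_simps)
    finally show ?thesis .
  qed
  obtain k where k: "finite (k ` unit_ball_L2)" "\<And>f g :: 'a \<Rightarrow> complex. f \<in> unit_ball_L2 \<Longrightarrow> g \<in> unit_ball_L2 \<Longrightarrow>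
      k f = (k g :: nat) \<Longrightarrow> sqnorm (\<lambda>t. S f t - S g t) \<le> ennreal (\<epsilon> / 4)"
    using precompact_opD(2)[OF S, of "\<epsilon> / 4"] \<epsilon> by auto
  obtain l where l: "finite (l ` unit_ball_L2)" "\<And>f g :: 'a \<Rightarrow> complex. f \<in> unit_ball_L2 \<Longrightarrow> g \<in> unit_ball_L2 \<Longrightarrow>
      l f = (l g :: nat) \<Longrightarrow> sqnorm (\<lambda>t. T f t - T g t) \<le> ennreal \<eta>"
    using precompact_opD(2)[OF T, of \<eta>] \<eta> by auto
  show "\<exists>l :: ('a \<Rightarrow> complex) \<Rightarrow> nat. finite (l ` unit_ball_L2) \<and> (\<forall>f\<in>unit_ball_L2. \<forall>g\<in>unit_ball_L2. l f = l g \<longrightarrow>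
      sqnorm (\<lambda>t. S f t + c * T f t - (S g t + c * T g t)) \<le> ennreal \<epsilon>)"
  proof (intro exI[of _ "\<lambda>f. prod_encode (k f, l f)"] conjI ballI impI)
    have "(\<lambda>f. prod_encode (k f, l f)) ` unit_ball_L2 \<subseteq> prod_encode ` (k ` unit_ball_L2 \<times> l ` unit_ball_L2)" by auto
    then show "finite ((\<lambda>f. prod_encode (k f, l f)) ` unit_ball_L2)"
      using k(1) l(1) by (meson finite_SigmaI finite_imageI finite_subset)
    fix f g :: "'a \<Rightarrow> complex" assume f: "f \<in> unit_ball_L2" and g: "g \<in> unit_ball_L2"
      and "prod_encode (k f, l f) = prod_encode (k g, l g)"
    then have eq: "k f = k g" "l f = l g" by auto
    note [measurable] = precompact_opD(1)[OF S f] precompact_opD(1)[OF T f] precompact_opD(1)[OF S g] precompact_opD(1)[OF T g]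
    have "sqnorm (\<lambda>t. c * (T f t - T g t)) = ennreal ((cmod c)\<^sup>2) * sqnorm (\<lambda>t. T f t - T g t)"
      by (rule sqnorm_mult) measurable
    also have "\<dots> \<le> ennreal ((cmod c)\<^sup>2) * ennreal \<eta>"
      by (intro mult_left_mono l(2) f g eq) simp
    also have "\<dots> \<le> ennreal (\<epsilon> / 4)"
      using \<eta>c \<eta> by (simp add: ennreal_leI flip: ennreal_mult)
    finally have "sqnorm (\<lambda>t. (S f t - S g t) + c * (T f t - T g t)) \<le> ennreal (2 * (\<epsilon> / 4) + 2 * (\<epsilon> / 4))"
      using \<epsilon> by (intro sqnorm_add_le_ennreal k(2) f g eq) auto
    then show "sqnorm (\<lambda>t. S f t + c * T f t - (S g t + c * T g t)) \<le> ennreal \<epsilon>"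
      by (simp add: algebra_simps)
  qed
qed

lemma precompact_op_limit:
  assumes Tm: "\<And>f. f \<in> unit_ball_L2 \<Longrightarrow> T f \<in> borel_measurable borel"
    and app: "\<And>\<epsilon>. \<epsilon> > 0 \<Longrightarrow> \<exists>S. precompact_op S \<and> (\<forall>f\<in>unit_ball_L2. sqnorm (\<lambda>t. T f t - S f t) \<le> ennreal \<epsilon>)"
  shows "precompact_op T"
  unfolding precompact_op_def
proof (intro conjI ballI allI impI)
  fix \<epsilon> :: real assume \<epsilon>: "\<epsilon> > 0"
  \<comment> \<open>Three errors are added in two steps, each doubling:
    \<open>2 * \<eta> + 2 * (2 * \<eta> + 2 * \<eta>)\<close> is \<open>10 * \<eta>\<close>.\<close>
  define \<eta> where "\<eta> = \<epsilon> / 10"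
  have \<eta>: "\<eta> > 0" using \<epsilon> by (simp add: \<eta>_def)
  obtain S where S: "precompact_op S" "\<And>f. f \<in> unit_ball_L2 \<Longrightarrow> sqnorm (\<lambda>t. T f t - S f t) \<le> ennreal \<eta>"
    using app[OF \<eta>] by blast
  obtain l where l: "finite (l ` unit_ball_L2)" "\<And>f g :: 'a \<Rightarrow> complex. f \<in> unit_ball_L2 \<Longrightarrow> g \<in> unit_ball_L2 \<Longrightarrow>
      l f = (l g :: nat) \<Longrightarrow> sqnorm (\<lambda>t. S f t - S g t) \<le> ennreal \<eta>"
    using precompact_opD(2)[OF S(1) \<eta>] by auto
  show "\<exists>l :: ('a \<Rightarrow> complex) \<Rightarrow> nat. finite (l ` unit_ball_L2) \<and> (\<forall>f\<in>unit_ball_L2. \<forall>g\<in>unit_ball_L2. l f = l g \<longrightarrow>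
      sqnorm (\<lambda>t. T f t - T g t) \<le> ennreal \<epsilon>)"
  proof (intro exI[of _ l] conjI ballI impI l(1))
    fix f g :: "'a \<Rightarrow> complex" assume f: "f \<in> unit_ball_L2" and g: "g \<in> unit_ball_L2" and eq: "l f = l g"
    note [measurable] = Tm[OF f] Tm[OF g] precompact_opD(1)[OF S(1) f] precompact_opD(1)[OF S(1) g]
    have m: "sqnorm (\<lambda>t. S g t - T g t) \<le> ennreal \<eta>"
      using S(2)[OF g] sqnorm_mult[of "\<lambda>t. T g t - S g t" "-1"] by simp
    have "sqnorm (\<lambda>t. (S f t - S g t) + (S g t - T g t)) \<le> ennreal (2 * \<eta> + 2 * \<eta>)"
      using \<eta> by (intro sqnorm_add_le_ennreal l(2) m f g eq) auto
    then have "sqnorm (\<lambda>t. S f t - T g t) \<le> ennreal (4 * \<eta>)" by simp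
    then have "sqnorm (\<lambda>t. (T f t - S f t) + (S f t - T g t)) \<le> ennreal (2 * \<eta> + 2 * (4 * \<eta>))"
      using \<eta> by (intro sqnorm_add_le_ennreal S(2) f) auto
    then show "sqnorm (\<lambda>t. T f t - T g t) \<le> ennreal \<epsilon>" by (simp add: \<eta>_def)
  qed
qed (rule Tm)

lemma precompact_op_cong_AE:
  assumes S: "precompact_op S" and Tm: "\<And>f. f \<in> unit_ball_L2 \<Longrightarrow> T f \<in> borel_measurable borel"
    and eq: "\<And>f. f \<in> unit_ball_L2 \<Longrightarrow> AE t in lborel. T f t = S f t"
  shows "precompact_op T"
proof (rule precompact_op_limit[OF Tm])
  fix \<epsilon> :: real assume "\<epsilon> > 0"
  have "sqnorm (\<lambda>t. T f t - S f t) \<le> ennreal \<epsilon>" if f: "f \<in> unit_ball_L2" for f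
  proof -
    note [measurable] = Tm[OF f] precompact_opD(1)[OF S f]
    have "AE t in lborel. T f t - S f t = 0" using eq[OF f] by eventually_elim simp
    then show ?thesis by (subst sqnorm_zero_iff[THEN iffD2]) auto
  qed
  with S show "\<exists>S. precompact_op S \<and> (\<forall>f\<in>unit_ball_L2. sqnorm (\<lambda>t. T f t - S f t) \<le> ennreal \<epsilon>)" by blast
qed

lemma integrable_product_L2:
  assumes "square_integrable b" "square_integrable f"
  shows "integrable lborel (\<lambda>t. b t * f t)" "cmod (LINT t|lborel. b t * f t) \<le> enn2real (sqnorm b + sqnorm f)"
proof -
  have [measurable]: "b \<in> borel_measurable borel" "f \<in> borel_measurable borel"
    using assms by (auto simp: square_integrable_def)
  have bd: "cmod (x * y) \<le> (cmod x)\<^sup>2 + (cmod y)\<^sup>2" for x y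
    using sum_squares_bound[of "cmod x" "cmod y"] mult_nonneg_nonneg[OF norm_ge_zero[of x] norm_ge_zero[of y]]
    unfolding norm_mult by linarith
  have "(\<integral>\<^sup>+t. ennreal (cmod (b t * f t)) \<partial>lborel) \<le> (\<integral>\<^sup>+t. ennreal ((cmod (b t))\<^sup>2) + ennreal ((cmod (f t))\<^sup>2) \<partial>lborel)"
    using bd by (intro nn_integral_mono) (simp add: ennreal_leI flip: ennreal_plus)
  also have "\<dots> = sqnorm b + sqnorm f" by (simp add: nn_integral_add sqnorm_def)
  finally have le: "(\<integral>\<^sup>+t. ennreal (cmod (b t * f t)) \<partial>lborel) \<le> sqnorm b + sqnorm f" .
  have fin: "sqnorm b + sqnorm f < \<infinity>" using assms by (simp add: square_integrable_iff_sqnorm)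
  show "integrable lborel (\<lambda>t. b t * f t)"
    using le_less_trans[OF le fin] by (simp add: integrable_iff_bounded)
  have "ennreal (cmod (LINT t|lborel. b t * f t)) \<le> sqnorm b + sqnorm f"
    using order_trans[OF norm_integral_le_nn_integral le] .
  then show "cmod (LINT t|lborel. b t * f t) \<le> enn2real (sqnorm b + sqnorm f)"
    using fin by (metis enn2real_mono enn2real_ennreal infinity_ennreal_def norm_ge_zero)
qed

lemma precompact_op_rank_one:
  assumes a: "square_integrable a" and b: "square_integrable b"
  shows "precompact_op (\<lambda>f t. a t * (LINT s|lborel. b s * f s))"
  unfolding precompact_op_def
proof (intro conjI ballI allI impI)
  have [measurable]: "a \<in> borel_measurable borel" using a by (simp add: square_integrable_def)
  show "(\<lambda>t. a t * (LINT s|lborel. b s * f s)) \<in> borel_measurable borel" for f by measurable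
  fix \<epsilon> :: real assume \<epsilon>: "\<epsilon> > 0"
  define v where "v f = (LINT s|lborel. b s * f s)" for f
  define A where "A = enn2real (sqnorm a)"
  have A: "sqnorm a = ennreal A" "0 \<le> A"
    using a by (auto simp: A_def square_integrable_iff_sqnorm)
  define C where "C = enn2real (sqnorm b + 1)"
  have vC: "cmod (v f) \<le> C" if "f \<in> unit_ball_L2" for f
  proof -
    have "cmod (v f) \<le> enn2real (sqnorm b + sqnorm f)"
      unfolding v_def by (rule integrable_product_L2[OF b unit_ball_L2D(2)[OF that]])
    also have "\<dots> \<le> C"
      unfolding C_def using b unit_ball_L2D(3)[OF that]
      by (intro enn2real_mono add_left_mono) (auto simp: square_integrable_iff_sqnorm)
    finally show ?thesis .
  qed
  \<comment> \<open>The coefficient \<open>v f\<close> ranges over a bounded part of the plane and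
    is labelled by its grid cell of side \<delta>. Two coefficients in one cell differ in squared
    modulus by at most twice the square of \<delta>, which is then multiplied by
    \<open>A\<close>.\<close>
  define \<delta> where "\<delta> = sqrt (\<epsilon> / (2 * (A + 1)))"
  have \<delta>: "\<delta> > 0" "2 * \<delta>\<^sup>2 * A \<le> \<epsilon>"
    using \<epsilon> A(2) by (auto simp: \<delta>_def field_simps)
  define l where "l f = to_nat (\<lfloor>Re (v f) / \<delta>\<rfloor>, \<lfloor>Im (v f) / \<delta>\<rfloor>)" for f
  show "\<exists>l :: ('a \<Rightarrow> complex) \<Rightarrow> nat. finite (l ` unit_ball_L2) \<and> (\<forall>f\<in>unit_ball_L2. \<forall>g\<in>unit_ball_L2. l f = l g \<longrightarrow>
      sqnorm (\<lambda>t. a t * (LINT s|lborel. b s * f s) - a t * (LINT s|lborel. b s * g s)) \<le> ennreal \<epsilon>)"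
  proof (intro exI[of _ l] conjI ballI impI)
    have fl: "\<lfloor>x / \<delta>\<rfloor> \<in> {\<lfloor>- C / \<delta>\<rfloor>..\<lfloor>C / \<delta>\<rfloor>}" if "\<bar>x\<bar> \<le> C" for x
      using that \<delta>(1) divide_right_mono[of "- C" x \<delta>] divide_right_mono[of x C \<delta>]
      by (auto intro!: floor_mono)
    have "l ` unit_ball_L2 \<subseteq> to_nat ` ({\<lfloor>- C / \<delta>\<rfloor>..\<lfloor>C / \<delta>\<rfloor>} \<times> {\<lfloor>- C / \<delta>\<rfloor>..\<lfloor>C / \<delta>\<rfloor>})"
    proof
      fix n assume "n \<in> l ` unit_ball_L2"
      then obtain f where f: "f \<in> unit_ball_L2" "n = l f" by auto
      have "\<bar>Re (v f)\<bar> \<le> C" "\<bar>Im (v f)\<bar> \<le> C"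
        using vC[OF f(1)] abs_Re_le_cmod[of "v f"] abs_Im_le_cmod[of "v f"] by linarith+
      then show "n \<in> to_nat ` ({\<lfloor>- C / \<delta>\<rfloor>..\<lfloor>C / \<delta>\<rfloor>} \<times> {\<lfloor>- C / \<delta>\<rfloor>..\<lfloor>C / \<delta>\<rfloor>})"
        unfolding f(2) l_def by (intro imageI SigmaI fl)
    qed
    then show "finite (l ` unit_ball_L2)" by (rule finite_subset) simp
    fix f g :: "'a \<Rightarrow> complex" assume f: "f \<in> unit_ball_L2" and g: "g \<in> unit_ball_L2" and "l f = l g"
    then have eq: "\<lfloor>Re (v f) / \<delta>\<rfloor> = \<lfloor>Re (v g) / \<delta>\<rfloor>" "\<lfloor>Im (v f) / \<delta>\<rfloor> = \<lfloor>Im (v g) / \<delta>\<rfloor>"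
      by (auto simp: l_def)
    have close: "\<bar>x - y\<bar> \<le> \<delta>" if "\<lfloor>x / \<delta>\<rfloor> = \<lfloor>y / \<delta>\<rfloor>" for x y
    proof -
      have "\<bar>x / \<delta> - y / \<delta>\<bar> \<le> 1" using that by linarith
      then have "\<bar>x - y\<bar> / \<delta> \<le> 1" using \<delta>(1) by (simp flip: diff_divide_distrib)
      then show ?thesis using \<delta>(1) by (simp add: field_simps)
    qed
    have "(cmod (v f - v g))\<^sup>2 = (Re (v f) - Re (v g))\<^sup>2 + (Im (v f) - Im (v g))\<^sup>2"
      by (simp add: cmod_power2)
    also have "\<dots> \<le> \<delta>\<^sup>2 + \<delta>\<^sup>2"
      using close[OF eq(1)] close[OF eq(2)] \<delta>(1) by (intro add_mono) (auto simp: abs_le_square_iff[symmetric])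
    finally have sq: "(cmod (v f - v g))\<^sup>2 \<le> 2 * \<delta>\<^sup>2" by simp
    have "sqnorm (\<lambda>t. (v f - v g) * a t) = ennreal ((cmod (v f - v g))\<^sup>2) * sqnorm a"
      by (rule sqnorm_mult) measurable
    also have "\<dots> = ennreal ((cmod (v f - v g))\<^sup>2 * A)" using A by (simp add: ennreal_mult)
    also have "\<dots> \<le> ennreal (2 * \<delta>\<^sup>2 * A)" using sq A(2) by (intro ennreal_leI mult_right_mono)
    also have "\<dots> \<le> ennreal \<epsilon>" using \<delta>(2) by (rule ennreal_leI)
    finally show "sqnorm (\<lambda>t. a t * (LINT s|lborel. b s * f s) - a t * (LINT s|lborel. b s * g s)) \<le> ennreal \<epsilon>"
      by (simp add: v_def algebra_simps)
  qed
qed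

text \<open>The bounds are parameters so that a whole sequence can be required to share them, as
  dominated convergence demands in the induction below.\<close>

definition bounded_borel :: "('a::euclidean_space \<Rightarrow> complex) \<Rightarrow> real \<Rightarrow> real \<Rightarrow> bool"
  where "bounded_borel f C r \<longleftrightarrow> f \<in> borel_measurable borel \<and> (\<forall>z. cmod (f z) \<le> C) \<and> (\<forall>z. f z \<noteq> 0 \<longrightarrow> norm z \<le> r)"

lemma bounded_borel_lincomb:
  assumes "bounded_borel f C r" "bounded_borel g D s"
  shows "bounded_borel (\<lambda>z. f z + c * g z) (C + cmod c * D) (max r s)"
proof -
  have "cmod (f z + c * g z) \<le> C + cmod c * D" for z
  proof -
    have "cmod (f z + c * g z) \<le> cmod (f z) + cmod c * cmod (g z)"
      using norm_triangle_ineq[of "f z" "c * g z"] by (simp add: norm_mult)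
    also have "\<dots> \<le> C + cmod c * D"
      using assms by (intro add_mono mult_left_mono) (auto simp: bounded_borel_def)
    finally show ?thesis .
  qed
  moreover have "norm z \<le> max r s" if "f z + c * g z \<noteq> 0" for z
  proof -
    have "f z \<noteq> 0 \<or> g z \<noteq> 0" using that by auto
    then show ?thesis using assms unfolding bounded_borel_def by (meson le_max_iff_disj)
  qed
  ultimately show ?thesis using assms unfolding bounded_borel_def by auto
qed

section \<open>Monotone class induction for bounded Borel functions of bounded support\<close>

context
  fixes P :: "('z::euclidean_space \<Rightarrow> complex) \<Rightarrow> bool"
  assumes box: "\<And>a b. P (indicator (box a b))"
    and lin: "\<And>f g c C r D s. bounded_borel f C r \<Longrightarrow> bounded_borel g D s \<Longrightarrow> P f \<Longrightarrow> P g \<Longrightarrow> P (\<lambda>z. f z + c * g z)"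
    and lim: "\<And>u f C r. (\<And>i::nat. bounded_borel (u i) C r) \<Longrightarrow> bounded_borel f C r \<Longrightarrow>
      (\<And>z. (\<lambda>i. u i z) \<longlonglongrightarrow> f z) \<Longrightarrow> (\<And>i. P (u i)) \<Longrightarrow> P f"
begin

lemma bounded_borel_induct_zero: "P (\<lambda>z. 0)"
proof -
  have "(indicator (box 0 0 :: 'z set) :: 'z \<Rightarrow> complex) = (\<lambda>z. 0)" by auto
  then show ?thesis using box[of 0 0] by simp
qed

text \<open>Boxes are stable under intersection and generate the Borel sets, so the pi-lambda
  theorem applies. All sets are cut with one large box \<open>Q\<close>, since the closure
  properties of \<open>P\<close> only concern bounded support.\<close>

lemma bounded_borel_induct_set:
  assumes A: "A \<in> sets borel" and r: "A \<subseteq> cball 0 r"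
  shows "P (indicator A)"
proof -
  define Q :: "'z set" where "Q = box (- ((r + 1) *\<^sub>R One)) ((r + 1) *\<^sub>R One)"
  have Qb: "bounded Q" "Q \<in> sets borel" by (auto simp: Q_def bounded_box)
  have AQ: "A \<subseteq> Q"
  proof
    fix z assume "z \<in> A"
    then have "norm z \<le> r" using r by auto
    then have "\<bar>z \<bullet> b\<bar> < r + 1" if "b \<in> Basis" for b
      using Basis_le_norm[OF that, of z] by linarith
    then show "z \<in> Q" by (auto simp: Q_def box_def abs_less_iff inner_sum_left_Basis) (smt (verit))+
  qed
  obtain R where R: "\<And>z. z \<in> Q \<Longrightarrow> norm z \<le> R" using Qb(1) unfolding bounded_iff by blast
  have bb: "bounded_borel (indicator B) 1 R" if "B \<in> sets borel" "B \<subseteq> Q" for B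
    using that R by (auto simp: bounded_borel_def indicator_def borel_measurable_indicator split: if_splits)
  let ?G = "range (\<lambda>(a, b). box a b :: 'z set)"
  have sig: "sets borel = sigma_sets UNIV ?G"
    by (subst borel_eq_box) (simp add: sets_measure_of)
  have "Int_stable ?G" by (auto simp: Int_stable_def box_Int_box)
  then have "P (indicator (A \<inter> Q))"
  proof (rule sigma_sets_induct_disjoint[where \<Omega> = UNIV and A = A and P = "\<lambda>A. P (indicator (A \<inter> Q))"])
    show "A \<in> sigma_sets UNIV ?G" using A sig by simp
    show "P (indicator (B \<inter> Q))" if "B \<in> ?G" for B
      using that box by (auto simp: Q_def box_Int_box)
    show "P (indicator ({} \<inter> Q))" using box[of 0 0] by simp
    fix B assume "B \<in> sigma_sets UNIV ?G" and PB: "P (indicator (B \<inter> Q))"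
    then have B: "B \<in> sets borel" using sig by simp
    have "P (\<lambda>z. indicator Q z + (-1) * indicator (B \<inter> Q) z)"
      by (rule lin[OF bb bb _ PB]) (use B Qb box in \<open>auto simp: Q_def\<close>)
    also have "(\<lambda>z. indicator Q z + (-1) * indicator (B \<inter> Q) z) = (indicator ((UNIV - B) \<inter> Q) :: 'z \<Rightarrow> complex)"
      by (auto simp: indicator_def)
    finally show "P (indicator ((UNIV - B) \<inter> Q))" .
  next
    fix B :: "nat \<Rightarrow> 'z set"
    assume dis: "disjoint_family B" and Bs: "range B \<subseteq> sigma_sets UNIV ?G" and PB: "\<And>i. P (indicator (B i \<inter> Q))"
    have B: "B i \<in> sets borel" for i using Bs sig by auto
    have un: "P (indicator ((\<Union>i<n. B i) \<inter> Q))" for n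
    proof (induction n)
      case 0
      show ?case using bounded_borel_induct_zero by (simp add: indicator_def[abs_def])
    next
      case (Suc n)
      have "P (\<lambda>z. indicator ((\<Union>i<n. B i) \<inter> Q) z + 1 * indicator (B n \<inter> Q) z)"
        by (rule lin[OF bb bb Suc PB]) (use B Qb in auto)
      also have "(\<lambda>z. indicator ((\<Union>i<n. B i) \<inter> Q) z + 1 * indicator (B n \<inter> Q) z) = (indicator ((\<Union>i<Suc n. B i) \<inter> Q) :: 'z \<Rightarrow> complex)"
      proof
        fix z
        have "z \<notin> B i" if "i < n" "z \<in> B n" for i
          using disjoint_family_onD[OF dis, of i n] that by auto
        then show "indicator ((\<Union>i<n. B i) \<inter> Q) z + 1 * indicator (B n \<inter> Q) z = (indicator ((\<Union>i<Suc n. B i) \<inter> Q) z :: complex)"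
          by (auto simp: indicator_def less_Suc_eq)
      qed
      finally show ?case .
    qed
    show "P (indicator (\<Union> (range B) \<inter> Q))"
    proof (rule lim[where u = "\<lambda>n. indicator ((\<Union>i<n. B i) \<inter> Q)" and C = 1 and r = R, OF bb bb _ un])
      fix z
      show "(\<lambda>n. indicator ((\<Union>i<n. B i) \<inter> Q) z) \<longlonglongrightarrow> (indicator (\<Union> (range B) \<inter> Q) z :: complex)"
      proof (cases "z \<in> \<Union> (range B) \<inter> Q")
        case True
        then obtain k where "z \<in> B k" by auto
        then have "\<forall>\<^sub>F n in sequentially. indicator ((\<Union>i<n. B i) \<inter> Q) z = (indicator (\<Union> (range B) \<inter> Q) z :: complex)"
          using True by (intro eventually_sequentiallyI[of "Suc k"]) (auto simp: indicator_def)
        then show ?thesis by (rule tendsto_eventually)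
      next
        case False
        then have "(indicator ((\<Union>i<n. B i) \<inter> Q) z :: complex) = indicator (\<Union> (range B) \<inter> Q) z" for n
          by (auto simp: indicator_def)
        then show ?thesis by simp
      qed
    qed (use B Qb in auto)
  qed auto
  then show ?thesis using AQ by (simp add: Int_absorb2)
qed

lemma bounded_borel_induct:
  assumes f: "bounded_borel f C r"
  shows "P f"
proof -
  have fm: "f \<in> borel_measurable borel" using f by (simp add: bounded_borel_def)
  obtain u where u: "\<And>i. simple_function borel (u i)" "\<And>z. (\<lambda>i. u i z) \<longlonglongrightarrow> f z"
    "\<And>i z. dist (u i z) 0 \<le> 2 * dist (f z) 0"
    using borel_measurable_implies_sequence_metric[OF fm, of 0] by auto
  have um: "u i \<in> borel_measurable borel" for i using u(1) by (rule borel_measurable_simple_function)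
  \<comment> \<open>The approximating simple functions are bounded by twice the modulus of
    \<open>f\<close>, so they also vanish wherever \<open>f\<close> does.\<close>
  have ub: "bounded_borel (u i) (2 * C) r" for i
    unfolding bounded_borel_def
  proof (intro conjI allI impI um)
    fix z
    have "cmod (u i z) \<le> 2 * cmod (f z)" using u(3)[of i z] by simp
    also have "\<dots> \<le> 2 * C" using f by (simp add: bounded_borel_def)
    finally show "cmod (u i z) \<le> 2 * C" .
    assume "u i z \<noteq> 0"
    then have "f z \<noteq> 0" using u(3)[of i z] by auto
    then show "norm z \<le> r" using f by (auto simp: bounded_borel_def)
  qed
  have C0: "0 \<le> C" using f norm_ge_zero order_trans unfolding bounded_borel_def by blast
  have Pu: "P (u i)" for i
  proof -
    have fin: "finite (u i ` UNIV - {0})" using u(1)[of i] by (auto simp: simple_function_def)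
    have pre: "u i -` {y} \<in> sets borel" for y
      using measurable_sets[OF um, of "{y}" i] by simp
    have sub: "u i -` {y} \<subseteq> cball 0 r" if "y \<noteq> 0" for y
      using ub[of i] that by (auto simp: bounded_borel_def)
    have "P (\<lambda>z. \<Sum>y\<in>Y. y * indicator (u i -` {y}) z) \<and> (\<exists>D s. bounded_borel (\<lambda>z. \<Sum>y\<in>Y. y * indicator (u i -` {y}) z) D s)"
      if "finite Y" "0 \<notin> Y" for Y
      using that
    proof (induction Y rule: finite_induct)
      case empty
      show ?case using bounded_borel_induct_zero by (auto simp: bounded_borel_def intro!: exI[of _ 0])
    next
      case (insert y Y)
      then obtain D s where D: "bounded_borel (\<lambda>z. \<Sum>y\<in>Y. y * indicator (u i -` {y}) z) D s" by auto
      have y: "y \<noteq> 0" using insert.prems by auto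
      have Py: "P (indicator (u i -` {y}))" by (rule bounded_borel_induct_set[OF pre sub[OF y]])
      have bY: "bounded_borel (indicator (u i -` {y})) 1 r"
        using pre[of y] sub[OF y] by (auto simp: bounded_borel_def indicator_def borel_measurable_indicator split: if_splits)
      have e: "(\<lambda>z. \<Sum>y\<in>insert y Y. y * indicator (u i -` {y}) z) = (\<lambda>z. (\<Sum>y\<in>Y. y * indicator (u i -` {y}) z) + y * indicator (u i -` {y}) z)"
        by (intro ext, subst sum.insert[OF insert.hyps], rule add.commute)
      show ?case
        unfolding e using lin[OF D bY _ Py, of y] bounded_borel_lincomb[OF D bY, of y] insert by auto
    qed
    from this[OF fin] have "P (\<lambda>z. \<Sum>y\<in>u i ` UNIV - {0}. y * indicator (u i -` {y}) z)" by simp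
    also have "(\<lambda>z. \<Sum>y\<in>u i ` UNIV - {0}. y * indicator (u i -` {y}) z) = u i"
    proof
      fix z
      have "(\<Sum>y\<in>u i ` UNIV - {0}. y * indicator (u i -` {y}) z) = (\<Sum>y\<in>u i ` UNIV - {0}. if y = u i z then y else 0)"
        by (intro sum.cong) (auto simp: indicator_def)
      also have "\<dots> = u i z" using fin by (subst sum.delta) auto
      finally show "(\<Sum>y\<in>u i ` UNIV - {0}. y * indicator (u i -` {y}) z) = u i z" .
    qed
    finally show "P (u i)" .
  qed
  have "bounded_borel f (2 * C) r"
    using f C0 by (auto simp: bounded_borel_def intro: order_trans[of _ C])
  then show "P f" by (rule lim[OF ub _ u(2) Pu])
qed

end

section \<open>Integral operators with bounded kernels\<close>

lemma indicator_square_integrable: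
  assumes "A \<in> sets borel" "bounded (A :: 'a::euclidean_space set)"
  shows "square_integrable (indicator A)"
proof -
  have "sqnorm (indicator A) = emeasure lborel A"
  proof -
    have "sqnorm (indicator A) = (\<integral>\<^sup>+t. indicator A t \<partial>lborel)"
      unfolding sqnorm_def by (intro nn_integral_cong) (auto simp: indicator_def)
    then show ?thesis using assms(1) by simp
  qed
  then show ?thesis
    using emeasure_bounded_finite[OF assms(2)] assms(1) by (simp add: square_integrable_iff_sqnorm)
qed

lemma bounded_borel_section:
  fixes k :: "'a::euclidean_space \<times> 'b::euclidean_space \<Rightarrow> complex"
  assumes k: "bounded_borel k C r"
  shows "square_integrable (\<lambda>s. k (t, s))"
proof -
  have [measurable]: "k \<in> borel_measurable borel" using k by (simp add: bounded_borel_def)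
  have m: "(\<lambda>s. k (t, s)) \<in> borel_measurable borel" by measurable
  have C0: "0 \<le> C" using k norm_ge_zero order_trans unfolding bounded_borel_def by blast
  have "sqnorm (\<lambda>s. k (t, s)) \<le> (\<integral>\<^sup>+s. ennreal (C\<^sup>2) * indicator (cball 0 r) s \<partial>(lborel :: 'b measure))"
    unfolding sqnorm_def
  proof (intro nn_integral_mono)
    fix s
    show "ennreal ((cmod (k (t, s)))\<^sup>2) \<le> ennreal (C\<^sup>2) * indicator (cball 0 r) s"
    proof (cases "k (t, s) = 0")
      case False
      then have "norm (t, s) \<le> r" using k by (simp add: bounded_borel_def)
      then have "norm s \<le> r" using norm_snd_le[of s t] by simp
      then show ?thesis using k by (auto simp: bounded_borel_def intro!: ennreal_leI power_mono)
    qed simp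
  qed
  also have "\<dots> < \<infinity>"
    using emeasure_bounded_finite[OF bounded_cball[of "0 :: 'b" r]] by (simp add: nn_integral_cmult_indicator ennreal_mult_less_top)
  finally show ?thesis using m by (simp add: square_integrable_iff_sqnorm)
qed

definition kernel_op :: "('a::euclidean_space \<times> 'a \<Rightarrow> complex) \<Rightarrow> ('a \<Rightarrow> complex) \<Rightarrow> 'a \<Rightarrow> complex"
  where "kernel_op k f t = (LINT s|lborel. k (t, s) * f s)"

lemma kernel_op_measurable:
  assumes [measurable]: "k \<in> borel_measurable borel" "f \<in> borel_measurable borel"
  shows "kernel_op k f \<in> borel_measurable borel"
  unfolding kernel_op_def[abs_def] by (rule lborel.borel_measurable_lebesgue_integral) measurable

text \<open>The Hilbert-Schmidt bound: Cauchy-Schwarz in \<open>s\<close> for each \<open>t\<close>,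
  then integration over \<open>t\<close>.\<close>

lemma sqnorm_kernel_op_le:
  assumes k[measurable]: "k \<in> borel_measurable borel" and f[measurable]: "f \<in> borel_measurable borel"
  shows "sqnorm (kernel_op k f) \<le> (\<integral>\<^sup>+p. ennreal ((cmod (k p))\<^sup>2) \<partial>lborel) * sqnorm f"
proof -
  have "sqnorm (kernel_op k f) \<le> (\<integral>\<^sup>+t. (\<integral>\<^sup>+s. ennreal ((cmod (k (t, s)))\<^sup>2) \<partial>lborel) * sqnorm f \<partial>lborel)"
    unfolding sqnorm_def[of "kernel_op k f"]
  proof (intro nn_integral_mono)
    fix t
    have "ennreal (cmod (kernel_op k f t)) \<le> (\<integral>\<^sup>+s. ennreal (cmod (k (t, s) * f s)) \<partial>lborel)"
      unfolding kernel_op_def by (rule norm_integral_le_nn_integral)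
    also have "\<dots> = (\<integral>\<^sup>+s. ennreal (cmod (k (t, s))) * ennreal (cmod (f s)) \<partial>lborel)"
      by (simp add: norm_mult ennreal_mult)
    finally have "(ennreal (cmod (kernel_op k f t)))\<^sup>2 \<le> (\<integral>\<^sup>+s. ennreal (cmod (k (t, s))) * ennreal (cmod (f s)) \<partial>lborel)\<^sup>2"
      by (rule power_mono) simp
    also have "\<dots> \<le> (\<integral>\<^sup>+s. (ennreal (cmod (k (t, s))))\<^sup>2 \<partial>lborel) * (\<integral>\<^sup>+s. (ennreal (cmod (f s)))\<^sup>2 \<partial>lborel)"
      by (rule Cauchy_Schwarz_nn_integral) measurable
    finally show "ennreal ((cmod (kernel_op k f t))\<^sup>2) \<le> (\<integral>\<^sup>+s. ennreal ((cmod (k (t, s)))\<^sup>2) \<partial>lborel) * sqnorm f"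
      by (simp add: sqnorm_def ennreal_power)
  qed
  also have "\<dots> = (\<integral>\<^sup>+t. (\<integral>\<^sup>+s. ennreal ((cmod (k (t, s)))\<^sup>2) \<partial>lborel) \<partial>lborel) * sqnorm f"
    by (rule nn_integral_multc) measurable
  also have "(\<integral>\<^sup>+t. (\<integral>\<^sup>+s. ennreal ((cmod (k (t, s)))\<^sup>2) \<partial>lborel) \<partial>lborel) = (\<integral>\<^sup>+p. ennreal ((cmod (k p))\<^sup>2) \<partial>(lborel \<Otimes>\<^sub>M lborel))"
    using lborel.nn_integral_fst[of "\<lambda>p. ennreal ((cmod (k p))\<^sup>2)" lborel] by (simp add: lborel_prod)
  finally show ?thesis by (simp add: lborel_prod)
qed

text \<open>Used with exponent 2 for kernels, where the Hilbert-Schmidt norm counts, and with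
  exponent 1 for symbols of Weyl transforms, where the norm of integrable functions counts.\<close>

lemma bounded_dominated_convergence:
  fixes u :: "nat \<Rightarrow> 'a::euclidean_space \<Rightarrow> complex"
  assumes u: "\<And>i. bounded_borel (u i) C r" and f: "bounded_borel f C r"
    and lim: "\<And>z. (\<lambda>i. u i z) \<longlonglongrightarrow> f z" and p: "p > 0"
  shows "(\<lambda>i. \<integral>\<^sup>+z. ennreal ((cmod (f z - u i z)) ^ p) \<partial>lborel) \<longlonglongrightarrow> 0"
proof -
  have [measurable]: "cball (0 :: 'a) r \<in> sets borel" by (intro borel_closed) simp
  have [measurable]: "\<And>i. u i \<in> borel_measurable borel" "f \<in> borel_measurable borel"
    using u f by (auto simp: bounded_borel_def)
  have "(\<lambda>i. \<integral>\<^sup>+z. ennreal ((cmod (f z - u i z)) ^ p) \<partial>lborel) \<longlonglongrightarrow> (\<integral>\<^sup>+z. 0 \<partial>(lborel :: 'a measure))"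
  proof (rule nn_integral_dominated_convergence[where w = "\<lambda>z::'a. ennreal ((2 * C) ^ p) * indicator (cball 0 r) z"])
    show "AE z in lborel. ennreal ((cmod (f z - u i z)) ^ p) \<le> ennreal ((2 * C) ^ p) * indicator (cball 0 r) z" for i
    proof (rule AE_I2)
      fix z
      have b: "cmod (f z - u i z) \<le> 2 * C"
        using norm_triangle_ineq4[of "f z" "u i z"] u[of i] f unfolding bounded_borel_def by (smt (verit))
      show "ennreal ((cmod (f z - u i z)) ^ p) \<le> ennreal ((2 * C) ^ p) * indicator (cball 0 r) z"
      proof (cases "z \<in> cball 0 r")
        case False
        then have "f z = 0" "u i z = 0" using u[of i] f by (auto simp: bounded_borel_def)
        then show ?thesis using p by (simp add: zero_power)
      next
        case True
        have "(cmod (f z - u i z)) ^ p \<le> (2 * C) ^ p" using b by (rule power_mono) simp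
        then show ?thesis using True by (simp only: indicator_simps mult_1_right ennreal_leI)
      qed
    qed
    show "(\<integral>\<^sup>+z. ennreal ((2 * C) ^ p) * indicator (cball 0 r) z \<partial>(lborel :: 'a measure)) < \<infinity>"
      using emeasure_bounded_finite[OF bounded_cball[of "0 :: 'a" r]] by (simp add: nn_integral_cmult_indicator ennreal_mult_less_top)
    show "AE z in lborel. (\<lambda>i. ennreal ((cmod (f z - u i z)) ^ p)) \<longlonglongrightarrow> 0"
    proof (rule AE_I2)
      fix z
      have "(\<lambda>i. (cmod (f z - u i z)) ^ p) \<longlonglongrightarrow> (cmod (f z - f z)) ^ p"
        by (intro tendsto_power tendsto_norm tendsto_diff tendsto_const lim)
      then have "(\<lambda>i. ennreal ((cmod (f z - u i z)) ^ p)) \<longlonglongrightarrow> ennreal ((cmod (f z - f z)) ^ p)"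
        by (rule tendsto_ennrealI)
      then show "(\<lambda>i. ennreal ((cmod (f z - u i z)) ^ p)) \<longlonglongrightarrow> 0" using p by (simp add: zero_power)
    qed
  qed measurable
  then show ?thesis by simp
qed

text \<open>The indicator of a box in the product space is a product of indicators and gives an
  operator of rank one. The monotone class induction does the rest, limits being controlled by the
  Hilbert-Schmidt bound.\<close>

lemma precompact_kernel_op:
  fixes k :: "'a::euclidean_space \<times> 'a \<Rightarrow> complex"
  assumes "bounded_borel k C r"
  shows "precompact_op (kernel_op k)"
proof (rule bounded_borel_induct[OF _ _ _ assms])
  fix a b :: "'a \<times> 'a"
  have "kernel_op (indicator (box a b)) =
    (\<lambda>f t. indicator (box (fst a) (fst b)) t * (LINT s|lborel. indicator (box (snd a) (snd b)) s * f s))"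
  proof (intro ext)
    fix f :: "'a \<Rightarrow> complex" and t
    have "indicator (box a b) (t, s) = (indicator (box (fst a) (fst b)) t * indicator (box (snd a) (snd b)) s :: complex)" for s
      by (cases a; cases b) (auto simp: indicator_def box_def Basis_prod_def ball_Un image_iff)
    then show "kernel_op (indicator (box a b)) f t =
      indicator (box (fst a) (fst b)) t * (LINT s|lborel. indicator (box (snd a) (snd b)) s * f s)"
      by (simp add: kernel_op_def mult.assoc)
  qed
  then show "precompact_op (kernel_op (indicator (box a b)))"
    by (simp add: precompact_op_rank_one indicator_square_integrable bounded_box)
next
  fix k l :: "'a \<times> 'a \<Rightarrow> complex" and c C r D s
  assume k: "bounded_borel k C r" and l: "bounded_borel l D s" and P: "precompact_op (kernel_op k)" "precompact_op (kernel_op l)"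
  show "precompact_op (kernel_op (\<lambda>z. k z + c * l z))"
  proof (rule precompact_op_cong_AE[OF precompact_op_lincomb[OF P, of c]])
    fix f :: "'a \<Rightarrow> complex" assume f: "f \<in> unit_ball_L2"
    show "kernel_op (\<lambda>z. k z + c * l z) f \<in> borel_measurable borel"
      using bounded_borel_lincomb[OF k l] unit_ball_L2D(1)[OF f] by (intro kernel_op_measurable) (auto simp: bounded_borel_def)
    have i: "integrable lborel (\<lambda>s. k (t, s) * f s)" "integrable lborel (\<lambda>s. l (t, s) * f s)" for t
      by (rule integrable_product_L2 bounded_borel_section[OF k] bounded_borel_section[OF l] unit_ball_L2D(2)[OF f])+
    have "kernel_op (\<lambda>z. k z + c * l z) f t = kernel_op k f t + c * kernel_op l f t" for t
    proof -
      have "(\<lambda>s. (k (t, s) + c * l (t, s)) * f s) = (\<lambda>s. k (t, s) * f s + c * (l (t, s) * f s))"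
        by (auto simp: algebra_simps)
      then show ?thesis using i[of t] by (simp add: kernel_op_def)
    qed
    then show "AE t in lborel. kernel_op (\<lambda>z. k z + c * l z) f t = kernel_op k f t + c * kernel_op l f t" by simp
  qed
next
  fix u and k :: "'a \<times> 'a \<Rightarrow> complex" and C r
  assume u: "\<And>i::nat. bounded_borel (u i) C r" and k: "bounded_borel k C r"
    and lim: "\<And>z. (\<lambda>i. u i z) \<longlonglongrightarrow> k z" and P: "\<And>i. precompact_op (kernel_op (u i))"
  note [measurable] = u[unfolded bounded_borel_def, THEN conjunct1] k[unfolded bounded_borel_def, THEN conjunct1]
  show "precompact_op (kernel_op k)"
  proof (rule precompact_op_limit)
    fix \<epsilon> :: real assume \<epsilon>: "\<epsilon> > 0"
    have "(\<lambda>i. \<integral>\<^sup>+z. ennreal ((cmod (k z - u i z))\<^sup>2) \<partial>lborel) \<longlonglongrightarrow> 0"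
      by (rule bounded_dominated_convergence[OF u k lim]) simp
    then have "\<forall>\<^sub>F i in sequentially. (\<integral>\<^sup>+z. ennreal ((cmod (k z - u i z))\<^sup>2) \<partial>lborel) < ennreal \<epsilon>"
      using \<epsilon> by (intro order_tendstoD) auto
    then obtain i where i: "(\<integral>\<^sup>+z. ennreal ((cmod (k z - u i z))\<^sup>2) \<partial>lborel) < ennreal \<epsilon>"
      by (auto simp: eventually_sequentially)
    have "sqnorm (\<lambda>t. kernel_op k f t - kernel_op (u i) f t) \<le> ennreal \<epsilon>" if f: "f \<in> unit_ball_L2" for f
    proof -
      note [measurable] = unit_ball_L2D(1)[OF f]
      have int: "integrable lborel (\<lambda>s. k (t, s) * f s)" "integrable lborel (\<lambda>s. u i (t, s) * f s)" for t
        by (rule integrable_product_L2 bounded_borel_section[OF k] bounded_borel_section[OF u] unit_ball_L2D(2)[OF f])+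
      have "kernel_op k f t - kernel_op (u i) f t = kernel_op (\<lambda>z. k z - u i z) f t" for t
        using int[of t] by (simp add: kernel_op_def left_diff_distrib)
      then have "sqnorm (\<lambda>t. kernel_op k f t - kernel_op (u i) f t) = sqnorm (kernel_op (\<lambda>z. k z - u i z) f)" by simp
      also have "\<dots> \<le> (\<integral>\<^sup>+z. ennreal ((cmod (k z - u i z))\<^sup>2) \<partial>lborel) * sqnorm f"
        by (rule sqnorm_kernel_op_le) measurable
      also have "\<dots> \<le> ennreal \<epsilon> * 1" using i unit_ball_L2D(3)[OF f] by (intro mult_mono) auto
      finally show ?thesis by simp
    qed
    with P show "\<exists>S. precompact_op S \<and> (\<forall>f\<in>unit_ball_L2. sqnorm (\<lambda>t. kernel_op k f t - S f t) \<le> ennreal \<epsilon>)" by blast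
  qed (use unit_ball_L2D(1) in \<open>auto intro!: kernel_op_measurable\<close>)
qed

section \<open>Weyl transforms of integrable functions\<close>

definition echar :: "'a::euclidean_space \<Rightarrow> 'a \<Rightarrow> complex"
  where "echar y t = exp (\<i> * complex_of_real (2 * pi * (y \<bullet> t)))"

lemma norm_echar [simp]: "cmod (echar y t) = 1"
  by (simp add: echar_def)

lemma borel_measurable_echar [measurable (raw)]:
  assumes [measurable]: "f \<in> borel_measurable M" "g \<in> borel_measurable M"
  shows "(\<lambda>x. echar (f x) (g x)) \<in> borel_measurable M"
  unfolding echar_def by measurable

text \<open>The Weyl transform with the phase in \<open>fst z \<bullet> snd z\<close> absorbed into
  \<open>H\<close>. The remaining phase couples \<open>snd z\<close> with \<open>t\<close> only, so
  for a product symbol the two integrations separate.\<close>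

definition untwisted_fun :: "('a::euclidean_space \<times> 'a \<Rightarrow> complex) \<Rightarrow> ('a \<Rightarrow> complex) \<Rightarrow> 'a \<Rightarrow> complex"
  where "untwisted_fun H f t = (LINT z|lborel. H z * echar (snd z) t * f (t + fst z))"

lemma untwisted_fun_measurable:
  assumes [measurable]: "H \<in> borel_measurable borel" "f \<in> borel_measurable borel"
  shows "untwisted_fun H f \<in> borel_measurable borel"
  unfolding untwisted_fun_def[abs_def] by (rule lborel.borel_measurable_lebesgue_integral) measurable

context
  fixes H :: "'a::euclidean_space \<times> 'a \<Rightarrow> complex"
  assumes H: "integrable lborel H"
begin

lemma untwisted_fun_density_measurable [measurable]: "H \<in> borel_measurable borel"
  using H by auto

lemma untwisted_fun_density_finite:
  "finite_measure (density lborel (\<lambda>z. ennreal (cmod (H z))))"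
  "emeasure (density lborel (\<lambda>z. ennreal (cmod (H z)))) UNIV = (\<integral>\<^sup>+z. ennreal (cmod (H z)) \<partial>lborel)"
proof -
  show e: "emeasure (density lborel (\<lambda>z. ennreal (cmod (H z)))) UNIV = (\<integral>\<^sup>+z. ennreal (cmod (H z)) \<partial>lborel)"
    by (simp add: emeasure_density)
  also have "\<dots> < \<infinity>" using H by (simp add: integrable_iff_bounded)
  finally show "finite_measure (density lborel (\<lambda>z. ennreal (cmod (H z))))"
    by (intro finite_measureI) simp
qed

lemma sqnorm_untwisted_fun_le:
  assumes f[measurable]: "f \<in> borel_measurable borel"
  shows "sqnorm (untwisted_fun H f) \<le> (\<integral>\<^sup>+z. ennreal (cmod (H z)) \<partial>lborel)\<^sup>2 * sqnorm f"
proof -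
  have eq: "untwisted_fun H f t = (LINT z|density lborel (\<lambda>z. ennreal (cmod (H z))). sgn (H z) * echar (snd z) t * f (t + fst z))" for t
  proof -
    have "H z * echar (snd z) t * f (t + fst z) = cmod (H z) *\<^sub>R (sgn (H z) * echar (snd z) t * f (t + fst z))" for z
      by (cases "H z = 0") (simp_all add: sgn_div_norm scaleR_conv_of_real)
    then show ?thesis unfolding untwisted_fun_def by (subst integral_density) auto
  qed
  have "sqnorm (untwisted_fun H f) = sqnorm (\<lambda>t. LINT z|density lborel (\<lambda>z. ennreal (cmod (H z))). sgn (H z) * echar (snd z) t * f (t + fst z))"
    by (simp only: sqnorm_def eq)
  also have "\<dots> \<le> (emeasure (density lborel (\<lambda>z. ennreal (cmod (H z)))) (space (density lborel (\<lambda>z. ennreal (cmod (H z))))))\<^sup>2 * sqnorm f"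
    by (rule sqnorm_average_le[OF untwisted_fun_density_finite(1) _ f]) (simp_all add: norm_mult norm_sgn)
  finally show ?thesis by (simp add: untwisted_fun_density_finite(2))
qed

lemma AE_integrable_untwisted_fun:
  assumes f: "square_integrable f"
  shows "AE t in lborel. integrable lborel (\<lambda>z. H z * echar (snd z) t * f (t + fst z))"
proof -
  note [measurable] = square_integrableD[OF f]
  have "fst \<in> borel_measurable (density lborel (\<lambda>z. ennreal (cmod (H z))))" by simp
  from AE_integrable_translates[OF untwisted_fun_density_finite(1) this f] show ?thesis
  proof eventually_elim
    fix t assume "integrable (density lborel (\<lambda>z. ennreal (cmod (H z)))) (\<lambda>z. f (t + fst z))"
    then have i: "integrable lborel (\<lambda>z. cmod (H z) *\<^sub>R f (t + fst z))"
      by (subst (asm) integrable_density) auto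
    show "integrable lborel (\<lambda>z. H z * echar (snd z) t * f (t + fst z))"
      by (rule Bochner_Integration.integrable_bound[OF i]) (auto simp: norm_mult)
  qed
qed

end

lemma untwisted_fun_lincomb:
  assumes H: "integrable lborel H" and U: "integrable lborel U" and f: "square_integrable f"
  shows "AE t in lborel. untwisted_fun (\<lambda>z. H z + c * U z) f t = untwisted_fun H f t + c * untwisted_fun U f t"
  using AE_integrable_untwisted_fun[OF H f] AE_integrable_untwisted_fun[OF U f]
proof eventually_elim
  fix t assume i: "integrable lborel (\<lambda>z. H z * echar (snd z) t * f (t + fst z))"
    "integrable lborel (\<lambda>z. U z * echar (snd z) t * f (t + fst z))"
  have "untwisted_fun (\<lambda>z. H z + c * U z) f t = (LINT z|lborel. H z * echar (snd z) t * f (t + fst z) +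
      c * (U z * echar (snd z) t * f (t + fst z)))"
    unfolding untwisted_fun_def by (intro Bochner_Integration.integral_cong refl) (simp add: algebra_simps)
  also have "\<dots> = untwisted_fun H f t + c * untwisted_fun U f t"
    unfolding untwisted_fun_def using i by (subst Bochner_Integration.integral_add) auto
  finally show "untwisted_fun (\<lambda>z. H z + c * U z) f t = untwisted_fun H f t + c * untwisted_fun U f t" .
qed

lemma precompact_untwisted_fun_limit:
  fixes H :: "'a::euclidean_space \<times> 'a \<Rightarrow> complex"
  assumes H: "integrable lborel H" and U: "\<And>i::nat. integrable lborel (U i)"
    and P: "\<And>i. precompact_op (untwisted_fun (U i))"
    and lim: "(\<lambda>i. \<integral>\<^sup>+z. ennreal (cmod (H z - U i z)) \<partial>lborel) \<longlonglongrightarrow> 0"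
  shows "precompact_op (untwisted_fun H)"
proof (rule precompact_op_limit)
  have [measurable]: "H \<in> borel_measurable borel" using H by auto
  show "untwisted_fun H f \<in> borel_measurable borel" if "f \<in> unit_ball_L2" for f
    using unit_ball_L2D(1)[OF that] by (intro untwisted_fun_measurable) auto
  fix \<epsilon> :: real assume \<epsilon>: "\<epsilon> > 0"
  \<comment> \<open>The squared operator norm is at most the square of the integral of the modulus
    of the symbol, hence the square root.\<close>
  have "\<forall>\<^sub>F i in sequentially. (\<integral>\<^sup>+z. ennreal (cmod (H z - U i z)) \<partial>lborel) < ennreal (sqrt \<epsilon>)"
    using \<epsilon> by (intro order_tendstoD(2)[OF lim]) auto
  then obtain i where i: "(\<integral>\<^sup>+z. ennreal (cmod (H z - U i z)) \<partial>lborel) < ennreal (sqrt \<epsilon>)"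
    by (auto simp: eventually_sequentially)
  have "sqnorm (\<lambda>t. untwisted_fun H f t - untwisted_fun (U i) f t) \<le> ennreal \<epsilon>" if f: "f \<in> unit_ball_L2" for f
  proof -
    have d: "integrable lborel (\<lambda>z. H z + (-1) * U i z)" using H U by simp
    have "AE t in lborel. untwisted_fun H f t - untwisted_fun (U i) f t = untwisted_fun (\<lambda>z. H z + (-1) * U i z) f t"
      using untwisted_fun_lincomb[OF H U[of i] unit_ball_L2D(2)[OF f], of "-1"] by eventually_elim simp
    then have "sqnorm (\<lambda>t. untwisted_fun H f t - untwisted_fun (U i) f t) = sqnorm (untwisted_fun (\<lambda>z. H z + (-1) * U i z) f)"
      by (rule sqnorm_cong_AE)
    also have "\<dots> \<le> (\<integral>\<^sup>+z. ennreal (cmod (H z + (-1) * U i z)) \<partial>lborel)\<^sup>2 * sqnorm f"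
      by (rule sqnorm_untwisted_fun_le[OF d unit_ball_L2D(1)[OF f]])
    also have "\<dots> \<le> (ennreal (sqrt \<epsilon>))\<^sup>2 * 1"
      using i unit_ball_L2D(3)[OF f] by (intro mult_mono power_mono) auto
    also have "\<dots> = ennreal \<epsilon>" using \<epsilon> by (simp add: ennreal_power)
    finally show ?thesis .
  qed
  with P show "\<exists>S. precompact_op S \<and> (\<forall>f\<in>unit_ball_L2. sqnorm (\<lambda>t. untwisted_fun H f t - S f t) \<le> ennreal \<epsilon>)" by blast
qed

lemma bounded_borel_integrable:
  fixes u :: "'a::euclidean_space \<Rightarrow> complex"
  assumes u: "bounded_borel u C r"
  shows "integrable lborel u"
proof -
  have [measurable]: "u \<in> borel_measurable borel" using u by (simp add: bounded_borel_def)
  have "(\<integral>\<^sup>+z. ennreal (norm (u z)) \<partial>lborel) \<le> (\<integral>\<^sup>+z. ennreal C * indicator (cball 0 r) z \<partial>(lborel :: 'a measure))"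
  proof (intro nn_integral_mono)
    fix z
    show "ennreal (norm (u z)) \<le> ennreal C * indicator (cball 0 r) z"
      using u by (cases "u z = 0") (auto simp: bounded_borel_def intro!: ennreal_leI)
  qed
  also have "\<dots> < \<infinity>"
    using emeasure_bounded_finite[OF bounded_cball[of "0 :: 'a" r]] by (simp add: nn_integral_cmult_indicator ennreal_mult_less_top)
  finally show ?thesis by (simp add: integrable_iff_bounded)
qed

text \<open>Shifting by \<open>t / (2 \<bar>t\<bar>\<^sup>2)\<close> changes the sign of the exponential.\<close>

lemma box_fourier_decay:
  fixes a b :: "'a::euclidean_space"
  assumes \<delta>: "\<delta> > 0"
  obtains R where "\<And>t. norm t > R \<Longrightarrow> cmod (LINT y|lborel. indicator (box a b) y * echar y t) \<le> \<delta>"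
proof -
  define B where "B = box a b"
  define G where "G t = (LINT y|lborel. indicator B y * echar y t)" for t
  have Bm[measurable]: "B \<in> sets borel" by (simp add: B_def)
  obtain \<rho> where \<rho>: "\<And>y. y \<in> B \<Longrightarrow> norm y \<le> \<rho>"
    using bounded_box[of a b] unfolding bounded_iff B_def by blast
  \<comment> \<open>\<open>2 * cmod (G t)\<close> is at most the integral of the difference between
    \<open>B\<close> and its shift, so decay of \<open>G\<close> reduces to continuity of
    translation in the integral norm.\<close>
  define D where "D \<tau> = (\<integral>\<^sup>+y. ennreal (cmod (indicator B y - indicator B (y + \<tau>))) \<partial>lborel)" for \<tau>
  have bb: "bounded_borel (\<lambda>y. indicator B (y + \<tau>) :: complex) 1 (\<rho> + norm \<tau>)" for \<tau>
    unfolding bounded_borel_def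
  proof (intro conjI allI impI)
    show "cmod (indicator B (y + \<tau>)) \<le> 1" for y by (simp add: indicator_def)
    show "(\<lambda>y. indicator B (y + \<tau>) :: complex) \<in> borel_measurable borel" by measurable
    fix y assume "(indicator B (y + \<tau>) :: complex) \<noteq> 0"
    then have "norm (y + \<tau>) \<le> \<rho>" using \<rho> by (auto simp: indicator_def split: if_splits)
    then show "norm y \<le> \<rho> + norm \<tau>" using norm_triangle_ineq4[of "y + \<tau>" \<tau>] by simp
  qed
  have G: "ennreal (2 * cmod (G t)) \<le> D (t /\<^sub>R (2 * (norm t)\<^sup>2))" if t: "t \<noteq> 0" for t
  proof -
    define \<tau> where "\<tau> = t /\<^sub>R (2 * (norm t)\<^sup>2)"
    have \<tau>t: "\<tau> \<bullet> t = 1 / 2" using t by (simp add: \<tau>_def power2_norm_eq_inner)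
    have e: "echar (y + \<tau>) t = - echar y t" for y
    proof -
      have "echar (y + \<tau>) t = echar y t * exp (\<i> * complex_of_real pi)"
        unfolding echar_def exp_add[symmetric] by (rule arg_cong[where f = exp]) (simp add: inner_add_left \<tau>t algebra_simps)
      then show ?thesis by simp
    qed
    have i0: "integrable lborel (\<lambda>y. indicator B (y + \<tau>') * echar y t)" for \<tau>'
      by (rule Bochner_Integration.integrable_bound[OF bounded_borel_integrable[OF bb[of \<tau>']]]) (auto simp: norm_mult)
    have "G t = (LINT y|lborel. indicator B (y + \<tau>) * echar (y + \<tau>) t)"
      unfolding G_def by (rule lborel_translate_integral[symmetric]) measurable
    also have "\<dots> = - (LINT y|lborel. indicator B (y + \<tau>) * echar y t)" by (simp add: e)
    finally have "2 * G t = (LINT y|lborel. indicator B y * echar y t) - (LINT y|lborel. indicator B (y + \<tau>) * echar y t)"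
      by (simp add: G_def)
    also have "\<dots> = (LINT y|lborel. indicator B y * echar y t - indicator B (y + \<tau>) * echar y t)"
      using i0[of 0] i0[of \<tau>] by simp
    finally have "ennreal (cmod (2 * G t)) \<le> (\<integral>\<^sup>+y. ennreal (cmod (indicator B y * echar y t - indicator B (y + \<tau>) * echar y t)) \<partial>lborel)"
      by (simp only: norm_integral_le_nn_integral)
    also have "\<dots> = D \<tau>"
      unfolding D_def by (intro nn_integral_cong) (simp flip: left_diff_distrib add: norm_mult)
    finally show ?thesis by (simp add: \<tau>_def norm_mult)
  qed
  have D0: "(\<lambda>m. D (\<tau> m)) \<longlonglongrightarrow> 0" if \<tau>: "\<tau> \<longlonglongrightarrow> 0" "\<And>m. norm (\<tau> m) \<le> 1" for \<tau> :: "nat \<Rightarrow> 'a"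
  proof -
    have cm[measurable]: "cball (0 :: 'a) (\<rho> + 1) \<in> sets borel" by (intro borel_closed) simp
    have "(\<lambda>m. D (\<tau> m)) \<longlonglongrightarrow> (\<integral>\<^sup>+y. 0 \<partial>(lborel :: 'a measure))"
      unfolding D_def
    proof (rule nn_integral_dominated_convergence[where w = "\<lambda>y::'a. indicator (cball 0 (\<rho> + 1)) y"])
      show "AE y in lborel. ennreal (cmod (indicator B y - indicator B (y + \<tau> m))) \<le> indicator (cball 0 (\<rho> + 1)) y" for m
      proof (rule AE_I2)
        fix y
        show "ennreal (cmod (indicator B y - indicator B (y + \<tau> m))) \<le> indicator (cball 0 (\<rho> + 1)) y"
        proof (cases "y \<in> cball 0 (\<rho> + 1)")
          case False
          then have "y \<notin> B" using \<rho>[of y] by auto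
          moreover have "y + \<tau> m \<notin> B"
          proof
            assume "y + \<tau> m \<in> B"
            then have "norm y \<le> \<rho> + 1" using \<rho>[of "y + \<tau> m"] norm_triangle_ineq4[of "y + \<tau> m" "\<tau> m"] \<tau>(2)[of m] by simp
            with False show False by simp
          qed
          ultimately show ?thesis by simp
        qed (auto simp: indicator_def)
      qed
      show "(\<integral>\<^sup>+y. indicator (cball 0 (\<rho> + 1)) y \<partial>(lborel :: 'a measure)) < \<infinity>"
        using emeasure_bounded_finite[OF bounded_cball[of "0 :: 'a" "\<rho> + 1"]] by simp
      \<comment> \<open>Off the boundary of the box the difference of the indicators is eventually
        0, and the boundary of a convex set is null.\<close>
      have "negligible (frontier B)" unfolding B_def by (intro negligible_convex_frontier convex_box)
      then have "AE y in lebesgue. y \<notin> frontier B" by (intro AE_not_in) (simp add: negligible_iff_null_sets)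
      then have "AE y in lborel. y \<notin> frontier B" by (simp add: AE_completion_iff)
      then show "AE y in lborel. (\<lambda>m. ennreal (cmod (indicator B y - indicator B (y + \<tau> m)))) \<longlonglongrightarrow> 0"
      proof eventually_elim
        fix y assume y: "y \<notin> frontier B"
        have l: "(\<lambda>m. y + \<tau> m) \<longlonglongrightarrow> y" using tendsto_add[OF tendsto_const \<tau>(1), of y] by simp
        have "\<forall>\<^sub>F m in sequentially. ennreal (cmod (indicator B y - indicator B (y + \<tau> m))) = 0"
        proof (cases "y \<in> B")
          case True
          have "open B" by (simp add: B_def open_box)
          from topological_tendstoD[OF l this True] show ?thesis by eventually_elim (use True in simp)
        next
          case False
          then have "y \<in> - closure B" using y by (auto simp: frontier_def B_def interior_open open_box)
          from topological_tendstoD[OF l open_Compl[OF closed_closure] this] have "\<forall>\<^sub>F m in sequentially. y + \<tau> m \<in> - closure B" by simp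
          then show ?thesis
          proof eventually_elim
            fix m assume "y + \<tau> m \<in> - closure B"
            then have "y + \<tau> m \<notin> B" using closure_subset by blast
            with False show "ennreal (cmod (indicator B y - indicator B (y + \<tau> m))) = 0" by simp
          qed
        qed
        then show "(\<lambda>m. ennreal (cmod (indicator B y - indicator B (y + \<tau> m)))) \<longlonglongrightarrow> 0" by (rule tendsto_eventually)
      qed
    qed measurable
    then show ?thesis by simp
  qed
  \<comment> \<open>Argued by contradiction so that dominated convergence along a sequence suffices:
    bad points of growing norm give shifts tending to 0, of norm at most 1 as \<open>D0\<close>
    requires.\<close>
  have "\<exists>R. \<forall>t. norm t > R \<longrightarrow> cmod (G t) \<le> \<delta>"
  proof (rule ccontr)
    assume "\<not> ?thesis"
    then have "\<forall>m::nat. \<exists>t. norm t > real m + 1 \<and> cmod (G t) > \<delta>" by (meson not_le)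
    then obtain t where t: "\<And>m::nat. norm (t m) > real m + 1" "\<And>m. cmod (G (t m)) > \<delta>" by metis
    define \<tau> where "\<tau> m = t m /\<^sub>R (2 * (norm (t m))\<^sup>2)" for m
    have n: "norm (\<tau> m) \<le> 1 / (real m + 1)" for m
    proof -
      have pos: "norm (t m) > 0" using t(1)[of m] by linarith
      then have "norm (\<tau> m) = 1 / (2 * norm (t m))" by (simp add: \<tau>_def power2_eq_square field_simps)
      also have "\<dots> \<le> 1 / (real m + 1)" using t(1)[of m] pos by (intro divide_left_mono) auto
      finally show ?thesis .
    qed
    have "(\<lambda>m. 1 / (real m + 1)) \<longlonglongrightarrow> 0" using LIMSEQ_inverse_real_of_nat by (simp add: inverse_eq_divide add.commute)
    then have "\<tau> \<longlonglongrightarrow> 0" by (rule Lim_null_comparison[rotated]) (simp add: n)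
    moreover have "norm (\<tau> m) \<le> 1" for m by (rule order_trans[OF n]) simp
    ultimately have "\<forall>\<^sub>F m in sequentially. D (\<tau> m) < ennreal (2 * \<delta>)"
      using \<delta> by (intro order_tendstoD(2)[OF D0]) auto
    then obtain m where m: "D (\<tau> m) < ennreal (2 * \<delta>)" by (auto simp: eventually_sequentially)
    have "t m \<noteq> 0" using t(1)[of m] by auto
    then have "ennreal (2 * cmod (G (t m))) \<le> D (\<tau> m)" unfolding \<tau>_def by (rule G)
    then have "ennreal (2 * cmod (G (t m))) < ennreal (2 * \<delta>)" using m by (rule le_less_trans)
    then show False using t(2)[of m] by (simp add: ennreal_less_iff)
  qed
  then show ?thesis using that unfolding G_def B_def by blast
qed

text \<open>The operator is the correlation \<open>c\<close> with \<open>A\<close> followed by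
  multiplication by \<open>G\<close>, a Fourier transform of \<open>B\<close>. As \<open>G\<close>
  decays, cutting it off at a large radius costs little in norm, and what remains is an integral
  operator with a bounded kernel of bounded support.\<close>

lemma precompact_untwisted_fun_box:
  fixes a b :: "'a::euclidean_space \<times> 'a"
  shows "precompact_op (untwisted_fun (indicator (box a b)))"
proof -
  define A where "A = box (fst a) (fst b)"
  define B where "B = box (snd a) (snd b)"
  define G where "G t = (LINT y|lborel. indicator B y * echar y t)" for t
  define c where "c f t = (LINT x|lborel. indicator A x * f (t + x))" for f :: "'a \<Rightarrow> complex" and t
  have [measurable]: "A \<in> sets borel" "B \<in> sets borel" by (simp_all add: A_def B_def)
  have ind: "indicator (box a b) (x, y) = (indicator A x * indicator B y :: complex)" for x y
    unfolding A_def B_def by (cases a; cases b) (auto simp: indicator_def box_def Basis_prod_def ball_Un image_iff)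
  obtain \<rho> where \<rho>: "\<And>x. x \<in> A \<Longrightarrow> norm x \<le> \<rho>"
    using bounded_box[of "fst a" "fst b"] unfolding bounded_iff A_def by blast
  have Gm[measurable]: "G \<in> borel_measurable borel"
    unfolding G_def[abs_def] by (rule lborel.borel_measurable_lebesgue_integral) measurable
  obtain \<beta> where \<beta>: "0 \<le> \<beta>" "\<And>t. cmod (G t) \<le> \<beta>"
  proof -
    have "emeasure lborel B < \<infinity>" unfolding B_def by (rule emeasure_bounded_finite) (rule bounded_box)
    then obtain m where m: "emeasure lborel B = ennreal m" "0 \<le> m" by (cases "emeasure lborel B") auto
    have "cmod (G t) \<le> m" for t
    proof -
      have "ennreal (cmod (G t)) \<le> (\<integral>\<^sup>+y. ennreal (cmod (indicator B y * echar y t)) \<partial>lborel)"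
        unfolding G_def by (rule norm_integral_le_nn_integral)
      also have "\<dots> = (\<integral>\<^sup>+y. indicator B y \<partial>lborel)"
        by (intro nn_integral_cong) (auto simp: norm_mult indicator_def)
      finally show ?thesis using m by simp
    qed
    with m(2) that show ?thesis by blast
  qed
  have fin: "emeasure lborel A < \<infinity>" unfolding A_def by (rule emeasure_bounded_finite) (rule bounded_box)
  obtain \<alpha> where \<alpha>: "emeasure lborel A = ennreal \<alpha>" "0 \<le> \<alpha>" using fin by (cases "emeasure lborel A") auto
  have cm: "c f \<in> borel_measurable borel" if [measurable]: "f \<in> borel_measurable borel" for f
    unfolding c_def[abs_def] by (rule lborel.borel_measurable_lebesgue_integral) measurable
  have cN: "sqnorm (c f) \<le> ennreal (\<alpha>\<^sup>2)" if f: "f \<in> unit_ball_L2" for f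
  proof -
    note [measurable] = unit_ball_L2D(1)[OF f]
    let ?\<Theta> = "density lborel (\<lambda>x. ennreal (indicator A x))"
    have e: "emeasure ?\<Theta> UNIV = ennreal \<alpha>" using \<alpha> by (simp add: emeasure_density ennreal_indicator)
    have "finite_measure ?\<Theta>" using e by (intro finite_measureI) simp
    moreover have "(\<lambda>x. x) \<in> borel_measurable ?\<Theta>" by simp
    ultimately have "sqnorm (\<lambda>t. LINT x|?\<Theta>. 1 * f (t + x)) \<le> (emeasure ?\<Theta> (space ?\<Theta>))\<^sup>2 * sqnorm f"
      by (rule sqnorm_average_le) simp_all
    moreover have "c f = (\<lambda>t. LINT x|?\<Theta>. 1 * f (t + x))"
    proof
      fix t
      have "indicator A x * f (t + x) = (indicator A x :: real) *\<^sub>R f (t + x)" for x by (simp add: indicator_def)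
      then show "c f t = (LINT x|?\<Theta>. 1 * f (t + x))"
        unfolding c_def by (subst integral_density) auto
    qed
    ultimately have "sqnorm (c f) \<le> (ennreal \<alpha>)\<^sup>2 * sqnorm f" using e by simp
    also have "\<dots> \<le> (ennreal \<alpha>)\<^sup>2 * 1" using unit_ball_L2D(3)[OF f] by (intro mult_left_mono) auto
    finally show ?thesis using \<alpha>(2) by (simp add: ennreal_power)
  qed
  have Hm: "(indicator (box a b) :: 'a \<times> 'a \<Rightarrow> complex) \<in> borel_measurable borel" by simp
  have Hi: "integrable lborel (indicator (box a b) :: 'a \<times> 'a \<Rightarrow> complex)"
  proof -
    obtain R where "\<And>z. z \<in> box a b \<Longrightarrow> norm z \<le> R" using bounded_box[of a b] unfolding bounded_iff by blast
    then have "bounded_borel (indicator (box a b) :: 'a \<times> 'a \<Rightarrow> complex) 1 R"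
      by (auto simp: bounded_borel_def indicator_def borel_measurable_indicator split: if_splits)
    then show ?thesis by (rule bounded_borel_integrable)
  qed
  have fopc: "AE t in lborel. untwisted_fun (indicator (box a b)) f t = G t * c f t" if f: "f \<in> unit_ball_L2" for f
    using AE_integrable_untwisted_fun[OF Hi unit_ball_L2D(2)[OF f]]
  proof eventually_elim
    fix t assume i: "integrable lborel (\<lambda>z. indicator (box a b) z * echar (snd z) t * f (t + fst z))"
    have "untwisted_fun (indicator (box a b)) f t =
      (LINT x|lborel. LINT y|lborel. indicator (box a b) (x, y) * echar y t * f (t + x))"
      using lborel_pair.integral_fst'[of "\<lambda>z. indicator (box a b) z * echar (snd z) t * f (t + fst z)"] i
      by (simp add: untwisted_fun_def lborel_prod)
    also have "\<dots> = (LINT x|lborel. LINT y|lborel. (indicator A x * f (t + x)) * (indicator B y * echar y t))"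
      unfolding ind by (simp add: mult_ac)
    also have "\<dots> = G t * c f t"
      by (simp add: G_def c_def mult.commute)
    finally show "untwisted_fun (indicator (box a b)) f t = G t * c f t" .
  qed
  show ?thesis
  proof (rule precompact_op_limit)
    show "untwisted_fun (indicator (box a b)) f \<in> borel_measurable borel" if "f \<in> unit_ball_L2" for f
      by (rule untwisted_fun_measurable[OF Hm unit_ball_L2D(1)[OF that]])
    fix \<epsilon> :: real assume \<epsilon>: "\<epsilon> > 0"
    \<comment> \<open>The discarded part multiplies \<open>c f\<close> by something of modulus at
      most \<delta>, and \<open>sqnorm (c f)\<close> is at most \<open>\<alpha>\<^sup>2\<close> on
      the unit ball; the summand 1 covers \<open>\<alpha> = 0\<close>.\<close>
    define \<delta> where "\<delta> = sqrt (\<epsilon> / (\<alpha>\<^sup>2 + 1))"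
    have p: "\<alpha>\<^sup>2 + 1 > 0" by (simp add: add_nonneg_pos)
    have \<delta>: "\<delta> > 0" "\<delta>\<^sup>2 * \<alpha>\<^sup>2 \<le> \<epsilon>"
    proof -
      show "\<delta> > 0" using \<epsilon> p by (simp add: \<delta>_def)
      have "\<delta>\<^sup>2 * \<alpha>\<^sup>2 \<le> \<delta>\<^sup>2 * (\<alpha>\<^sup>2 + 1)" by (intro mult_left_mono) auto
      also have "\<dots> = \<epsilon>" using \<epsilon> p by (simp add: \<delta>_def)
      finally show "\<delta>\<^sup>2 * \<alpha>\<^sup>2 \<le> \<epsilon>" .
    qed
    obtain R where R: "\<And>t. norm t > R \<Longrightarrow> cmod (G t) \<le> \<delta>"
      using box_fourier_decay[OF \<delta>(1), of "snd a" "snd b"] unfolding G_def B_def by blast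
    \<comment> \<open>Read \<open>z\<close> as the pair of \<open>t\<close> and \<open>s\<close>:
      substituting \<open>s - t\<close> for the variable of the correlation turns the truncated
      operator into an integral operator. The support is bounded because both \<open>t\<close> and
      \<open>s - t\<close> are.\<close>
    define k where "k z = indicator (cball 0 R) (fst z) * G (fst z) * indicator A (snd z - fst z)" for z :: "'a \<times> 'a"
    have [measurable]: "cball (0 :: 'a) R \<in> sets borel" by (intro borel_closed) simp
    have "bounded_borel k \<beta> (R + (R + \<rho>))"
      unfolding bounded_borel_def
    proof (intro conjI allI impI)
      show "k \<in> borel_measurable borel" unfolding k_def[abs_def] by measurable
      show "cmod (k z) \<le> \<beta>" for z
        using \<beta> by (auto simp: k_def norm_mult indicator_def)
      fix z assume "k z \<noteq> 0"
      then have z: "norm (fst z) \<le> R" "norm (snd z - fst z) \<le> \<rho>"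
        using \<rho> by (auto simp: k_def indicator_def split: if_splits)
      have "norm (snd z) \<le> R + \<rho>" using z norm_triangle_ineq[of "fst z" "snd z - fst z"] by simp
      then show "norm z \<le> R + (R + \<rho>)"
        using z(1) norm_Pair_le[of "fst z" "snd z"] by simp
    qed
    then have Pk: "precompact_op (kernel_op k)" by (rule precompact_kernel_op)
    have kc: "kernel_op k f t = indicator (cball 0 R) t * G t * c f t" if [measurable]: "f \<in> borel_measurable borel" for f t
    proof -
      have "kernel_op k f t = (LINT s|lborel. (indicator (cball 0 R) t * G t) * (indicator A (s - t) * f s))"
        by (simp add: kernel_op_def k_def mult_ac)
      also have "\<dots> = (indicator (cball 0 R) t * G t) * (LINT s|lborel. indicator A (s - t) * f s)"
        by simp
      also have "(LINT s|lborel. indicator A (s - t) * f s) = (LINT x|lborel. indicator A (x + t - t) * f (x + t))"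
        by (rule lborel_translate_integral[symmetric]) measurable
      finally show ?thesis by (simp add: c_def add.commute)
    qed
    have "sqnorm (\<lambda>t. untwisted_fun (indicator (box a b)) f t - kernel_op k f t) \<le> ennreal \<epsilon>" if f: "f \<in> unit_ball_L2" for f
    proof -
      note [measurable] = unit_ball_L2D(1)[OF f]
      have [measurable]: "c f \<in> borel_measurable borel" by (rule cm) measurable
      have "AE t in lborel. untwisted_fun (indicator (box a b)) f t - kernel_op k f t = (1 - indicator (cball 0 R) t) * G t * c f t"
        using fopc[OF f] by eventually_elim (simp add: kc algebra_simps)
      then have "sqnorm (\<lambda>t. untwisted_fun (indicator (box a b)) f t - kernel_op k f t) = sqnorm (\<lambda>t. (1 - indicator (cball 0 R) t) * G t * c f t)"
        by (rule sqnorm_cong_AE)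
      also have "\<dots> \<le> sqnorm (\<lambda>t. complex_of_real \<delta> * c f t)"
        unfolding sqnorm_def
      proof (intro nn_integral_mono ennreal_leI power_mono)
        fix t
        have "cmod ((1 - indicator (cball 0 R) t) * G t) \<le> \<delta>"
          using R[of t] \<delta>(1) by (cases "t \<in> cball 0 R") auto
        then show "cmod ((1 - indicator (cball 0 R) t) * G t * c f t) \<le> cmod (complex_of_real \<delta> * c f t)"
          using \<delta>(1) by (subst (1 2) norm_mult) (auto intro!: mult_right_mono)
      qed simp
      also have "\<dots> = ennreal (\<delta>\<^sup>2) * sqnorm (c f)" by (subst sqnorm_mult) auto
      also have "\<dots> \<le> ennreal (\<delta>\<^sup>2) * ennreal (\<alpha>\<^sup>2)" by (intro mult_left_mono cN f) simp
      also have "\<dots> \<le> ennreal \<epsilon>" using \<delta>(2) by (simp add: ennreal_leI flip: ennreal_mult)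
      finally show ?thesis .
    qed
    with Pk show "\<exists>S. precompact_op S \<and> (\<forall>f\<in>unit_ball_L2. sqnorm (\<lambda>t. untwisted_fun (indicator (box a b)) f t - S f t) \<le> ennreal \<epsilon>)" by blast
  qed
qed

lemma precompact_untwisted_fun_bounded:
  fixes H :: "'a::euclidean_space \<times> 'a \<Rightarrow> complex"
  assumes "bounded_borel H C r"
  shows "precompact_op (untwisted_fun H)"
proof (rule bounded_borel_induct[OF _ _ _ assms])
  show "precompact_op (untwisted_fun (indicator (box a b)))" for a b :: "'a \<times> 'a" by (rule precompact_untwisted_fun_box)
next
  fix k l :: "'a \<times> 'a \<Rightarrow> complex" and c C r D s
  assume k: "bounded_borel k C r" and l: "bounded_borel l D s" and P: "precompact_op (untwisted_fun k)" "precompact_op (untwisted_fun l)"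
  show "precompact_op (untwisted_fun (\<lambda>z. k z + c * l z))"
  proof (rule precompact_op_cong_AE[OF precompact_op_lincomb[OF P, of c]])
    fix f :: "'a \<Rightarrow> complex" assume f: "f \<in> unit_ball_L2"
    show "untwisted_fun (\<lambda>z. k z + c * l z) f \<in> borel_measurable borel"
      using bounded_borel_lincomb[OF k l] unit_ball_L2D(1)[OF f] by (intro untwisted_fun_measurable) (auto simp: bounded_borel_def)
    show "AE t in lborel. untwisted_fun (\<lambda>z. k z + c * l z) f t = untwisted_fun k f t + c * untwisted_fun l f t"
      by (rule untwisted_fun_lincomb[OF bounded_borel_integrable[OF k] bounded_borel_integrable[OF l] unit_ball_L2D(2)[OF f]])
  qed
next
  fix u and k :: "'a \<times> 'a \<Rightarrow> complex" and C r
  assume u: "\<And>i::nat. bounded_borel (u i) C r" and k: "bounded_borel k C r"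
    and lim: "\<And>z. (\<lambda>i. u i z) \<longlonglongrightarrow> k z" and P: "\<And>i. precompact_op (untwisted_fun (u i))"
  show "precompact_op (untwisted_fun k)"
    using bounded_dominated_convergence[OF u k lim, of 1]
    by (intro precompact_untwisted_fun_limit[OF bounded_borel_integrable[OF k] bounded_borel_integrable[OF u] P]) simp
qed

lemma precompact_untwisted_fun:
  fixes H :: "'a::euclidean_space \<times> 'a \<Rightarrow> complex"
  assumes H: "integrable lborel H"
  shows "precompact_op (untwisted_fun H)"
proof -
  have [measurable]: "H \<in> borel_measurable borel" using H by auto
  \<comment> \<open>Truncation in size and in distance from the origin. At each point it is exact
    from some index on, and the error is dominated by the modulus of \<open>H\<close>.\<close>
  define U where "U i z = (if cmod (H z) \<le> real i \<and> norm z \<le> real i then H z else 0)" for i z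
  have Um[measurable]: "U i \<in> borel_measurable borel" for i
    unfolding U_def[abs_def] by measurable
  have U: "bounded_borel (U i) (real i) (real i)" for i
    by (auto simp: bounded_borel_def Um) (auto simp: U_def split: if_splits)
  have fin: "(\<integral>\<^sup>+z. ennreal (cmod (H z)) \<partial>lborel) < \<infinity>"
    using H unfolding integrable_iff_bounded by (rule conjunct2)
  have pw: "(\<lambda>i. ennreal (cmod (H z - U i z))) \<longlonglongrightarrow> 0" for z
  proof -
    obtain n where n: "cmod (H z) \<le> real n" "norm z \<le> real n"
      using real_arch_simple[of "max (cmod (H z)) (norm z)"] by auto
    have "\<forall>\<^sub>F i in sequentially. ennreal (cmod (H z - U i z)) = 0"
    proof (rule eventually_sequentiallyI[of n])
      fix i assume "n \<le> i"
      then have "cmod (H z) \<le> real i" "norm z \<le> real i" using n by linarith+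
      then show "ennreal (cmod (H z - U i z)) = 0" by (simp add: U_def)
    qed
    then show ?thesis by (rule tendsto_eventually)
  qed
  have bd: "ennreal (cmod (H z - U i z)) \<le> ennreal (cmod (H z))" for i z
    by (simp add: U_def)
  have m: "(\<lambda>z. ennreal (cmod (H z - U i z))) \<in> borel_measurable lborel" "(\<lambda>z. ennreal (cmod (H z))) \<in> borel_measurable lborel" for i
    by measurable
  have "(\<lambda>i. \<integral>\<^sup>+z. ennreal (cmod (H z - U i z)) \<partial>lborel) \<longlonglongrightarrow> (\<integral>\<^sup>+z. 0 \<partial>(lborel :: ('a \<times> 'a) measure))"
    by (rule nn_integral_dominated_convergence[OF m(1) _ m(2) AE_I2[OF bd] fin AE_I2[OF pw]]) simp
  then have lim: "(\<lambda>i. \<integral>\<^sup>+z. ennreal (cmod (H z - U i z)) \<partial>lborel) \<longlonglongrightarrow> 0" by simp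
  show ?thesis
    by (rule precompact_untwisted_fun_limit[OF H bounded_borel_integrable[OF U] precompact_untwisted_fun_bounded[OF U] lim])
qed

text \<open>The density of \<nu>, the weight \<open>h\<close> and the part of the phase free of
  \<open>t\<close> merge into a single integrable symbol.\<close>

lemma precompact_weyl_fun:
  fixes \<nu> :: "('a::euclidean_space \<times> 'a) measure"
  assumes w: "weight \<nu> h" and ac: "absolutely_continuous lborel \<nu>"
  shows "precompact_op (weyl_fun \<nu> h)"
proof -
  have [measurable]: "h \<in> borel_measurable borel" by (rule weightD[OF w])
  have s: "sets \<nu> = sets lborel" using weightD(3)[OF w] by simp
  obtain k where k: "k \<in> borel_measurable lborel" "AE z in lborel. RN_deriv lborel \<nu> z = ennreal (k z)" "\<And>z. 0 \<le> k z"
    using sigma_finite_measure.real_RN_deriv[OF sigma_finite_lborel weightD(2)[OF w] ac s] by metis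
  have km[measurable]: "k \<in> borel_measurable borel" using k(1) by simp
  have "\<nu> = density lborel (RN_deriv lborel \<nu>)" using sigma_finite_measure.density_RN_deriv[OF sigma_finite_lborel ac s] by simp
  also have "\<dots> = density lborel (\<lambda>z. ennreal (k z))" using k by (intro density_cong) auto
  finally have \<nu>: "\<nu> = density lborel (\<lambda>z. ennreal (k z))" .
  define H where "H z = k z *\<^sub>R (h z * exp (\<i> * complex_of_real (pi * (fst z \<bullet> snd z))))" for z
  have Hm[measurable]: "H \<in> borel_measurable borel" unfolding H_def[abs_def] by measurable
  have "(\<integral>\<^sup>+z. ennreal (norm (H z)) \<partial>lborel) \<le> (\<integral>\<^sup>+z. ennreal (k z) \<partial>lborel)"
    using k(3) weightD(6)[OF w] by (intro nn_integral_mono ennreal_leI) (simp add: H_def norm_mult mult_left_le)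
  also have "\<dots> = emeasure \<nu> UNIV" unfolding \<nu> by (simp add: emeasure_density)
  also have "\<dots> < \<infinity>"
    using finite_measure.emeasure_finite[OF weightD(2)[OF w], of UNIV] by (simp add: less_top[symmetric])
  finally have Hfin: "(\<integral>\<^sup>+z. ennreal (norm (H z)) \<partial>lborel) < \<infinity>" .
  have "integrable lborel H" by (rule integrableI_bounded[OF _ Hfin]) measurable
  then have P: "precompact_op (untwisted_fun H)" by (rule precompact_untwisted_fun)
  have eq: "weyl_fun \<nu> h f t = untwisted_fun H f t" if [measurable]: "f \<in> borel_measurable borel" for f t
  proof -
    have "wchar z t = exp (\<i> * complex_of_real (pi * (fst z \<bullet> snd z))) * echar (snd z) t" for z
      unfolding wchar_def echar_def exp_add[symmetric] by (rule arg_cong[where f = exp]) (simp add: algebra_simps)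
    then have "weyl_fun \<nu> h f t = (LINT z|\<nu>. h z * (exp (\<i> * complex_of_real (pi * (fst z \<bullet> snd z))) * echar (snd z) t) * f (t + fst z))"
      unfolding weyl_fun_def by simp
    also have "\<dots> = (LINT z|lborel. k z *\<^sub>R (h z * (exp (\<i> * complex_of_real (pi * (fst z \<bullet> snd z))) * echar (snd z) t) * f (t + fst z)))"
      unfolding \<nu> using k(3) by (subst integral_density) auto
    also have "\<dots> = untwisted_fun H f t"
      unfolding untwisted_fun_def H_def by (simp add: mult_ac)
    finally show ?thesis .
  qed
  show ?thesis
  proof (rule precompact_op_cong_AE[OF P])
    fix f :: "'a \<Rightarrow> complex" assume f: "f \<in> unit_ball_L2"
    show "weyl_fun \<nu> h f \<in> borel_measurable borel" by (rule weyl_fun_measurable[OF w unit_ball_L2D(1)[OF f]])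
    show "AE t in lborel. weyl_fun \<nu> h f t = untwisted_fun H f t" using eq[OF unit_ball_L2D(1)[OF f]] by simp
  qed
qed

section \<open>Reduction to a convolution power\<close>

text \<open>\<open>precompact_op\<close> restated for maps between normed spaces, where the inner
  product and its adjoints are available.\<close>

definition precompact_map :: "('a::real_normed_vector \<Rightarrow> 'b::real_normed_vector) \<Rightarrow> bool"
  where "precompact_map T \<longleftrightarrow> (\<forall>\<epsilon>>0. \<exists>l :: 'a \<Rightarrow> nat. finite (l ` cball 0 1) \<and>
    (\<forall>x\<in>cball 0 1. \<forall>y\<in>cball 0 1. l x = l y \<longrightarrow> norm (T x - T y) \<le> \<epsilon>))"

lemma precompact_map_weyl_op:
  fixes \<nu> :: "('a::euclidean_space \<times> 'a) measure"
  assumes w: "weight \<nu> h" and ac: "absolutely_continuous lborel \<nu>"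
  shows "precompact_map (weyl_op \<nu> h)"
  unfolding precompact_map_def
proof (intro allI impI)
  fix \<epsilon> :: real assume \<epsilon>: "\<epsilon> > 0"
  have rep: "rep_L2 F \<in> unit_ball_L2" if "F \<in> cball 0 1" for F :: "'a L2"
  proof -
    have "(norm F)\<^sup>2 \<le> 1" using that by (simp add: power_le_one)
    then show ?thesis
      using norm_L2_rep[of F] square_integrable_rep[of F]
      by (simp add: unit_ball_L2_def ennreal_le_1 flip: norm_L2_rep)
  qed
  obtain l :: "('a \<Rightarrow> complex) \<Rightarrow> nat" where l: "finite (l ` unit_ball_L2)"
    "\<And>f g. f \<in> unit_ball_L2 \<Longrightarrow> g \<in> unit_ball_L2 \<Longrightarrow> l f = l g \<Longrightarrow> sqnorm (\<lambda>t. weyl_fun \<nu> h f t - weyl_fun \<nu> h g t) \<le> ennreal (\<epsilon>\<^sup>2)"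
    using precompact_opD(2)[OF precompact_weyl_fun[OF w ac], of "\<epsilon>\<^sup>2"] \<epsilon> by auto
  show "\<exists>l :: 'a L2 \<Rightarrow> nat. finite (l ` cball 0 1) \<and>
    (\<forall>x\<in>cball 0 1. \<forall>y\<in>cball 0 1. l x = l y \<longrightarrow> norm (weyl_op \<nu> h x - weyl_op \<nu> h y) \<le> \<epsilon>)"
  proof (intro exI[of _ "\<lambda>F. l (rep_L2 F)"] conjI ballI impI)
    show "finite ((\<lambda>F. l (rep_L2 F)) ` cball 0 1)"
      by (rule finite_subset[OF _ l(1)]) (use rep in blast)
    fix F G :: "'a L2" assume F: "F \<in> cball 0 1" and G: "G \<in> cball 0 1" and eq: "l (rep_L2 F) = l (rep_L2 G)"
    have "ennreal ((norm (weyl_op \<nu> h F - weyl_op \<nu> h G))\<^sup>2) =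
        sqnorm (\<lambda>t. rep_L2 (weyl_op \<nu> h F) t - rep_L2 (weyl_op \<nu> h G) t)"
      by (rule sqnorm_rep_diff[symmetric])
    also have "\<dots> = sqnorm (\<lambda>t. weyl_fun \<nu> h (rep_L2 F) t - weyl_fun \<nu> h (rep_L2 G) t)"
    proof (rule sqnorm_cong_AE)
      show "AE t in lborel. rep_L2 (weyl_op \<nu> h F) t - rep_L2 (weyl_op \<nu> h G) t =
          weyl_fun \<nu> h (rep_L2 F) t - weyl_fun \<nu> h (rep_L2 G) t"
        using rep_weyl_op[OF w, of F] rep_weyl_op[OF w, of G] by eventually_elim simp
    qed
    also have "\<dots> \<le> ennreal (\<epsilon>\<^sup>2)" by (rule l(2)[OF rep[OF F] rep[OF G] eq])
    finally have "(norm (weyl_op \<nu> h F - weyl_op \<nu> h G))\<^sup>2 \<le> \<epsilon>\<^sup>2" by (subst (asm) ennreal_le_iff) auto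
    then show "norm (weyl_op \<nu> h F - weyl_op \<nu> h G) \<le> \<epsilon>" by (rule power2_le_imp_le) (use \<epsilon> in simp)
  qed
qed

text \<open>\<open>\<parallel>T x\<parallel>\<^sup>2 \<le> \<parallel>T\<^sup>* T x\<parallel> \<parallel>x\<parallel>\<close>.\<close>

lemma precompact_map_adjoint_compose:
  fixes T S :: "'a::real_inner \<Rightarrow> 'a"
  assumes T: "bounded_linear T" and S: "bounded_linear S" and adj: "\<And>x y. T x \<bullet> y = x \<bullet> S y"
    and P: "precompact_map (\<lambda>x. S (T x))"
  shows "precompact_map T"
  unfolding precompact_map_def
proof (intro allI impI)
  fix \<epsilon> :: real assume \<epsilon>: "\<epsilon> > 0"
  \<comment> \<open>Half of \<open>\<epsilon>\<^sup>2\<close> because two points of the unit ball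
    are at distance at most 2, a factor that enters through Cauchy-Schwarz.\<close>
  obtain l :: "'a \<Rightarrow> nat" where l: "finite (l ` cball 0 1)"
    "\<And>x y. x \<in> cball 0 1 \<Longrightarrow> y \<in> cball 0 1 \<Longrightarrow> l x = l y \<Longrightarrow> norm (S (T x) - S (T y)) \<le> \<epsilon>\<^sup>2 / 2"
    using P \<epsilon> unfolding precompact_map_def by (metis half_gt_zero zero_less_power)
  interpret T: bounded_linear T by fact
  interpret S: bounded_linear S by fact
  show "\<exists>l :: 'a \<Rightarrow> nat. finite (l ` cball 0 1) \<and> (\<forall>x\<in>cball 0 1. \<forall>y\<in>cball 0 1. l x = l y \<longrightarrow> norm (T x - T y) \<le> \<epsilon>)"
  proof (intro exI[of _ l] conjI ballI impI l(1))
    fix x y assume x: "x \<in> cball 0 1" and y: "y \<in> cball 0 1" and "l x = l y"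
    then have "norm (S (T (x - y))) \<le> \<epsilon>\<^sup>2 / 2" using l(2) by (simp add: T.diff S.diff)
    moreover have "norm (x - y) \<le> 2" using norm_triangle_ineq4[of x y] x y by simp
    ultimately have "norm (x - y) * norm (S (T (x - y))) \<le> 2 * (\<epsilon>\<^sup>2 / 2)" by (intro mult_mono) auto
    moreover have "(norm (T (x - y)))\<^sup>2 \<le> norm (x - y) * norm (S (T (x - y)))"
      using Cauchy_Schwarz_ineq2[of "x - y" "S (T (x - y))"] by (simp add: power2_norm_eq_inner adj)
    ultimately have "(norm (T (x - y)))\<^sup>2 \<le> \<epsilon>\<^sup>2" by simp
    then have "norm (T (x - y)) \<le> \<epsilon>" by (rule power2_le_imp_le) (use \<epsilon> in simp)
    then show "norm (T x - T y) \<le> \<epsilon>" by (simp add: T.diff)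
  qed
qed

lemma precompact_map_compact_image:
  fixes T :: "'a::real_normed_vector \<Rightarrow> 'b::banach"
  assumes T: "bounded_linear T" and P: "precompact_map T" and B: "bounded B"
  shows "compact (closure (T ` B))"
proof -
  interpret T: bounded_linear T by fact
  obtain K where K: "K > 0" "\<And>x. x \<in> B \<Longrightarrow> norm x \<le> K" using B by (auto simp: bounded_pos)
  have "\<exists>k. finite k \<and> closure (T ` B) \<subseteq> (\<Union>x\<in>k. ball x e)" if e: "e > 0" for e
  proof -
    obtain l :: "'a \<Rightarrow> nat" where l: "finite (l ` cball 0 1)"
      "\<And>x y. x \<in> cball 0 1 \<Longrightarrow> y \<in> cball 0 1 \<Longrightarrow> l x = l y \<Longrightarrow> norm (T x - T y) \<le> e / (2 * K)"
      using P e K(1) unfolding precompact_map_def by (metis divide_pos_pos mult_pos_pos zero_less_numeral)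
    define m where "m x = l (x /\<^sub>R K)" for x
    have cb: "x /\<^sub>R K \<in> cball 0 1" if "x \<in> B" for x using K(1) K(2)[OF that] by (simp add: field_simps)
    \<comment> \<open>Picks one element of \<open>B\<close> for each label; their images form the
      finite net. The tolerance \<open>e / (2 * K)\<close> becomes \<open>e / 2\<close> once the
      scaling by \<open>K\<close> is undone, which leaves room to pass from closed balls to open
      ones.\<close>
    define s where "s n = (SOME x. x \<in> B \<and> m x = n)" for n
    have s: "s (m x) \<in> B \<and> m (s (m x)) = m x" if "x \<in> B" for x
      unfolding s_def by (rule someI[of _ x]) (simp add: that)
    have fin: "finite (m ` B)" by (rule finite_subset[OF _ l(1)]) (use cb in \<open>auto simp: m_def\<close>)
    have d: "norm (T (s (m x)) - T x) \<le> e / 2" if x: "x \<in> B" for x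
    proof -
      have "norm (T (s (m x) /\<^sub>R K) - T (x /\<^sub>R K)) \<le> e / (2 * K)"
        using s[OF x] by (intro l(2) cb x) (auto simp: m_def)
      also have "T (s (m x) /\<^sub>R K) - T (x /\<^sub>R K) = (T (s (m x)) - T x) /\<^sub>R K"
        by (simp add: T.scaleR scaleR_diff_right)
      also have "norm \<dots> = norm (T (s (m x)) - T x) / K"
        unfolding norm_scaleR using K(1) by (simp add: divide_inverse mult.commute)
      finally show ?thesis using K(1) by (simp add: field_simps)
    qed
    have "closure (T ` B) \<subseteq> (\<Union>y\<in>(\<lambda>n. T (s n)) ` m ` B. cball y (e / 2))"
    proof (rule closure_minimal)
      show "T ` B \<subseteq> (\<Union>y\<in>(\<lambda>n. T (s n)) ` m ` B. cball y (e / 2))"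
        using d by (auto simp: dist_norm)
      show "closed (\<Union>y\<in>(\<lambda>n. T (s n)) ` m ` B. cball y (e / 2))"
        using fin by (intro closed_UN) auto
    qed
    also have "\<dots> \<subseteq> (\<Union>y\<in>(\<lambda>n. T (s n)) ` m ` B. ball y e)" using e by fastforce
    finally show ?thesis using fin by (intro exI[of _ "(\<lambda>n. T (s n)) ` m ` B"]) auto
  qed
  then show ?thesis
    unfolding compact_eq_totally_bounded by (auto simp: complete_eq_closed)
qed

section \<open>Absolute continuity under convolution\<close>

lemma absolutely_continuous_trans:
  "absolutely_continuous K M \<Longrightarrow> absolutely_continuous M N \<Longrightarrow> absolutely_continuous K N"
  unfolding absolutely_continuous_def by blast

lemma null_sets_lborel_translate:
  fixes x :: "'a::euclidean_space"
  assumes E: "E \<in> null_sets lborel"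
  shows "{y. x + y \<in> E} \<in> null_sets lborel"
proof -
  have Eb: "E \<in> sets borel" using E by auto
  have "emeasure lborel {y. x + y \<in> E} = emeasure (distr lborel borel ((+) x)) E"
    using Eb by (subst emeasure_distr) (auto simp: vimage_def)
  then show ?thesis using E borel_translate[OF Eb, of x] by (simp add: lborel_distr_plus null_sets_def)
qed

lemma absolutely_continuous_conv:
  assumes fb: "finite_borel M1" "finite_borel M2" "finite_borel K1" "finite_borel K2"
    and 1: "absolutely_continuous M1 K1" and 2: "absolutely_continuous M2 K2"
  shows "absolutely_continuous (conv M1 M2) (conv K1 K2)"
  unfolding absolutely_continuous_def
proof
  fix A assume A: "A \<in> null_sets (conv M1 M2)"
  then have Ab: "A \<in> sets borel" by auto
  have "AE x in M1. {y. x + y \<in> A} \<in> null_sets M2" using A null_sets_conv_iff[OF fb(1,2) Ab] by simp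
  then have ae: "AE x in M1. {y. x + y \<in> A} \<in> null_sets K2"
    using 2 by (auto simp: absolutely_continuous_def elim!: eventually_mono)
  have "sets K1 = sets M1" by (simp add: finite_borelD(3)[OF fb(1)] finite_borelD(3)[OF fb(3)])
  then have "AE x in K1. {y. x + y \<in> A} \<in> null_sets K2"
    using 1 ae by (rule absolutely_continuous_AE)
  then show "A \<in> null_sets (conv K1 K2)" using null_sets_conv_iff[OF fb(3,4) Ab] by simp
qed

text \<open>Index \<open>j\<close> stands for \<open>2 ^ j\<close> factors, bracketed as they arise
  when an operator is squared repeatedly. This keeps the product of reflected and unreflected
  factors together instead of sorting them.\<close>

primrec conv_double :: "'a::euclidean_space measure \<Rightarrow> nat \<Rightarrow> 'a measure" where
  "conv_double M 0 = M"
| "conv_double M (Suc j) = conv (conv_double M j) (conv_double M j)"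

lemma finite_borel_conv_double: "finite_borel M \<Longrightarrow> finite_borel (conv_double M j)"
  by (induction j) (auto simp: finite_borel_conv)

lemma translate_dominated_conv_double:
  assumes "finite_borel N" "finite_borel R"
  shows "translate_dominated (conv_double (conv N R) j) (conv_double R j)"
proof (induction j)
  case 0
  show ?case using translate_dominated_conv_left[OF assms] by simp
next
  case (Suc j)
  then show ?case
    using finite_borel_conv_double[OF finite_borel_conv[OF assms]] finite_borel_conv_double[OF assms(2)]
    by (simp add: translate_dominated_conv)
qed

lemma conv_power_one:
  assumes M: "finite_borel M"
  shows "conv_power M 1 = M"
proof (rule measure_eqI)
  show "sets (conv_power M 1) = sets M" using finite_borelD(3)[OF M] by simp
  fix A assume "A \<in> sets (conv_power M 1)"
  then have A: "A \<in> sets borel" by simp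
  have "emeasure (conv_power M 1) A = emeasure (conv (conv_power M 0) M) A"
    using conv_commute[OF M finite_borel_conv_power[OF M, of 0]] by simp
  also have "\<dots> = (\<integral>\<^sup>+x. emeasure M {y. x + y \<in> A} \<partial>conv_power M 0)"
    by (rule emeasure_conv(1)[OF finite_borel_conv_power[OF M] M A])
  also have "\<dots> = emeasure M A"
    using emeasure_conv(2)[OF finite_borel_conv_power[OF M, of 0] M A]
    by (simp add: nn_integral_distr nn_integral_count_space_finite)
  finally show "emeasure (conv_power M 1) A = emeasure M A" .
qed

lemma conv_double_eq_power:
  assumes M: "finite_borel M"
  shows "conv_double M j = conv_power M (2 ^ j)"
proof (induction j)
  case 0
  show ?case using conv_power_one[OF M] by simp
next
  case (Suc j)
  then show ?case using conv_power_add[OF M, of "2 ^ j" "2 ^ j"] by (simp add: mult_2)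
qed

text \<open>Lets the exponent of a convolution power be enlarged. Almost all translates are not
  enough to ask for: here every translate of a Lebesgue null set is null for
  \<open>N\<close>.\<close>

lemma absolutely_continuous_conv_right:
  assumes fb: "finite_borel M" "finite_borel N" and N: "absolutely_continuous lborel N"
  shows "absolutely_continuous lborel (conv M N)"
  unfolding absolutely_continuous_def
proof
  fix A :: "'a set" assume A: "A \<in> null_sets lborel"
  then have Ab: "A \<in> sets borel" by auto
  have "{y. x + y \<in> A} \<in> null_sets N" for x
    using null_sets_lborel_translate[OF A, of x] N by (auto simp: absolutely_continuous_def)
  then show "A \<in> null_sets (conv M N)" using null_sets_conv_iff[OF fb Ab] by simp
qed

lemma finite_borel_reflect: "finite_borel \<nu> \<Longrightarrow> finite_borel (reflect \<nu>)"
  using finite_measure.finite_measure_distr[of \<nu> uminus borel] measurable_cong_sets[of \<nu> borel borel borel]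
  by (auto simp: finite_borel_def reflect_def)

lemma compact_weyl_op:
  fixes \<nu> :: "('a::euclidean_space \<times> 'a) measure"
  assumes w: "weight \<nu> h" and ac: "absolutely_continuous lborel (conv_power \<nu> k)"
  shows "precompact_map (weyl_op \<nu> h)"
proof -
  let ?h' = "\<lambda>z. cnj (h (- z))"
  note fb = weightD(1)[OF w] and w' = weight_reflect[OF w]
  define L where "L = conv (reflect \<nu>) \<nu>"
  have L: "finite_borel L" unfolding L_def by (rule finite_borel_conv[OF finite_borel_reflect[OF fb] fb])
  obtain \<nu>1 h1 where 1: "weight \<nu>1 h1" "absolutely_continuous L \<nu>1"
    "\<And>F. weyl_op (reflect \<nu>) ?h' (weyl_op \<nu> h F) = weyl_op \<nu>1 h1 F"
    unfolding L_def using weyl_op_compose[OF w' w] by metis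
  define P where "P = weyl_op \<nu>1 h1"
  have P: "bounded_linear P" unfolding P_def by (rule bounded_linear_weyl_op[OF 1(1)])
  have Padj: "P x \<bullet> y = x \<bullet> P y" for x y
  proof -
    have "P x \<bullet> y = y \<bullet> weyl_op (reflect \<nu>) ?h' (weyl_op \<nu> h x)"
      by (simp add: P_def 1(3) inner_commute)
    also have "\<dots> = weyl_op \<nu> h y \<bullet> weyl_op \<nu> h x" by (rule weyl_op_adjoint[OF w, symmetric])
    also have "\<dots> = x \<bullet> weyl_op (reflect \<nu>) ?h' (weyl_op \<nu> h y)"
      using weyl_op_adjoint[OF w, of x "weyl_op \<nu> h y"] by (simp add: inner_commute)
    finally show ?thesis by (simp add: P_def 1(3))
  qed
  have rep: "\<exists>\<nu>' h'. weight \<nu>' h' \<and> absolutely_continuous (conv_double L j) \<nu>' \<and> (P ^^ (2 ^ j)) = weyl_op \<nu>' h'" for j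
  proof (induction j)
    case 0
    show ?case using 1 by (auto simp: P_def)
  next
    case (Suc j)
    then obtain \<nu>' h' where \<nu>': "weight \<nu>' h'" "absolutely_continuous (conv_double L j) \<nu>'" "(P ^^ (2 ^ j)) = weyl_op \<nu>' h'"
      by blast
    obtain \<nu>2 h2 where 2: "weight \<nu>2 h2" "absolutely_continuous (conv \<nu>' \<nu>') \<nu>2"
      "\<And>F. weyl_op \<nu>' h' (weyl_op \<nu>' h' F) = weyl_op \<nu>2 h2 F"
      using weyl_op_compose[OF \<nu>'(1) \<nu>'(1)] by metis
    have "absolutely_continuous (conv_double L (Suc j)) (conv \<nu>' \<nu>')"
      using absolutely_continuous_conv[OF _ _ _ _ \<nu>'(2) \<nu>'(2)] finite_borel_conv_double[OF L] weightD(1)[OF \<nu>'(1)] by simp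
    then have "absolutely_continuous (conv_double L (Suc j)) \<nu>2" using 2(2) by (rule absolutely_continuous_trans)
    moreover have "P ^^ (2 ^ Suc j) = weyl_op \<nu>2 h2"
      using 2(3) \<nu>'(3) by (simp add: mult_2 funpow_add fun_eq_iff)
    ultimately show ?case using 2(1) by blast
  qed
  \<comment> \<open>Only powers of two are reached by squaring; \<open>2 ^ k\<close> is one that is
    at least \<open>k\<close>, and the \<open>i\<close> surplus factors preserve absolute
    continuity.\<close>
  have "k \<le> 2 ^ k" by (simp add: less_imp_le)
  then obtain i where i: "2 ^ k = i + k" by (metis le_add_diff_inverse2)
  have "absolutely_continuous lborel (conv_double \<nu> k)"
    using absolutely_continuous_conv_right[OF finite_borel_conv_power[OF fb] finite_borel_conv_power[OF fb] ac, of i]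
    by (simp add: conv_double_eq_power[OF fb] conv_power_add[OF fb] i)
  \<comment> \<open>From here the reflected factors are dealt with: every translate of a Lebesgue
    null set is null for the power of \<nu>, so by domination the set itself is null for the power
    of \<open>L\<close>.\<close>
  then have "{z. w + z \<in> E} \<in> null_sets (conv_double \<nu> k)" if "E \<in> null_sets lborel" for w E
    using null_sets_lborel_translate[OF that, of w] unfolding absolutely_continuous_def by (rule subsetD)
  then have "E \<in> null_sets (conv_double L k)" if "E \<in> null_sets lborel" for E
    using translate_dominated_conv_double[OF finite_borel_reflect[OF fb] fb, of k] that null_setsD2[OF that]
    unfolding translate_dominated_def L_def by simp
  then have "absolutely_continuous lborel (conv_double L k)"
    by (auto simp: absolutely_continuous_def)
  moreover obtain \<nu>' h' where \<nu>': "weight \<nu>' h'" "absolutely_continuous (conv_double L k) \<nu>'" "(P ^^ (2 ^ k)) = weyl_op \<nu>' h'"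
    using rep by blast
  ultimately have Pk: "precompact_map (P ^^ (2 ^ k))"
    using precompact_map_weyl_op[OF \<nu>'(1) absolutely_continuous_trans] by simp
  have adjp: "(P ^^ n) x \<bullet> y = x \<bullet> (P ^^ n) y" for n x y
    by (induction n arbitrary: x y) (simp_all add: Padj funpow_swap1)
  \<comment> \<open>Halving the exponent: \<open>T = P ^^ (2 ^ m)\<close> is its own adjoint, so
    \<open>precompact_map_adjoint_compose\<close> passes from the square of \<open>T\<close> to
    \<open>T\<close>.\<close>
  have "precompact_map (P ^^ (2 ^ m)) \<Longrightarrow> precompact_map P" for m
  proof (induction m)
    case (Suc m)
    define T where "T = P ^^ (2 ^ m)"
    have bl: "bounded_linear T"
      using rep[of m] bounded_linear_weyl_op unfolding T_def by metis
    have "P ^^ (2 ^ Suc m) = (\<lambda>x. T (T x))"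
      by (simp add: T_def mult_2 funpow_add fun_eq_iff)
    then have "precompact_map (\<lambda>x. T (T x))" using Suc.prems by simp
    then have "precompact_map T"
      by (rule precompact_map_adjoint_compose[OF bl bl, rotated]) (simp add: T_def adjp)
    then show ?case using Suc.IH by (simp add: T_def)
  qed simp
  then have "precompact_map P" using Pk by blast
  then have "precompact_map (\<lambda>x. weyl_op (reflect \<nu>) ?h' (weyl_op \<nu> h x))" by (simp add: P_def 1(3))
  then show ?thesis
    by (rule precompact_map_adjoint_compose[OF bounded_linear_weyl_op[OF w] bounded_linear_weyl_op[OF w'] weyl_op_adjoint[OF w]])
qed

theorem theorem1p2:
  fixes M :: "((real^'n) \<times> (real^'n)) set" and \<mu> :: "((real^'n) \<times> (real^'n)) set \<Rightarrow> complex"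
  assumes "real_analytic_submanifold TYPE('k::finite) M"
    and "connected M"
    and "\<forall>a b. a \<noteq> 0 \<longrightarrow> \<not> M \<subseteq> {z. a \<bullet> z = b}"
    and "smooth_measure TYPE('k) M \<mu>"
  shows "compact_operator (weyl_transform \<mu>)"
proof -
  obtain \<sigma> \<psi> where \<sigma>: "riemannian_volume TYPE('k) M \<sigma>" and "smooth_on UNIV \<psi>"
    and K: "compact (closure {z. \<psi> z \<noteq> 0} \<inter> M)" and \<mu>: "\<And>A. A \<in> sets borel \<Longrightarrow> \<mu> A = (LINT z:A|\<sigma>. \<psi> z)"
    using assms(4) unfolding smooth_measure_def by blast
  then have "Ck_on 0 UNIV \<psi>" unfolding smooth_on_def by blast
  then have c\<psi>: "continuous_on UNIV \<psi>" by simp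
  then have [measurable]: "\<psi> \<in> borel_measurable borel" by (rule borel_measurable_continuous_onI)
  have s: "sets \<sigma> = sets borel" using \<sigma> by (simp add: riemannian_volume_def)
  note [measurable_cong] = s
  define K where "K = closure {z. \<psi> z \<noteq> 0} \<inter> M"
  have Kb[measurable]: "K \<in> sets borel" using K by (simp add: K_def borel_compact)
  obtain C :: "((real^'k) set \<times> (real^'k \<Rightarrow> (real^'n) \<times> (real^'n)) \<times> (real^'k) \<times> real) set"
    where C: "finite C" "\<And>V \<phi> p r. (V, \<phi>, p, r) \<in> C \<Longrightarrow> analytic_chart M V \<phi> p r"
      "K \<subseteq> (\<Union>(V, \<phi>, p, r)\<in>C. \<phi> ` ball p r)"
    using compact_chart_cover[OF assms(1) K] unfolding K_def by blast
  have img: "\<phi> ` (N \<inter> ball p r) \<in> sets borel" if "(V, \<phi>, p, r) \<in> C" "N \<in> sets borel" for V \<phi> p r N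
    using C(2)[OF that(1)] that(2) analytic_chart_ball[OF C(2)[OF that(1)]]
    by (intro regular_parametrization_borel[of M V]) (auto simp: analytic_chart_def)
  \<comment> \<open>On \<open>M\<close> the function \<psi> vanishes outside \<open>K\<close>, and
    \<sigma> does not charge the complement of \<open>M\<close>.\<close>
  have K0: "AE z in \<sigma>. z \<notin> K \<longrightarrow> \<psi> z = 0"
  proof (rule AE_I')
    have b: "{z. \<psi> z \<noteq> 0} - K \<in> sets borel" by measurable
    moreover have "({z. \<psi> z \<noteq> 0} - K) \<inter> M = {}" using closure_subset[of "{z. \<psi> z \<noteq> 0}"] by (auto simp: K_def)
    ultimately have "emeasure \<sigma> ({z. \<psi> z \<noteq> 0} - K) = 0" using \<sigma> by (simp add: riemannian_volume_def)
    then show "{z. \<psi> z \<noteq> 0} - K \<in> null_sets \<sigma>" using b by (simp add: null_sets_def s)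
  qed auto
  \<comment> \<open>The volume of \<open>M\<close> may be infinite, so finiteness is established on
    \<open>K\<close> alone, through the finite cover.\<close>
  have Kfin: "emeasure \<sigma> K < \<infinity>"
  proof -
    have "emeasure \<sigma> K \<le> emeasure \<sigma> (\<Union>c\<in>C. case c of (V, \<phi>, p, r) \<Rightarrow> \<phi> ` ball p r)"
      using C(1,3) img[where N = UNIV] by (intro emeasure_mono sets.finite_UN) (auto simp: s)
    also have "\<dots> \<le> (\<Sum>c\<in>C. emeasure \<sigma> (case c of (V, \<phi>, p, r) \<Rightarrow> \<phi> ` ball p r))"
      using C(1) img[where N = UNIV] by (intro emeasure_subadditive_finite) (auto simp: s)
    also have "\<dots> < \<infinity>"
    proof -
      have "emeasure \<sigma> (case c of (V, \<phi>, p, r) \<Rightarrow> \<phi> ` ball p r) < \<infinity>" if c: "c \<in> C" for c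
      proof -
        obtain V \<phi> p r where ce: "c = (V, \<phi>, p, r)" by (cases c) auto
        show ?thesis using chart_ball_finite[OF \<sigma> C(2)[OF c[unfolded ce]]] by (simp add: ce)
      qed
      then show ?thesis using C(1) by simp
    qed
    finally show ?thesis .
  qed
  obtain \<beta> where \<beta>: "\<And>z. z \<in> K \<Longrightarrow> cmod (\<psi> z) \<le> \<beta>"
  proof -
    have "compact (\<psi> ` K)" using K by (intro compact_continuous_image continuous_on_subset[OF c\<psi>]) (auto simp: K_def)
    from compact_imp_bounded[OF this] that show ?thesis by (auto simp: bounded_iff)
  qed
  have int\<psi>: "integrable \<sigma> \<psi>"
  proof -
    have "(\<integral>\<^sup>+z. ennreal (norm (\<psi> z)) \<partial>\<sigma>) \<le> (\<integral>\<^sup>+z. ennreal \<beta> * indicator K z \<partial>\<sigma>)"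
      using K0 \<beta> by (intro nn_integral_mono_AE) (auto elim!: eventually_mono simp: indicator_def ennreal_leI)
    also have "\<dots> < \<infinity>" using Kfin by (simp add: nn_integral_cmult_indicator s ennreal_mult_less_top)
    finally show ?thesis by (intro integrableI_bounded) measurable
  qed
  \<comment> \<open>Polar decomposition of \<psi> times \<sigma>; at the zeros of \<psi> the weight
    is 0.\<close>
  define \<nu> where "\<nu> = density \<sigma> (\<lambda>z. ennreal (cmod (\<psi> z)))"
  define h where "h z = sgn (\<psi> z)" for z
  have hm[measurable]: "h \<in> borel_measurable borel" unfolding h_def[abs_def] by measurable
  have w: "weight \<nu> h"
  proof -
    have "emeasure \<nu> (space \<nu>) = (\<integral>\<^sup>+z. norm (\<psi> z) \<partial>\<sigma>)"
      by (simp add: \<nu>_def emeasure_density cong: nn_integral_cong)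
    also have "\<dots> < \<infinity>" using int\<psi> unfolding integrable_iff_bounded by (rule conjunct2)
    finally have "finite_measure \<nu>" by (intro finite_measureI) simp
    moreover have "sets \<nu> = sets borel" by (simp add: \<nu>_def s)
    moreover have "cmod (h z) \<le> 1" for z by (simp add: h_def norm_sgn)
    ultimately show ?thesis using hm by (simp add: weight_def finite_borel_def)
  qed
  have weyl: "weyl_transform \<mu> = weyl_op \<nu> h"
  proof
    fix F :: "(real^'n) L2"
    have [measurable]: "rep_L2 F \<in> borel_measurable borel" by (rule square_integrableD[OF square_integrable_rep])
    \<comment> \<open>The pair \<sigma>, \<psi> evaluates the integral that defines the Weyl
      transform; the modulus of \<psi> is moved into \<nu> afterwards.\<close>
    have d: "has_complex_density \<mu> \<sigma> \<psi>" using s int\<psi> \<mu> by (simp add: has_complex_density_def)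
    have "complex_integral \<mu> (\<lambda>(x, y). exp (\<i> * complex_of_real (pi * (x \<bullet> y + 2 * (y \<bullet> t)))) * rep_L2 F (t + x)) =
      weyl_fun \<nu> h (rep_L2 F) t" for t
    proof -
      have e: "(\<lambda>(x, y). exp (\<i> * complex_of_real (pi * (x \<bullet> y + 2 * (y \<bullet> t)))) * rep_L2 F (t + x)) =
          (\<lambda>z. wchar z t * rep_L2 F (t + fst z))"
        by (auto simp: wchar_def)
      have "complex_integral \<mu> (\<lambda>z. wchar z t * rep_L2 F (t + fst z)) = (LINT z|\<sigma>. wchar z t * rep_L2 F (t + fst z) * \<psi> z)"
        by (rule complex_integral_eq[OF d]) measurable
      also have "\<dots> = (LINT z|\<sigma>. cmod (\<psi> z) *\<^sub>R (h z * wchar z t * rep_L2 F (t + fst z)))"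
      proof (rule Bochner_Integration.integral_cong[OF refl])
        fix z
        have "\<psi> z = cmod (\<psi> z) *\<^sub>R h z" by (cases "\<psi> z = 0") (simp_all add: h_def sgn_div_norm)
        then show "wchar z t * rep_L2 F (t + fst z) * \<psi> z = cmod (\<psi> z) *\<^sub>R (h z * wchar z t * rep_L2 F (t + fst z))"
          by (metis mult.commute mult.left_commute mult_scaleR_right)
      qed
      also have "\<dots> = weyl_fun \<nu> h (rep_L2 F) t"
        unfolding weyl_fun_def \<nu>_def by (subst integral_density) auto
      finally show ?thesis unfolding e .
    qed
    then show "weyl_transform \<mu> F = weyl_op \<nu> h F"
      unfolding weyl_transform_def weyl_op_def by simp
  qed
  \<comment> \<open>As many factors as the ambient space has dimensions, one for each direction to
    be spanned.\<close>
  have ac: "absolutely_continuous lborel (conv_power \<nu> (DIM((real^'n) \<times> (real^'n))))"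
  proof (rule conv_power_absolutely_continuous[where C = C and \<Phi> = "\<lambda>(V, \<phi>, p, r). \<phi>" and U = "\<lambda>(V, \<phi>, p, r). ball p r"
        and \<Phi>' = "\<lambda>(V, \<phi>, p, r) x. frechet_derivative \<phi> (at x)", OF weightD(1)[OF w] C(1)])
    fix P :: "(real^'n) \<times> (real^'n) \<Rightarrow> bool"
    assume P: "\<And>c. c \<in> C \<Longrightarrow> AE x in lborel. x \<in> (case c of (V, \<phi>, p, r) \<Rightarrow> ball p r) \<longrightarrow> P ((case c of (V, \<phi>, p, r) \<Rightarrow> \<phi>) x)"
    \<comment> \<open>\<open>P\<close> is arbitrary, so the set where it fails is enclosed in a
      Borel null set of parameters before the chart carries it to \<open>M\<close>; images of Borel
      null sets are null for \<sigma>.\<close>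
    have "\<exists>N\<in>null_sets \<sigma>. \<forall>x\<in>ball p r. \<not> P (\<phi> x) \<longrightarrow> \<phi> x \<in> N" if c: "(V, \<phi>, p, r) \<in> C" for V \<phi> p r
    proof -
      obtain N where N: "N \<in> null_sets lborel" "{x \<in> space lborel. \<not> (x \<in> ball p r \<longrightarrow> P (\<phi> x))} \<subseteq> N"
        using P[OF c] by (auto simp: eventually_ae_filter)
      have "N \<inter> ball p r \<in> null_sets lborel" using N(1) by (intro null_set_Int2) auto
      then have "\<phi> ` (N \<inter> ball p r) \<in> null_sets \<sigma>"
        using C(2)[OF c] analytic_chart_ball[OF C(2)[OF c]]
        by (intro chart_null_set[OF \<sigma>, of V]) (auto simp: analytic_chart_def)
      moreover have "\<forall>x\<in>ball p r. \<not> P (\<phi> x) \<longrightarrow> \<phi> x \<in> \<phi> ` (N \<inter> ball p r)" using N(2) by auto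
      ultimately show ?thesis by blast
    qed
    then have "\<forall>c\<in>C. \<exists>N. N \<in> null_sets \<sigma> \<and> (case c of (V, \<phi>, p, r) \<Rightarrow> \<forall>x\<in>ball p r. \<not> P (\<phi> x) \<longrightarrow> \<phi> x \<in> N)"
      by (auto simp: Bex_def)
    from bchoice[OF this] obtain N where
      "\<forall>c\<in>C. N c \<in> null_sets \<sigma> \<and> (case c of (V, \<phi>, p, r) \<Rightarrow> \<forall>x\<in>ball p r. \<not> P (\<phi> x) \<longrightarrow> \<phi> x \<in> N c)"
      by (rule exE)
    then have N: "N c \<in> null_sets \<sigma>"
      "case c of (V, \<phi>, p, r) \<Rightarrow> \<forall>x\<in>ball p r. \<not> P (\<phi> x) \<longrightarrow> \<phi> x \<in> N c" if "c \<in> C" for c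
      using that by simp_all
    have "AE z in \<sigma>. z \<notin> (\<Union>c\<in>C. N c)"
      using C(1) N(1) by (intro AE_not_in null_sets_UN' countable_finite) auto
    then have "AE z in \<sigma>. \<psi> z \<noteq> 0 \<longrightarrow> P z"
      using K0
    proof eventually_elim
      fix z assume z: "z \<notin> (\<Union>c\<in>C. N c)" "z \<notin> K \<longrightarrow> \<psi> z = 0"
      show "\<psi> z \<noteq> 0 \<longrightarrow> P z"
      proof
        assume "\<psi> z \<noteq> 0"
        then obtain V \<phi> p r x where c: "(V, \<phi>, p, r) \<in> C" "x \<in> ball p r" "z = \<phi> x" using z(2) C(3) by blast
        have "\<forall>x\<in>ball p r. \<not> P (\<phi> x) \<longrightarrow> \<phi> x \<in> N (V, \<phi>, p, r)" using N(2)[OF c(1)] by simp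
        then show "P z" using z(1) c by blast
      qed
    qed
    then show "AE z in \<nu>. P z"
      unfolding \<nu>_def by (subst AE_density) (auto elim!: eventually_mono)
  next
    show "open (case c of (V, \<phi>, p, r) \<Rightarrow> ball p r)" for c :: "(real^'k) set \<times> (real^'k \<Rightarrow> (real^'n) \<times> (real^'n)) \<times> (real^'k) \<times> real"
      by (simp split: prod.split)
  next
    fix c x assume c: "c \<in> C" and x: "x \<in> (case c of (V, \<phi>, p, r) \<Rightarrow> ball p r)"
    obtain V \<phi> p r where ce: "c = (V, \<phi>, p, r)" by (cases c) auto
    note ch = C(2)[OF c[unfolded ce]]
    show "((case c of (V, \<phi>, p, r) \<Rightarrow> \<phi>) has_derivative (case c of (V, \<phi>, p, r) \<Rightarrow> \<lambda>x. frechet_derivative \<phi> (at x)) x) (at x)"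
      using smooth_on_derivative[OF analytic_chart_smooth[OF ch], of x] analytic_chart_ball[OF ch] x by (auto simp: ce)
  next
    fix c v assume c: "c \<in> C"
    obtain V \<phi> p r where ce: "c = (V, \<phi>, p, r)" by (cases c) auto
    note ch = C(2)[OF c[unfolded ce]]
    show "continuous_on (case c of (V, \<phi>, p, r) \<Rightarrow> ball p r) (\<lambda>x. (case c of (V, \<phi>, p, r) \<Rightarrow> \<lambda>x. frechet_derivative \<phi> (at x)) x v)"
      using continuous_on_subset[OF smooth_on_derivative_continuous[OF analytic_chart_smooth[OF ch]] analytic_chart_ball[OF ch]]
      by (simp add: ce)
  next
    fix c and a :: "(real^'n) \<times> (real^'n)" assume c: "c \<in> C" and a: "a \<noteq> 0"
    obtain V \<phi> p r where ce: "c = (V, \<phi>, p, r)" by (cases c) auto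
    show "AE x in lborel. x \<in> (case c of (V, \<phi>, p, r) \<Rightarrow> ball p r) \<longrightarrow>
        (\<exists>v. a \<bullet> (case c of (V, \<phi>, p, r) \<Rightarrow> \<lambda>x. frechet_derivative \<phi> (at x)) x v \<noteq> 0)"
      using analytic_chart_nondegenerate[OF assms(1-3) C(2)[OF c[unfolded ce]] a] by (simp add: ce)
  qed
  show ?thesis
    unfolding compact_operator_def weyl
    using bounded_linear_weyl_op[OF w] weyl_op_scaleC[OF w]
      precompact_map_compact_image[OF bounded_linear_weyl_op[OF w] compact_weyl_op[OF w ac]] by blast
qed

end
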